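(* Let $k\geq 4$, let $\varepsilon>0$, and let $\mathcal{H}$ be a $2$-contractible $\ell$-overlapping $k$-tree with $t$ edges and cross-cut number $\sigma(\mathcal{H})$. There exist $c=c(\varepsilon,\mathcal{H})>0$ and $c'=c'(\varepsilon,\mathcal{H})>0$ such that, for all sufficiently large $n$, the following holds. Let $\mathcal{F}$ be a $k$-graph on $[n]$ with $|\mathcal{F}|=a\binom{n}{k-1}$, where $a\geq\sigma(\mathcal{H})-1+\varepsilon$. Then there is a collection $\mathcal{K}$ of copies of $\mathcal{H}$ in $\mathcal{F}$ with $|\mathcal{K}|\geq c'an^{k-1}(an^{k-\ell-1})^{t-1}$ and such that for all $1\leq b\leq t$, \[\Delta_b(\mathcal{K})\leq c\,[\tau(\mathcal{F})]^{b-1}\frac{|\mathcal{K}|}{|\mathcal{F}|},\qquad\text{where } \tau(\mathcal{F})=\frac{1}{an^{k-\ell-1}}.\]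
   Context: A copy of $\mathcal{H}$ in $\mathcal{F}$ is a subgraph of $\mathcal{F}$ isomorphic to $\mathcal{H}$, viewed as a $t$-element set of edges of $\mathcal{F}$; a collection $\mathcal{K}$ of copies is a $t$-uniform hypergraph on vertex set $E(\mathcal{F})$. $\Delta_b(\mathcal{K})$ is the maximum, over sets $S$ of $b$ edges of $\mathcal{F}$, of the number of copies in $\mathcal{K}$ containing $S$. A hypergraph is $\ell$-overlapping if any two edges share at most $\ell$ vertices. Hypertrees: a single edge is a hypertree; a hypergraph with at least two edges is a hypertree if it has an edge $E$ such that removing $E$ leaves a hypertree $\mathcal{H}'$ and some edge $F$ of $\mathcal{H}'$ satisfies $E\cap V(\mathcal{H}')=E\cap F$. A $k$-tree is a $k$-uniform hypertree; it is $2$-contractible if each edge contains at least two vertices of degree $1$. A cross-cut is a vertex set meeting each edge in exactly one vertex; $\sigma(\mathcal{H})$ is the minimum cross-cut size. *)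

theory Defs
  imports Complex_Main
begin

text \<open>A hypergraph is represented by its set of edges; its vertex set is the union of the edges.\<close>

definition uniform_hypergraph :: "nat \<Rightarrow> 'v set set \<Rightarrow> bool" where
  "uniform_hypergraph k H \<longleftrightarrow> (\<forall>E\<in>H. finite E \<and> card E = k)"

definition overlapping :: "nat \<Rightarrow> 'v set set \<Rightarrow> bool" where
  "overlapping l H \<longleftrightarrow> (\<forall>E\<in>H. \<forall>F\<in>H. E \<noteq> F \<longrightarrow> card (E \<inter> F) \<le> l)"

inductive hypertree :: "'v set set \<Rightarrow> bool" where
  single: "hypertree {E}"
| extend: "\<lbrakk>hypertree H'; E \<notin> H'; F \<in> H'; E \<inter> \<Union>H' = E \<inter> F\<rbrakk>
    \<Longrightarrow> hypertree (insert E H')"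

definition k_tree :: "nat \<Rightarrow> 'v set set \<Rightarrow> bool" where
  "k_tree k H \<longleftrightarrow> uniform_hypergraph k H \<and> hypertree H"

definition degree :: "'v set set \<Rightarrow> 'v \<Rightarrow> nat" where
  "degree H v = card {E \<in> H. v \<in> E}"

definition two_contractible :: "'v set set \<Rightarrow> bool" where
  "two_contractible H \<longleftrightarrow> (\<forall>E\<in>H. 2 \<le> card {v \<in> E. degree H v = 1})"

definition cross_cut :: "'v set set \<Rightarrow> 'v set \<Rightarrow> bool" where
  "cross_cut H S \<longleftrightarrow> S \<subseteq> \<Union>H \<and> (\<forall>E\<in>H. card (S \<inter> E) = 1)"

text \<open>The minimum is attained for every 2-contractible \<open>k\<close>-tree: choosing a vertex of degree 1
  in each edge gives a cross-cut.\<close>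

definition cross_cut_number :: "'v set set \<Rightarrow> nat" where
  "cross_cut_number H = (LEAST s. \<exists>S. cross_cut H S \<and> card S = s)"

definition hypergraph_isomorphic :: "'v set set \<Rightarrow> 'w set set \<Rightarrow> bool" where
  "hypergraph_isomorphic H G \<longleftrightarrow>
     (\<exists>f. bij_betw f (\<Union>H) (\<Union>G) \<and> (\<lambda>E. f ` E) ` H = G)"

definition copies :: "'v set set \<Rightarrow> 'w set set \<Rightarrow> 'w set set set" where
  "copies H F = {C. C \<subseteq> F \<and> hypergraph_isomorphic H C}"

text \<open>\<open>\<Delta>\<^sub>b(K)\<close> for a collection \<open>K\<close> of edge subsets of the finite hypergraph \<open>F\<close>;
  meaningful only for \<open>b \<le> card F\<close>, since otherwise the maximum is over the empty set.\<close>

definition max_codegree :: "'w set set \<Rightarrow> 'w set set set \<Rightarrow> nat \<Rightarrow> nat" where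
  "max_codegree F K b = Max ((\<lambda>S. card {C \<in> K. S \<subseteq> C}) ` {S. S \<subseteq> F \<and> card S = b})"

end

theory Submission
  imports Defs "HOL-Library.FuncSet"
begin

text \<open>
  Label the edges of \<open>F\<close>, or larger configurations of vertices, as tuples. Every family of tuples has a
  subfamily of positive proportion in which, for every set \<open>P\<close> of positions and every position \<open>p\<close>,
  the entries on \<open>P\<close> either determine the entry at \<open>p\<close>, or no single value at \<open>p\<close> accounts for more
  than a tiny fraction of the tuples with given entries on \<open>P\<close>. This replaces the
  sunflower-homogeneous subfamilies of the delta-system method, and it gives counting for free: a
  random walk along the hypertree, which picks the tuple of a new edge uniformly among those that
  agree with its parent on the common vertices, produces a copy of \<open>H\<close> with probability at least
  \<open>1/2\<close>, and its law is spread enough to bound all codegrees.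

  If many edges of \<open>F\<close> have all their \<open>(k-1)\<close>-subsets in more than a constant number of edges, no
  position is determined by the others and \<open>H\<close> embeds. Otherwise almost every edge contains a
  \<open>(k-1)\<close>-set of bounded degree, and since \<open>F\<close> has more than \<open>\<sigma>(H) - 1 + \<epsilon>/2\<close> such edges per
  \<open>(k-1)\<close>-set, a positive proportion of the \<open>(k-1)\<close>-sets extend to edges by \<open>\<sigma>(H)\<close> different vertices.
  Homogenise these tuples of length \<open>k - 1 + \<sigma>(H)\<close>. Either two positions of some edge can host two
  vertices of degree 1 of every edge of \<open>H\<close>, or the vertices of a minimum cross-cut of \<open>H\<close> can be placed
  at the \<open>\<sigma>(H)\<close> extra positions.
\<close>

section \<open>Homogeneous families of tuples\<close>

text \<open>Determined positions are the obstacle. There the walk is forced to repeat the entry of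
  the parent, so two different vertices of \<open>H\<close> placed at such a position could receive
  the same value. Hence a vertex outside the parent edge must sit at an undetermined position or at
  one that no other vertex of \<open>H\<close> uses. The two placements realise these alternatives.
  Vertices of degree 1 lie in no intersection of edges, so if each edge keeps two of them at fixed
  positions, the entries taken over from the parent always miss those two positions. A cross-cut
  gives each of its vertices a position of its own, which is why the density must supply \<sigma>(H)
  extensions of one (k-1)-set.

  The scale a n^(k-l-1) is a fiber size: fixing at most l entries leaves, up to constants, at least
  |F| / n^l tuples. The walk yields only a weighting of the copies, in which prescribing b edges
  costs a factor of order |F| (a n^(k-l-1))^(b-1). The unweighted collection is extracted afterwards
  as a maximal one under codegree caps, so its size and its codegrees are controlled by the same
  scale.\<close>

lemma popular_value:
  assumes "finite A" "finite B" "B \<noteq> {}" "f ` A \<subseteq> B"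
  shows "\<exists>b\<in>B. card A \<le> card B * card {a \<in> A. f a = b}"
proof -
  have "f -` {b} \<inter> A = {a \<in> A. f a = b}" for b by auto
  then show ?thesis using pigeonhole_card[of f A B] assms by (auto simp: mult.commute)
qed

text \<open>An extremal choice replaces repeated deletion: \<open>Z\<close> maximises its size minus
  the thresholds of all classes still present. Deleting a class below its threshold would lose fewer
  tuples than the threshold it frees, and other classes vanishing with it only help because
  thresholds are nonnegative.\<close>

lemma subfamily_with_large_classes:
  fixes key :: "'i \<Rightarrow> 'z \<Rightarrow> 'k" and thr :: "'i \<Rightarrow> 'k \<Rightarrow> real"
  assumes fin: "finite Z0" "finite I" and nonneg: "\<And>i x. i \<in> I \<Longrightarrow> 0 \<le> thr i x"
  shows "\<exists>Z\<subseteq>Z0. real (card Z0) - (\<Sum>i\<in>I. \<Sum>x\<in>key i ` Z0. thr i x) \<le> real (card Z) \<and>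
    (\<forall>z\<in>Z. \<forall>i\<in>I. thr i (key i z) \<le> real (card {z' \<in> Z. key i z' = key i z}))"
proof -
  define \<Psi> where "\<Psi> Z = real (card Z) - (\<Sum>i\<in>I. \<Sum>x\<in>key i ` Z. thr i x)" for Z
  have "\<exists>Z\<in>Pow Z0. \<forall>Z'\<in>Pow Z0. \<Psi> Z' \<le> \<Psi> Z"
  proof -
    have f: "finite (\<Psi> ` Pow Z0)" "\<Psi> ` Pow Z0 \<noteq> {}" using fin by auto
    obtain Z where "Z \<in> Pow Z0" "\<Psi> Z = Max (\<Psi> ` Pow Z0)" using Max_in[OF f] by auto
    then show ?thesis using Max_ge[OF f(1)] by (intro bexI[of _ Z]) auto
  qed
  then obtain Z where Z: "Z \<subseteq> Z0" and opt: "\<And>Z'. Z' \<subseteq> Z0 \<Longrightarrow> \<Psi> Z' \<le> \<Psi> Z" by auto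
  have finZ: "finite Z" using Z fin finite_subset by auto
  have "0 \<le> (\<Sum>i\<in>I. \<Sum>x\<in>key i ` Z. thr i x)" by (intro sum_nonneg nonneg)
  then have size: "\<Psi> Z0 \<le> real (card Z)" using opt[of Z0] by (simp add: \<Psi>_def)
  have "thr i (key i z) \<le> real (card {z' \<in> Z. key i z' = key i z})" if z: "z \<in> Z" and i: "i \<in> I" for z i
  proof (rule ccontr)
    assume small: "\<not> ?thesis"
    define C where "C = {z' \<in> Z. key i z' = key i z}"
    have C: "C \<subseteq> Z" "finite C" using finZ by (auto simp: C_def)
    have rem: "real (card (Z - C)) = real (card Z) - real (card C)"
      using C finZ by (simp add: card_Diff_subset card_mono of_nat_diff)
    have drop: "(\<Sum>x\<in>key i ` (Z - C). thr i x) + thr i (key i z) \<le> (\<Sum>x\<in>key i ` Z. thr i x)"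
    proof -
      have "key i z \<notin> key i ` (Z - C)" by (auto simp: C_def)
      then have "(\<Sum>x\<in>key i ` (Z - C). thr i x) + thr i (key i z)
          = (\<Sum>x\<in>insert (key i z) (key i ` (Z - C)). thr i x)" using finZ by simp
      also have "\<dots> \<le> (\<Sum>x\<in>key i ` Z. thr i x)"
        using z finZ nonneg[OF i] by (intro sum_mono2) auto
      finally show ?thesis .
    qed
    have "(\<Sum>j\<in>I. \<Sum>x\<in>key j ` (Z - C). thr j x) + thr i (key i z) \<le> (\<Sum>j\<in>I. \<Sum>x\<in>key j ` Z. thr j x)"
    proof -
      have "(\<Sum>j\<in>I - {i}. \<Sum>x\<in>key j ` (Z - C). thr j x) \<le> (\<Sum>j\<in>I - {i}. \<Sum>x\<in>key j ` Z. thr j x)"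
        using finZ nonneg by (intro sum_mono sum_mono2) auto
      then show ?thesis using drop fin i by (simp add: sum.remove)
    qed
    moreover have "real (card C) < thr i (key i z)" using small by (simp add: C_def)
    ultimately have "\<Psi> Z < \<Psi> (Z - C)" using rem by (simp add: \<Psi>_def)
    then show False using opt[of "Z - C"] Z by auto
  qed
  then show ?thesis using Z size by (auto simp: \<Psi>_def)
qed

section \<open>Fibers, determined positions and light positions\<close>

definition fiber :: "('i \<Rightarrow> 'w) set \<Rightarrow> 'i set \<Rightarrow> ('i \<Rightarrow> 'w) \<Rightarrow> ('i \<Rightarrow> 'w) set" where
  "fiber Z P z = {z' \<in> Z. \<forall>p\<in>P. z' p = z p}"

definition determines :: "('i \<Rightarrow> 'w) set \<Rightarrow> 'i set \<Rightarrow> 'i \<Rightarrow> bool" where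
  "determines Z P p \<longleftrightarrow> (\<forall>z\<in>Z. \<forall>z'\<in>fiber Z P z. z' p = z p)"

text \<open>For a uniformly random element of a fiber over \<open>P\<close>, this says that each
  single value at \<open>p\<close> has probability at most \<open>\<eta>\<close>.\<close>

definition light :: "real \<Rightarrow> ('i \<Rightarrow> 'w) set \<Rightarrow> 'i set \<Rightarrow> 'i \<Rightarrow> bool" where
  "light \<eta> Z P p \<longleftrightarrow>
    (\<forall>z\<in>Z. real (card (fiber Z (insert p P) z)) \<le> \<eta> * real (card (fiber Z P z)))"

lemma finite_fiber: "finite Z \<Longrightarrow> finite (fiber Z P z)"
  by (simp add: fiber_def)

lemma fiber_mono: "Z \<subseteq> Z' \<Longrightarrow> fiber Z P z \<subseteq> fiber Z' P z"
  by (auto simp: fiber_def)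

lemma self_in_fiber: "z \<in> Z \<Longrightarrow> z \<in> fiber Z P z"
  by (simp add: fiber_def)

lemma fiber_eq: "z' \<in> fiber Z P z \<Longrightarrow> fiber Z P z' = fiber Z P z"
  by (auto simp: fiber_def)

lemma fiber_conv_restrict: "fiber Z P z = {z' \<in> Z. restrict z' P = restrict z P}"
  unfolding fiber_def by (auto simp: restrict_def fun_eq_iff)

lemma determines_subset: "determines Z P p \<Longrightarrow> Z' \<subseteq> Z \<Longrightarrow> determines Z' P p"
  by (auto simp: determines_def fiber_def)

lemma determines_mono: "determines Z P p \<Longrightarrow> P \<subseteq> P' \<Longrightarrow> determines Z P' p"
  unfolding determines_def fiber_def by blast

lemma determines_mem: "p \<in> P \<Longrightarrow> determines Z P p"
  by (auto simp: determines_def fiber_def)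

lemma light_value_bound:
  assumes "light \<eta> Z P p" "z \<in> Z" "0 \<le> \<eta>"
  shows "real (card {z' \<in> fiber Z P z. z' p = w}) \<le> \<eta> * real (card (fiber Z P z))"
proof (cases "{z' \<in> fiber Z P z. z' p = w} = {}")
  case True
  show ?thesis unfolding True using assms by simp
next
  case False
  then obtain z' where z': "z' \<in> fiber Z P z" "z' p = w" by auto
  then have "{z' \<in> fiber Z P z. z' p = w} = fiber Z (insert p P) z'" by (auto simp: fiber_def)
  moreover have "z' \<in> Z" using z' by (simp add: fiber_def)
  ultimately show ?thesis using assms(1) unfolding light_def fiber_eq[OF z'(1), symmetric] by simp
qed

text \<open>In each class of tuples with given entries on \<open>P\<close>, keep only those with the
  most frequent value at \<open>p\<close>. A class shows at most \<open>1 / e\<close> values there,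
  so at least a proportion \<open>e\<close> of it survives.\<close>

lemma determining_subfamily_step:
  assumes fin: "finite Z" and e: "0 < e"
    and few: "\<And>z. z \<in> Z \<Longrightarrow> e * real (card ((\<lambda>z'. z' p) ` fiber Z P z)) \<le> 1"
  shows "\<exists>Z'\<subseteq>Z. e * real (card Z) \<le> real (card Z') \<and> determines Z' P p"
proof -
  define cls where "cls g = {z \<in> Z. restrict z P = g}" for g
  define G where "G = (\<lambda>z. restrict z P) ` Z"
  have "\<exists>v. e * real (card (cls g)) \<le> real (card {z \<in> cls g. z p = v})" if g: "g \<in> G" for g
  proof -
    obtain z where z: "z \<in> Z" "restrict z P = g" using g unfolding G_def by blast
    have c: "cls g = fiber Z P z" using z(2) by (auto simp: cls_def fiber_conv_restrict)
    let ?B = "(\<lambda>z'. z' p) ` cls g"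
    have "finite (cls g)" using fin by (simp add: cls_def)
    moreover have "cls g \<noteq> {}" using z by (auto simp: cls_def)
    ultimately obtain v where v: "card (cls g) \<le> card ?B * card {z \<in> cls g. z p = v}"
      using popular_value[of "cls g" ?B "\<lambda>z. z p"] by auto
    have "e * real (card (cls g)) \<le> e * real (card ?B) * real (card {z \<in> cls g. z p = v})"
      using v e by (simp add: mult.assoc flip: of_nat_mult)
    also have "\<dots> \<le> 1 * real (card {z \<in> cls g. z p = v})"
      using few[OF z(1)] by (intro mult_right_mono) (auto simp: c)
    finally show ?thesis by auto
  qed
  then have "\<forall>g\<in>G. \<exists>v. e * real (card (cls g)) \<le> real (card {z \<in> cls g. z p = v})" by blast
  from bchoice[OF this] obtain v
    where v: "\<And>g. g \<in> G \<Longrightarrow> e * real (card (cls g)) \<le> real (card {z \<in> cls g. z p = v g})" by blast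
  define Z' where "Z' = {z \<in> Z. z p = v (restrict z P)}"
  have Z': "Z' \<subseteq> Z" "finite Z'" using fin by (auto simp: Z'_def)
  have finG: "finite G" using fin by (simp add: G_def)
  have "real (card Z) = (\<Sum>g\<in>G. real (card (cls g)))"
    using sum.group[OF fin finG, of "\<lambda>z. restrict z P" "\<lambda>_. 1::real"] by (simp add: G_def cls_def)
  then have "e * real (card Z) = (\<Sum>g\<in>G. e * real (card (cls g)))" by (simp add: sum_distrib_left)
  also have "\<dots> \<le> (\<Sum>g\<in>G. real (card {z \<in> cls g. z p = v g}))" by (intro sum_mono v)
  also have "\<dots> = (\<Sum>g\<in>G. real (card {z \<in> Z'. restrict z P = g}))"
    by (intro sum.cong refl arg_cong[where f = "\<lambda>x. real (card x)"]) (auto simp: cls_def Z'_def)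
  also have "\<dots> = real (card Z')"
    using sum.group[OF Z'(2) finG, of "\<lambda>z. restrict z P" "\<lambda>_. 1::real"] Z'(1) by (auto simp: G_def)
  finally have "e * real (card Z) \<le> real (card Z')" .
  moreover have "determines Z' P p"
    unfolding determines_def fiber_conv_restrict by (auto simp: Z'_def)
  ultimately show ?thesis using Z' by auto
qed

text \<open>The step can be iterated because both ingredients pass to subfamilies: a determined pair
  stays determined, and the fibers of a smaller family show no more values.\<close>

lemma determining_subfamily:
  assumes fin: "finite T" "finite Z" and e: "0 < e" "e \<le> 1"
    and few: "\<And>z P p. z \<in> Z \<Longrightarrow> (P, p) \<in> T \<Longrightarrow> e * real (card ((\<lambda>z'. z' p) ` fiber Z P z)) \<le> 1"
  shows "\<exists>Z'\<subseteq>Z. e ^ card T * real (card Z) \<le> real (card Z') \<and> (\<forall>(P, p)\<in>T. determines Z' P p)"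
  using fin(1) few
proof (induction T rule: finite_induct)
  case empty
  then show ?case by auto
next
  case (insert x T)
  obtain P p where x: "x = (P, p)" by (cases x)
  obtain Z1 where Z1: "Z1 \<subseteq> Z" "e ^ card T * real (card Z) \<le> real (card Z1)"
      "\<forall>(P, p)\<in>T. determines Z1 P p"
  proof -
    have "\<exists>Z'\<subseteq>Z. e ^ card T * real (card Z) \<le> real (card Z') \<and> (\<forall>(P, p)\<in>T. determines Z' P p)"
      by (rule insert.IH, rule insert.prems) auto
    then show ?thesis using that by blast
  qed
  have f1: "finite Z1" using Z1 fin finite_subset by auto
  have few1: "e * real (card ((\<lambda>z'. z' p) ` fiber Z1 P z)) \<le> 1" if "z \<in> Z1" for z
  proof -
    have "card ((\<lambda>z'. z' p) ` fiber Z1 P z) \<le> card ((\<lambda>z'. z' p) ` fiber Z P z)"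
      by (intro card_mono finite_imageI finite_fiber image_mono fiber_mono fin Z1)
    then have "e * real (card ((\<lambda>z'. z' p) ` fiber Z1 P z)) \<le> e * real (card ((\<lambda>z'. z' p) ` fiber Z P z))"
      using e by simp
    then show ?thesis using insert.prems[of z P p] x that Z1 by auto
  qed
  obtain Z2 where Z2: "Z2 \<subseteq> Z1" "e * real (card Z1) \<le> real (card Z2)" "determines Z2 P p"
    using determining_subfamily_step[OF f1 e(1) few1] by blast
  have "e ^ card (insert x T) * real (card Z) = e * (e ^ card T * real (card Z))"
    using insert by simp
  also have "\<dots> \<le> e * real (card Z1)" using Z1 e by simp
  finally have size: "e ^ card (insert x T) * real (card Z) \<le> real (card Z2)" using Z2(2) by linarith
  have "\<forall>(P, p)\<in>insert x T. determines Z2 P p"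
    using Z1(3) Z2(3) determines_subset[OF _ Z2(1)] by (auto simp: x)
  then show ?case using size Z1(1) Z2(1) by (intro exI[of _ Z2]) blast
qed

text \<open>Heaviness is measured in the ambient family \<open>A\<close>, not in \<open>Z\<close>:
  each value seen in a fiber of \<open>Z\<close> occupies at least a share \<open>e\<close> of one
  and the same fiber of \<open>A\<close>, and these shares are disjoint. So earlier thinning of
  \<open>Z\<close> does no harm.\<close>

lemma few_heavy_values:
  assumes fin: "finite A" and sub: "Z \<subseteq> A" and z: "z \<in> Z"
    and heavy: "\<And>z. z \<in> Z \<Longrightarrow> e * real (card (fiber A P z)) \<le> real (card (fiber A (insert p P) z))"
  shows "e * real (card ((\<lambda>z'. z' p) ` fiber Z P z)) \<le> 1"
proof -
  let ?V = "(\<lambda>z'. z' p) ` fiber Z P z"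
  let ?d = "real (card (fiber A P z))"
  have finZ: "finite Z" using fin sub finite_subset by auto
  have "z \<in> fiber A P z" using z sub by (auto intro: self_in_fiber)
  then have d: "0 < ?d" using finite_fiber[OF fin] by (auto simp: card_gt_0_iff)
  have each: "e * ?d \<le> real (card {z' \<in> fiber A P z. z' p = v})" if "v \<in> ?V" for v
  proof -
    obtain z' where z': "z' \<in> fiber Z P z" "z' p = v" using \<open>v \<in> ?V\<close> by auto
    have "fiber A P z' = fiber A P z" using z' by (auto simp: fiber_def)
    moreover have "fiber A (insert p P) z' = {z' \<in> fiber A P z. z' p = v}"
      using z' by (auto simp: fiber_def)
    moreover have "z' \<in> Z" using z' by (simp add: fiber_def)
    ultimately show ?thesis using heavy[of z'] by simp
  qed
  have "real (card ?V) * (e * ?d) = (\<Sum>v\<in>?V. e * ?d)" by simp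
  also have "\<dots> \<le> (\<Sum>v\<in>?V. real (card {z' \<in> fiber A P z. z' p = v}))" by (intro sum_mono each)
  also have "\<dots> = real (card (\<Union>v\<in>?V. {z' \<in> fiber A P z. z' p = v}))"
    by (subst card_UN_disjoint) (use finite_fiber[OF fin] finite_fiber[OF finZ] in auto)
  also have "\<dots> \<le> ?d"
    unfolding of_nat_le_iff by (intro card_mono finite_fiber fin) auto
  finally have "(e * real (card ?V)) * ?d \<le> 1 * ?d" by (simp add: mult_ac)
  then show ?thesis using d by (simp only: mult_le_cancel_right)
qed

text \<open>There are \<open>card Q + 1\<close> disjoint half-open intervals from
  \<open>lev (Suc i)\<close> up to \<open>lev i\<close>, and only \<open>card Q\<close> numbers to
  put into them.\<close>

lemma gap_between_levels:
  fixes lev :: "nat \<Rightarrow> real" and x :: "'a \<Rightarrow> real"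
  assumes "finite Q" and dec: "\<And>i j. i \<le> j \<Longrightarrow> lev j \<le> lev i"
  shows "\<exists>i\<le>card Q. \<forall>q\<in>Q. lev i \<le> x q \<or> x q < lev (Suc i)"
proof (rule ccontr)
  assume "\<not> ?thesis"
  then have "\<forall>i. \<exists>q. i \<le> card Q \<longrightarrow> q \<in> Q \<and> \<not> (lev i \<le> x q \<or> x q < lev (Suc i))" by blast
  from choice[OF this] obtain q
    where q: "\<And>i. i \<le> card Q \<Longrightarrow> q i \<in> Q \<and> x (q i) < lev i \<and> lev (Suc i) \<le> x (q i)"
    by (auto simp: not_le not_less)
  have lt: "x (q j) < x (q i)" if "i < j" "j \<le> card Q" for i j
  proof -
    have "x (q j) < lev j" "lev (Suc i) \<le> x (q i)" using q that by auto
    moreover have "lev j \<le> lev (Suc i)" using that by (intro dec) auto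
    ultimately show ?thesis by linarith
  qed
  have "inj_on q {..card Q}"
  proof (rule inj_onI)
    fix i j assume "i \<in> {..card Q}" "j \<in> {..card Q}" "q i = q j"
    then show "i = j" using lt[of i j] lt[of j i] by (cases i j rule: linorder_cases) auto
  qed
  moreover have "q ` {..card Q} \<subseteq> Q" using q by auto
  ultimately have "card {..card Q} \<le> card Q" using assms(1) by (intro card_inj_on_le) auto
  then show False by simp
qed

text \<open>Fixing the set of pairs for which the ratio of fiber sizes exceeds a level, with a large gap
  below that level, costs a constant factor that does not depend on the levels. Hence cleaning up
  afterwards cannot turn a light pair into a heavy one.\<close>

theorem homogeneous_subfamily:
  fixes R :: "'i set" and \<eta> \<theta> :: real
  assumes finR: "finite R" and \<eta>: "0 < \<eta>" "\<eta> \<le> 1" and \<theta>: "0 < \<theta>" "\<theta> \<le> 1"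
  shows "\<exists>\<delta>>0. \<delta> \<le> 1 \<and> (\<forall>(A :: ('i \<Rightarrow> 'w) set) Z0 V. finite A \<longrightarrow> Z0 \<subseteq> A \<longrightarrow> \<theta> * real (card A) \<le> real (card Z0) \<longrightarrow>
    finite V \<longrightarrow> V \<noteq> {} \<longrightarrow> (\<forall>z\<in>A. z ` R \<subseteq> V) \<longrightarrow>
    (\<exists>Z\<subseteq>Z0. \<delta> * real (card A) \<le> real (card Z) \<and>
      (\<forall>z\<in>Z. \<forall>P\<subseteq>R. \<delta> * real (card (fiber A P z)) \<le> real (card (fiber Z P z)) \<and>
        \<delta> * real (card A) \<le> real (card (fiber Z P z)) * real (card V) ^ card P) \<and>
      (\<forall>P\<subseteq>R. \<forall>p\<in>R. determines Z P p \<or> light \<eta> Z P p)))"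
proof -
  define Q where "Q = Pow R \<times> R"
  define N where "N = card Q"
  \<comment> \<open>Three losses are collected: the initial density \<open>\<theta>\<close>, the
    \<open>Suc N * 2 ^ N\<close> combinations of a level and a heavy set among which one is chosen,
    and a reserve for the clean-up over the \<open>2 ^ card R\<close> sets of positions.\<close>
  define \<kappa> where "\<kappa> = \<theta> / (real (Suc N) * 2 ^ N * (4 * 2 ^ card R))"
  \<comment> \<open>With \<open>\<gamma> = \<kappa> * lev i ^ Suc N\<close>, the share of an ambient
    fiber that will survive, the recursion reads \<open>lev (Suc i) = \<eta> * \<gamma>\<close>. A
    ratio below the next level is thus still at most \<open>\<eta>\<close> after fibers have shrunk
    by the factor \<open>\<gamma>\<close>.\<close>
  define lev where "lev = rec_nat (1::real) (\<lambda>_ x. \<eta> * \<kappa> * x ^ Suc N)"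
  have lev0: "lev 0 = 1" and levS: "lev (Suc i) = \<eta> * \<kappa> * lev i ^ Suc N" for i
    by (simp_all add: lev_def)
  have finQ: "finite Q" using finR by (simp add: Q_def)
  have \<kappa>: "0 < \<kappa>" "\<kappa> \<le> 1"
  proof -
    show "0 < \<kappa>" using \<theta> by (simp add: \<kappa>_def)
    have "1 * 1 * (1 * 1) \<le> real (Suc N) * 2 ^ N * (4 * 2 ^ card R)"
      by (intro mult_mono) auto
    then show "\<kappa> \<le> 1" using \<theta> unfolding \<kappa>_def by (subst divide_le_eq_1_pos) auto
  qed
  have \<eta>\<kappa>: "0 < \<eta> * \<kappa>" "\<eta> * \<kappa> \<le> 1" using \<eta> \<kappa> by (auto intro: mult_le_one)
  have lev: "0 < lev i \<and> lev i \<le> 1" for i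
  proof (induction i)
    case 0
    then show ?case by (simp add: lev0)
  next
    case (Suc i)
    then have "0 < lev i ^ Suc N" "lev i ^ Suc N \<le> 1" by (auto intro: power_le_one simp del: power_Suc)
    then show ?case unfolding levS using \<eta>\<kappa> by (auto intro: mult_le_one simp del: power_Suc)
  qed
  have step: "lev (Suc i) \<le> lev i" for i
  proof -
    have "\<eta> * \<kappa> * lev i ^ Suc N \<le> 1 * lev i ^ 1"
      using \<eta>\<kappa> lev[of i] by (intro mult_mono power_decreasing) (auto simp del: power_Suc)
    then show ?thesis by (simp add: levS)
  qed
  have dec: "lev j \<le> lev i" if "i \<le> j" for i j
    using that by (rule lift_Suc_antimono_le[where f = lev, rotated]) (rule step)
  define \<delta> where "\<delta> = \<kappa> * lev N ^ Suc N"
  have \<delta>: "0 < \<delta>" "\<delta> \<le> 1" using \<kappa> lev[of N] unfolding \<delta>_def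
    by (auto intro!: mult_le_one power_le_one simp del: power_Suc)
  have main: "\<exists>Z\<subseteq>Z0. \<delta> * real (card A) \<le> real (card Z) \<and>
      (\<forall>z\<in>Z. \<forall>P\<subseteq>R. \<delta> * real (card (fiber A P z)) \<le> real (card (fiber Z P z)) \<and>
        \<delta> * real (card A) \<le> real (card (fiber Z P z)) * real (card V) ^ card P) \<and>
      (\<forall>P\<subseteq>R. \<forall>p\<in>R. determines Z P p \<or> light \<eta> Z P p)"
    if finA: "finite A" and Z0: "Z0 \<subseteq> A" and dense: "\<theta> * real (card A) \<le> real (card Z0)"
      and V: "finite V" "V \<noteq> {}" "\<forall>z\<in>A. z ` R \<subseteq> V" for A Z0 :: "('i \<Rightarrow> 'w) set" and V
  proof -
    define rat where "rat z q = real (card (fiber A (insert (snd q) (fst q)) z)) / real (card (fiber A (fst q) z))"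
      for z and q :: "'i set \<times> 'i"
    have pos: "0 < real (card (fiber A P z))" if "z \<in> A" for z P
      using self_in_fiber[OF that, of P] finite_fiber[OF finA] by (auto simp: card_gt_0_iff)
    have "\<exists>i\<le>N. \<forall>q\<in>Q. lev i \<le> rat z q \<or> rat z q < lev (Suc i)" for z
      unfolding N_def by (rule gap_between_levels[OF finQ dec])
    then obtain ix where ix: "\<And>z. ix z \<le> N" "\<And>z q. q \<in> Q \<Longrightarrow> lev (ix z) \<le> rat z q \<or> rat z q < lev (Suc (ix z))"
      by metis
    define hv where "hv z = {q \<in> Q. lev (ix z) \<le> rat z q}" for z
    have finZ0: "finite Z0" using Z0 finA finite_subset by auto
    \<comment> \<open>Level and heavy set depend on \<open>z\<close>; passing to the most frequent
      combination makes them constant.\<close>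
    obtain iT where iT: "iT \<in> {..N} \<times> Pow Q"
      and big: "card Z0 \<le> card ({..N} \<times> Pow Q) * card {z \<in> Z0. (ix z, hv z) = iT}"
    proof -
      have "finite ({..N} \<times> Pow Q)" "{..N} \<times> Pow Q \<noteq> {}" "(\<lambda>z. (ix z, hv z)) ` Z0 \<subseteq> {..N} \<times> Pow Q"
        using finQ ix(1) by (auto simp: hv_def)
      from popular_value[OF finZ0 this] show ?thesis using that by blast
    qed
    obtain i T where [simp]: "iT = (i, T)" by (cases iT)
    have i: "i \<le> N" and T: "T \<subseteq> Q" using iT by auto
    define Z1 where "Z1 = {z \<in> Z0. (ix z, hv z) = iT}"
    have Z1: "Z1 \<subseteq> Z0" "finite Z1" using finZ0 by (auto simp: Z1_def)
    have big1: "real (card Z0) \<le> real (Suc N) * 2 ^ N * real (card Z1)"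
    proof -
      have "card ({..N} \<times> Pow Q) = Suc N * 2 ^ N" using finQ by (simp add: card_cartesian_product card_Pow N_def)
      then have "card Z0 \<le> Suc N * 2 ^ N * card Z1" using big by (simp add: Z1_def)
      then have "real (card Z0) \<le> real (Suc N * 2 ^ N * card Z1)" by (rule of_nat_mono)
      then show ?thesis by (simp add: algebra_simps)
    qed
    have heavy: "lev i * real (card (fiber A P z)) \<le> real (card (fiber A (insert p P) z))"
      if "z \<in> Z1" "(P, p) \<in> T" for z P p
    proof -
      have "lev i \<le> rat z (P, p)" using that by (auto simp: Z1_def hv_def)
      then show ?thesis using pos[of z P] that Z1 Z0 by (auto simp: rat_def pos_le_divide_eq)
    qed
    have lightr: "real (card (fiber A (insert p P) z)) \<le> lev (Suc i) * real (card (fiber A P z))"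
      if "z \<in> Z1" "(P, p) \<in> Q" "(P, p) \<notin> T" for z P p
    proof -
      have "\<not> lev i \<le> rat z (P, p)" "ix z = i" using that by (auto simp: Z1_def hv_def)
      then have "rat z (P, p) < lev (Suc i)" using ix(2)[OF that(2), of z] by auto
      then show ?thesis using pos[of z P] that Z1 Z0 by (auto simp: rat_def pos_divide_less_eq)
    qed
    have finT: "finite T" using T finQ finite_subset by auto
    have few: "lev i * real (card ((\<lambda>z'. z' p) ` fiber Z1 P z)) \<le> 1"
      if "z \<in> Z1" "(P, p) \<in> T" for z P p
      by (rule few_heavy_values[OF finA _ that(1)]) (use Z1 Z0 heavy that in auto)
    obtain Z2 where Z2: "Z2 \<subseteq> Z1" "lev i ^ card T * real (card Z1) \<le> real (card Z2)"
        "\<forall>(P, p)\<in>T. determines Z2 P p"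
      using determining_subfamily[OF finT Z1(2), of "lev i"] few lev[of i] by blast
    have finZ2: "finite Z2" using Z2 Z1 finite_subset by auto
    have Z2A: "Z2 \<subseteq> A" using Z2 Z1 Z0 by auto
    define \<gamma> where "\<gamma> = \<kappa> * lev i ^ Suc N"
    have \<gamma>: "0 < \<gamma>" "\<delta> \<le> \<gamma>"
      using \<kappa> lev[of i] lev[of N] dec[OF i] unfolding \<gamma>_def \<delta>_def
      by (auto intro!: mult_left_mono power_mono simp del: power_Suc)
    have size2: "4 * 2 ^ card R * \<gamma> * real (card A) \<le> real (card Z2)"
    proof -
      have "card T \<le> Suc N" using card_mono[OF finQ T] by (simp add: N_def)
      then have "lev i ^ Suc N \<le> lev i ^ card T" using lev[of i] by (intro power_decreasing) auto
      then have a: "lev i ^ Suc N * real (card Z1) \<le> real (card Z2)"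
        using Z2(2) by (meson mult_right_mono of_nat_0_le_iff order_trans)
      have "\<theta> * real (card A) \<le> real (Suc N) * 2 ^ N * real (card Z1)" using dense big1 by simp
      then have "\<theta> / (real (Suc N) * 2 ^ N) * real (card A) \<le> real (card Z1)"
        by (simp add: divide_le_eq mult.commute mult.left_commute)
      then have "lev i ^ Suc N * (\<theta> / (real (Suc N) * 2 ^ N) * real (card A)) \<le> lev i ^ Suc N * real (card Z1)"
        using lev[of i] by (intro mult_left_mono) auto
      moreover have "4 * 2 ^ card R * \<gamma> * real (card A)
          = lev i ^ Suc N * (\<theta> / (real (Suc N) * 2 ^ N) * real (card A))"
        by (simp add: \<gamma>_def \<kappa>_def del: power_Suc)
      ultimately show ?thesis using a by linarith
    qed
    \<comment> \<open>The first summand compares a class with the corresponding class of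
      \<open>A\<close>, the second with the average \<open>card A / card V ^ card P\<close>. Each
      adds up to at most \<open>\<gamma> * card A\<close> over all classes, so all \<open>P\<close>
      together cost at most half of the lower bound in \<open>size2\<close>.\<close>
    define thr where "thr P g = \<gamma> * (real (card {z \<in> A. restrict z P = g}) + real (card A) / real (card V) ^ card P)"
      for P and g :: "'i \<Rightarrow> 'w"
    have Vpos: "0 < real (card V)" using V by (simp add: card_gt_0_iff)
    have thr0: "0 \<le> thr P g" for P g using \<gamma> by (simp add: thr_def)
    have keysum: "(\<Sum>g\<in>(\<lambda>z. restrict z P) ` Z2. thr P g) \<le> 2 * \<gamma> * real (card A)" if "P \<in> Pow R" for P
    proof -
      let ?K = "(\<lambda>z. restrict z P) ` A"
      have finP: "finite P" using that finR finite_subset by auto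
      have s0: "(\<Sum>g\<in>(\<lambda>z. restrict z P) ` Z2. thr P g) \<le> (\<Sum>g\<in>?K. thr P g)"
        by (intro sum_mono2 finite_imageI image_mono Z2A finA thr0)
      have s1: "(\<Sum>g\<in>?K. real (card {z \<in> A. restrict z P = g})) = real (card A)"
        using sum.group[OF finA finite_imageI[OF finA], of "\<lambda>z. restrict z P" "\<lambda>z. restrict z P" "\<lambda>_. 1::real"] by simp
      have s2: "real (card ?K) * (real (card A) / real (card V) ^ card P) \<le> real (card A)"
      proof -
        have "?K \<subseteq> PiE P (\<lambda>_. V)" using V(3) that by (auto simp: restrict_PiE_iff image_subset_iff subset_iff)
        then have "card ?K \<le> card (PiE P (\<lambda>_. V))" by (intro card_mono finite_PiE finP V)
        then have "card ?K \<le> card V ^ card P" using finP by (simp add: card_PiE)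
        then have "real (card ?K) \<le> real (card V) ^ card P" by (simp flip: of_nat_power)
        then have "real (card ?K) * real (card A) \<le> real (card V) ^ card P * real (card A)" by (intro mult_right_mono) auto
        then show ?thesis using Vpos by (simp add: divide_le_eq mult.commute)
      qed
      have "(\<Sum>g\<in>?K. thr P g) = \<gamma> * ((\<Sum>g\<in>?K. real (card {z \<in> A. restrict z P = g})) + real (card ?K) * (real (card A) / real (card V) ^ card P))"
        by (simp add: thr_def sum_distrib_left[symmetric] sum.distrib)
      also have "\<dots> \<le> \<gamma> * (real (card A) + real (card A))"
        unfolding s1 using s2 \<gamma> by (intro mult_left_mono) auto
      finally show ?thesis using s0 by (simp add: algebra_simps)
    qed
    obtain Z where Z: "Z \<subseteq> Z2"
      and sz: "real (card Z2) - (\<Sum>P\<in>Pow R. \<Sum>g\<in>(\<lambda>z. restrict z P) ` Z2. thr P g) \<le> real (card Z)"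
      and cl: "\<And>z P. z \<in> Z \<Longrightarrow> P \<subseteq> R \<Longrightarrow> thr P (restrict z P) \<le> real (card {z' \<in> Z. restrict z' P = restrict z P})"
    proof -
      have "\<exists>Z\<subseteq>Z2. real (card Z2) - (\<Sum>P\<in>Pow R. \<Sum>g\<in>(\<lambda>z. restrict z P) ` Z2. thr P g) \<le> real (card Z) \<and>
        (\<forall>z\<in>Z. \<forall>P\<in>Pow R. thr P (restrict z P) \<le> real (card {z' \<in> Z. restrict z' P = restrict z P}))"
        by (rule subfamily_with_large_classes) (use finZ2 finR thr0 in auto)
      then show ?thesis using that by (meson PowI)
    qed
    have "(\<Sum>P\<in>Pow R. \<Sum>g\<in>(\<lambda>z. restrict z P) ` Z2. thr P g) \<le> (\<Sum>P\<in>Pow R. 2 * \<gamma> * real (card A))"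
      by (intro sum_mono keysum)
    also have "\<dots> = 2 * 2 ^ card R * \<gamma> * real (card A)" using finR by (simp add: card_Pow)
    finally have szZ: "2 * 2 ^ card R * \<gamma> * real (card A) \<le> real (card Z)" using sz size2 by linarith
    have "1 * \<delta> * real (card A) \<le> 2 * 2 ^ card R * \<gamma> * real (card A)"
    proof (intro mult_right_mono mult_mono)
      show "(1::real) \<le> 2 * 2 ^ card R" using one_le_power[of "2::real" "card R"] by linarith
    qed (use \<gamma> \<delta> in auto)
    then have c1: "\<delta> * real (card A) \<le> real (card Z)" using szZ by simp
    have fibs: "\<gamma> * real (card (fiber A P z)) + \<gamma> * (real (card A) / real (card V) ^ card P) \<le> real (card (fiber Z P z))"
      if "z \<in> Z" "P \<subseteq> R" for z P
      using cl[OF that] by (simp add: thr_def fiber_conv_restrict distrib_left)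
    have fibA: "\<gamma> * real (card (fiber A P z)) \<le> real (card (fiber Z P z))" if "z \<in> Z" "P \<subseteq> R" for z P
    proof -
      have "0 \<le> \<gamma> * (real (card A) / real (card V) ^ card P)" using \<gamma> by simp
      then show ?thesis using fibs[OF that] by linarith
    qed
    have c2: "\<delta> * real (card (fiber A P z)) \<le> real (card (fiber Z P z))" if "z \<in> Z" "P \<subseteq> R" for z P
      using fibA[OF that] mult_right_mono[OF \<gamma>(2), of "real (card (fiber A P z))"] by simp
    have c3: "\<delta> * real (card A) \<le> real (card (fiber Z P z)) * real (card V) ^ card P" if "z \<in> Z" "P \<subseteq> R" for z P
    proof -
      have "0 \<le> \<gamma> * real (card (fiber A P z))" using \<gamma> by simp
      then have "\<gamma> * real (card A) / real (card V) ^ card P \<le> real (card (fiber Z P z))"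
        using fibs[OF that] by simp
      then have "\<gamma> * real (card A) \<le> real (card (fiber Z P z)) * real (card V) ^ card P"
        using Vpos by (simp add: pos_divide_le_eq)
      then show ?thesis using mult_right_mono[OF \<gamma>(2), of "real (card A)"] by simp
    qed
    have c4: "determines Z P p \<or> light \<eta> Z P p" if "P \<subseteq> R" "p \<in> R" for P p
    proof (cases "(P, p) \<in> T")
      case True
      then show ?thesis using Z2(3) determines_subset[OF _ Z] by auto
    next
      case False
      have "real (card (fiber Z (insert p P) z)) \<le> \<eta> * real (card (fiber Z P z))" if z: "z \<in> Z" for z
      proof -
        have "real (card (fiber Z (insert p P) z)) \<le> real (card (fiber A (insert p P) z))"
          unfolding of_nat_le_iff using Z Z2 Z1 Z0
          by (intro card_mono finite_fiber finA fiber_mono) auto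
        also have "\<dots> \<le> lev (Suc i) * real (card (fiber A P z))"
          using lightr[of z P p] False z Z Z2 \<open>P \<subseteq> R\<close> \<open>p \<in> R\<close> by (auto simp: Q_def)
        also have "\<dots> = \<eta> * (\<gamma> * real (card (fiber A P z)))" by (simp add: levS \<gamma>_def)
        also have "\<dots> \<le> \<eta> * real (card (fiber Z P z))"
          using fibA[OF z \<open>P \<subseteq> R\<close>] \<eta> by simp
        finally show ?thesis .
      qed
      then show ?thesis by (simp add: light_def)
    qed
    show ?thesis using Z Z2(1) Z1(1) c1 c2 c3 c4 by (intro exI[of _ Z]) auto
  qed
  show ?thesis using \<delta> main by (intro exI[of _ \<delta>]) blast
qed

section \<open>Random embeddings of hypertrees\<close>

lemma sum_insert_PiE:
  assumes "x \<notin> S"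
  shows "(\<Sum>g\<in>PiE (insert x S) T. f g) = (\<Sum>g\<in>PiE S T. \<Sum>y\<in>T x. f (g(x := y)))"
proof -
  have "(\<Sum>g\<in>PiE (insert x S) T. f g) = (\<Sum>(y, g)\<in>T x \<times> PiE S T. f (g(x := y)))"
    unfolding PiE_insert_eq by (subst sum.reindex[OF inj_combinator[OF assms]]) (simp add: case_prod_unfold)
  also have "\<dots> = (\<Sum>y\<in>T x. \<Sum>g\<in>PiE S T. f (g(x := y)))" by (rule sum.cartesian_product[symmetric])
  also have "\<dots> = (\<Sum>g\<in>PiE S T. \<Sum>y\<in>T x. f (g(x := y)))" by (rule sum.swap)
  finally show ?thesis .
qed

lemma sum_if_const: "(\<Sum>x\<in>A. if b then f x else 0) = (if b then sum f A else (0::real))"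
  by (cases b) simp_all

lemma sum_UN_le:
  fixes W :: "'a \<Rightarrow> real"
  assumes "finite J" "\<And>j. j \<in> J \<Longrightarrow> finite (A j)" "\<And>x. 0 \<le> W x"
  shows "sum W (\<Union>j\<in>J. A j) \<le> (\<Sum>j\<in>J. sum W (A j))"
  using assms(1,2)
proof (induction J rule: finite_induct)
  case (insert j J)
  have "sum W (A j \<union> (\<Union>j\<in>J. A j)) \<le> sum W (A j) + sum W (\<Union>j\<in>J. A j)"
    using insert assms(3) by (subst sum_Un) (auto intro!: sum_nonneg)
  then show ?case using insert by simp
qed simp

lemma finite_hypertree: "hypertree H \<Longrightarrow> finite H"
  by (induction rule: hypertree.induct) auto

lemma hypertree_nonempty: "hypertree H \<Longrightarrow> H \<noteq> {}"
  by (induction rule: hypertree.induct) auto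

text \<open>\<open>\<pi>\<close> tells at which position of a tuple a vertex is read off; an edge
  may use only some of the positions in \<open>R\<close>. The assumption \<open>fresh\<close>
  prevents collisions: a vertex outside the neighbouring edge has an undetermined entry or has its
  position to itself. The bound on \<open>\<eta>\<close> is made for a union bound over at most
  \<open>card R\<close> positions and \<open>card R * card H\<close> used values, with failure
  probability \<open>1 / (2 * card H)\<close> per step.\<close>

locale tuple_embedding =
  fixes H :: "'v set set" and \<pi> :: "'v \<Rightarrow> 'i" and R :: "'i set" and Z :: "('i \<Rightarrow> 'w) set"
    and \<eta> D :: real
  assumes tree: "hypertree H"
    and finR: "finite R" and finZ: "finite Z" and Z_nonempty: "Z \<noteq> {}"
    and pos_in: "E \<in> H \<Longrightarrow> \<pi> ` E \<subseteq> R"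
    and inj_pos: "E \<in> H \<Longrightarrow> inj_on \<pi> E"
    and inj_tuple: "z \<in> Z \<Longrightarrow> inj_on z R"
    and homogeneous: "P \<subseteq> R \<Longrightarrow> p \<in> R \<Longrightarrow> determines Z P p \<or> light \<eta> Z P p"
    and fresh: "\<lbrakk>E \<in> H; F \<in> H; E \<noteq> F; v \<in> E; v \<notin> F\<rbrakk> \<Longrightarrow>
      \<not> determines Z (\<pi> ` (E \<inter> F)) (\<pi> v) \<or> (\<forall>u\<in>\<Union>H. \<pi> u = \<pi> v \<longrightarrow> u = v)"
    and large_fibers: "\<lbrakk>E \<in> H; F \<in> H; E \<noteq> F; z \<in> Z\<rbrakk> \<Longrightarrow> D \<le> real (card (fiber Z (\<pi> ` (E \<inter> F)) z))"
    and D_pos: "0 < D"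
    and eta: "0 \<le> \<eta>" "\<eta> * real (card R) ^ 2 * real (card H) \<le> 1 / (2 * real (card H))"
begin

section \<open>Consistent assignments of tuples and their extension by one edge\<close>

lemma finH: "finite H"
  using tree by (rule finite_hypertree)

lemma finite_assignments: "H' \<subseteq> H \<Longrightarrow> finite (PiE H' (\<lambda>_. Z))"
  by (intro finite_PiE finZ) (rule finite_subset[OF _ finH])

text \<open>The second clause ranges over all of \<open>R\<close>, not only over positions that the
  edges use. At a determined position the new edge inherits the entry of its parent, possibly at a
  position that the parent itself does not use, and that entry must already be known to clash with
  nothing.\<close>

definition consistent :: "'v set set \<Rightarrow> ('v set \<Rightarrow> 'i \<Rightarrow> 'w) \<Rightarrow> bool" where
  "consistent H' \<zeta> \<longleftrightarrow>
    (\<forall>E\<in>H'. \<forall>F\<in>H'. \<forall>v\<in>E \<inter> F. \<zeta> E (\<pi> v) = \<zeta> F (\<pi> v)) \<and>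
    (\<forall>E\<in>H'. \<forall>F\<in>H'. \<forall>p\<in>R. \<forall>q\<in>R. p \<noteq> q \<longrightarrow> \<zeta> E p \<noteq> \<zeta> F q) \<and>
    (\<forall>E\<in>H'. \<forall>F\<in>H'. \<forall>u\<in>E. \<forall>v\<in>F. u \<noteq> v \<longrightarrow> \<pi> u = \<pi> v \<longrightarrow> \<zeta> E (\<pi> u) \<noteq> \<zeta> F (\<pi> v))"

definition extensions :: "'v set set \<Rightarrow> 'v set \<Rightarrow> 'v set \<Rightarrow> ('v set \<Rightarrow> 'i \<Rightarrow> 'w) \<Rightarrow> ('i \<Rightarrow> 'w) set" where
  "extensions H' F E \<zeta> = {z \<in> fiber Z (\<pi> ` (E \<inter> F)) (\<zeta> F).
    \<forall>p\<in>R. \<not> determines Z (\<pi> ` (E \<inter> F)) p \<longrightarrow> z p \<notin> (\<Union>G\<in>H'. \<zeta> G ` R)}"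

lemma many_extensions:
  assumes H': "H' \<subseteq> H" and F: "F \<in> H'" and E: "E \<in> H" and \<zeta>: "\<zeta> \<in> PiE H' (\<lambda>_. Z)"
  shows "(1 - 1 / (2 * real (card H))) * real (card (fiber Z (\<pi> ` (E \<inter> F)) (\<zeta> F)))
    \<le> real (card (extensions H' F E \<zeta>))"
proof -
  define P where "P = \<pi> ` (E \<inter> F)"
  define Fib where "Fib = fiber Z P (\<zeta> F)"
  define U where "U = (\<Union>G\<in>H'. \<zeta> G ` R)"
  define L where "L = {p \<in> R. \<not> determines Z P p}"
  define bad where "bad = (\<Union>(p, w)\<in>L \<times> U. {z \<in> Fib. z p = w})"
  have finH': "finite H'" using H' finH finite_subset by auto
  have finU: "finite U" using finH' finR by (simp add: U_def)
  have finL: "finite L" using finR by (simp add: L_def)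
  have finFib: "finite Fib" using finite_fiber[OF finZ] by (simp add: Fib_def)
  have P: "P \<subseteq> R" using pos_in[OF E] by (auto simp: P_def)
  have z: "\<zeta> F \<in> Z" using \<zeta> F by auto
  have "card U \<le> (\<Sum>G\<in>H'. card (\<zeta> G ` R))" unfolding U_def using finH' by (rule card_UN_le)
  also have "\<dots> \<le> (\<Sum>G\<in>H'. card R)" using finR by (intro sum_mono card_image_le)
  also have "\<dots> \<le> card H * card R" using card_mono[OF finH H'] by simp
  finally have cU: "card U \<le> card H * card R" .
  have cL: "card L \<le> card R" using finR by (auto simp: L_def intro: card_mono)
  have one: "real (card {z \<in> Fib. z p = w}) \<le> \<eta> * real (card Fib)" if "p \<in> L" for p w
    using light_value_bound[OF _ z eta(1)] homogeneous[OF P] that by (auto simp: L_def Fib_def)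
  have "real (card bad) \<le> real (\<Sum>(p, w)\<in>L \<times> U. card {z \<in> Fib. z p = w})"
    unfolding bad_def of_nat_le_iff case_prod_unfold using finL finU by (intro card_UN_le) simp
  also have "\<dots> \<le> (\<Sum>(p, w)\<in>L \<times> U. \<eta> * real (card Fib))"
    unfolding of_nat_sum case_prod_unfold by (intro sum_mono one) auto
  also have "\<dots> = real (card L * card U) * (\<eta> * real (card Fib))" by (simp add: card_cartesian_product)
  also have "\<dots> \<le> real (card R * (card H * card R)) * (\<eta> * real (card Fib))"
    using eta(1) cU cL by (intro mult_right_mono of_nat_mono mult_le_mono) auto
  also have "\<dots> = (\<eta> * real (card R) ^ 2 * real (card H)) * real (card Fib)"
    by (simp add: power2_eq_square)
  also have "\<dots> \<le> 1 / (2 * real (card H)) * real (card Fib)"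
    by (intro mult_right_mono eta) auto
  finally have b: "real (card bad) \<le> 1 / (2 * real (card H)) * real (card Fib)" .
  have ext: "extensions H' F E \<zeta> = Fib - bad"
    unfolding extensions_def bad_def Fib_def[symmetric] P_def[symmetric] U_def[symmetric] L_def by auto
  have "bad \<subseteq> Fib" by (auto simp: bad_def)
  then have "real (card (Fib - bad)) = real (card Fib) - real (card bad)"
    using finFib by (simp add: card_Diff_subset finite_subset card_mono of_nat_diff)
  then show ?thesis using b by (simp add: ext Fib_def P_def algebra_simps)
qed

text \<open>Each entry of the new tuple is either determined, hence equal to the parent's entry, or
  avoids every entry used so far. In the first case the clauses are inherited from the parent. For a
  vertex outside the parent that shares its position with another vertex, \<open>fresh\<close> rules
  out the first case.\<close>

lemma consistent_extend:
  assumes H': "H' \<subseteq> H" and E: "E \<in> H" "E \<notin> H'" and F: "F \<in> H'" and leaf: "E \<inter> \<Union>H' = E \<inter> F"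
    and \<zeta>: "\<zeta> \<in> PiE H' (\<lambda>_. Z)" and cons: "consistent H' \<zeta>" and z: "z \<in> extensions H' F E \<zeta>"
  shows "consistent (insert E H') (\<zeta>(E := z))"
proof -
  define P where "P = \<pi> ` (E \<inter> F)"
  have FH: "F \<in> H" "E \<noteq> F" using F H' E by auto
  have zZ: "z \<in> Z" and zP: "\<And>p. p \<in> P \<Longrightarrow> z p = \<zeta> F p"
    using z by (auto simp: extensions_def fiber_def P_def)
  have FZ: "\<zeta> F \<in> Z" using \<zeta> F by auto
  have det: "z p = \<zeta> F p" if "determines Z P p" for p
    using that z FZ by (auto simp: extensions_def determines_def P_def)
  have new: "z p \<noteq> \<zeta> G q" if "p \<in> R" "\<not> determines Z P p" "G \<in> H'" "q \<in> R" for p q G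
    using that z by (auto simp: extensions_def P_def)
  have c1: "\<And>A B v. A \<in> H' \<Longrightarrow> B \<in> H' \<Longrightarrow> v \<in> A \<Longrightarrow> v \<in> B \<Longrightarrow> \<zeta> A (\<pi> v) = \<zeta> B (\<pi> v)"
    and c2: "\<And>A B p q. A \<in> H' \<Longrightarrow> B \<in> H' \<Longrightarrow> p \<in> R \<Longrightarrow> q \<in> R \<Longrightarrow> p \<noteq> q \<Longrightarrow> \<zeta> A p \<noteq> \<zeta> B q"
    and c3: "\<And>A B u v. A \<in> H' \<Longrightarrow> B \<in> H' \<Longrightarrow> u \<in> A \<Longrightarrow> v \<in> B \<Longrightarrow> u \<noteq> v \<Longrightarrow> \<pi> u = \<pi> v \<Longrightarrow> \<zeta> A (\<pi> u) \<noteq> \<zeta> B (\<pi> v)"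
    using cons unfolding consistent_def by blast+
  have d1: "z (\<pi> v) = \<zeta> G (\<pi> v)" if "G \<in> H'" "v \<in> E" "v \<in> G" for G v
  proof -
    have "v \<in> E \<inter> F" using that leaf by blast
    then show ?thesis using zP[of "\<pi> v"] c1[OF F that(1), of v] that by (auto simp: P_def)
  qed
  have d2: "z p \<noteq> \<zeta> G q" if "G \<in> H'" "p \<in> R" "q \<in> R" "p \<noteq> q" for G p q
    using new[of p G q] det[of p] c2[OF F that(1), of p q] that by (cases "determines Z P p") auto
  have d3: "z (\<pi> u) \<noteq> \<zeta> G (\<pi> v)" if "G \<in> H'" "u \<in> E" "v \<in> G" "u \<noteq> v" "\<pi> u = \<pi> v" for G u v
  proof (cases "u \<in> F")
    case True
    then have "z (\<pi> u) = \<zeta> F (\<pi> u)" using zP[of "\<pi> u"] that(2) unfolding P_def by blast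
    then show ?thesis using c3[OF F that(1) True that(3)] that by auto
  next
    case False
    have "v \<in> \<Union>H" using that H' by auto
    then have "\<not> determines Z P (\<pi> u)"
      using fresh[OF E(1) FH(1,2) that(2) False] that unfolding P_def by metis
    moreover have "\<pi> u \<in> R" using pos_in[OF E(1)] that by auto
    ultimately show ?thesis using new that by auto
  qed
  have e2: "z p \<noteq> z q" if "p \<in> R" "q \<in> R" "p \<noteq> q" for p q
    using inj_tuple[OF zZ] that by (auto dest: inj_onD)
  have e3: "\<pi> u \<noteq> \<pi> v" if "u \<in> E" "v \<in> E" "u \<noteq> v" for u v
    using inj_pos[OF E(1)] that by (auto dest: inj_onD)
  have upd: "(\<zeta>(E := z)) G = \<zeta> G" if "G \<in> H'" for G using that E by auto
  have d2': "\<zeta> G q \<noteq> z p" if "G \<in> H'" "p \<in> R" "q \<in> R" "q \<noteq> p" for G p q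
    using d2[OF that(1-3)] that(4) by metis
  have d3': "\<zeta> G (\<pi> v) \<noteq> z (\<pi> u)" if "G \<in> H'" "u \<in> E" "v \<in> G" "v \<noteq> u" "\<pi> v = \<pi> u" for G u v
    using d3[OF that(1-3)] that(4,5) by metis
  show ?thesis
    unfolding consistent_def
  proof (intro conjI ballI impI)
    fix A B v assume "A \<in> insert E H'" "B \<in> insert E H'" "v \<in> A \<inter> B"
    then show "(\<zeta>(E := z)) A (\<pi> v) = (\<zeta>(E := z)) B (\<pi> v)"
      by (elim insertE) (auto simp: upd d1 intro: c1)
  next
    fix A B p q assume "A \<in> insert E H'" "B \<in> insert E H'" "p \<in> R" "q \<in> R" "p \<noteq> q"
    then show "(\<zeta>(E := z)) A p \<noteq> (\<zeta>(E := z)) B q"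
      by (elim insertE) (simp_all add: upd e2 d2 d2' c2)
  next
    fix A B u v assume "A \<in> insert E H'" "B \<in> insert E H'" "u \<in> A" "v \<in> B" "u \<noteq> v" "\<pi> u = \<pi> v"
    then show "(\<zeta>(E := z)) A (\<pi> u) \<noteq> (\<zeta>(E := z)) B (\<pi> v)"
      using e3 d3 d3' c3 by (elim insertE) (simp_all add: upd, blast+)
  qed
qed

text \<open>\<open>W\<close> is the law of a walk that is killed when it meets a forbidden entry, so
  its total is bounded below instead of being 1. The last clause bounds the probability that the
  edges in \<open>I\<close> carry prescribed tuples: a factor \<open>1 / card Z\<close> for one of
  them and \<open>1 / D\<close> for each further one.\<close>

definition spread :: "'v set set \<Rightarrow> (('v set \<Rightarrow> 'i \<Rightarrow> 'w) \<Rightarrow> real) \<Rightarrow> bool" where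
  "spread H' W \<longleftrightarrow> (\<forall>\<zeta>. 0 \<le> W \<zeta>) \<and> (\<forall>\<zeta>\<in>PiE H' (\<lambda>_. Z). W \<zeta> \<noteq> 0 \<longrightarrow> consistent H' \<zeta>) \<and>
    (1 - 1 / (2 * real (card H))) ^ card H' \<le> (\<Sum>\<zeta>\<in>PiE H' (\<lambda>_. Z). W \<zeta>) \<and>
    (\<forall>I f. I \<subseteq> H' \<longrightarrow> I \<noteq> {} \<longrightarrow> (\<Sum>\<zeta>\<in>PiE H' (\<lambda>_. Z). if \<forall>G\<in>I. \<zeta> G = f G then W \<zeta> else 0)
      \<le> 1 / real (card Z) * (1 / D) ^ (card I - 1))"

lemma spreadD:
  assumes "spread H' W"
  shows "\<And>\<zeta>. 0 \<le> W \<zeta>" and "\<And>\<zeta>. \<zeta> \<in> PiE H' (\<lambda>_. Z) \<Longrightarrow> W \<zeta> \<noteq> 0 \<Longrightarrow> consistent H' \<zeta>"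
    and "(1 - 1 / (2 * real (card H))) ^ card H' \<le> (\<Sum>\<zeta>\<in>PiE H' (\<lambda>_. Z). W \<zeta>)"
    and "\<And>I f. I \<subseteq> H' \<Longrightarrow> I \<noteq> {} \<Longrightarrow> (\<Sum>\<zeta>\<in>PiE H' (\<lambda>_. Z). if \<forall>G\<in>I. \<zeta> G = f G then W \<zeta> else 0)
      \<le> 1 / real (card Z) * (1 / D) ^ (card I - 1)"
  using assms unfolding spread_def by auto

text \<open>The weights are the law of a tree-indexed Markov chain: the tuple of a new edge is uniform in
  the fiber of its parent. The chain is stationary, so every edge of the hypertree, and not only the
  first one, carries a uniformly distributed tuple.\<close>

lemma spread_weights:
  assumes "hypertree H'" "H' \<subseteq> H"
  shows "\<exists>W. spread H' W"
  using assms
proof (induction rule: hypertree.induct)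
  case (single E)
  let ?W = "\<lambda>\<zeta>::'v set \<Rightarrow> 'i \<Rightarrow> 'w. 1 / real (card Z)"
  have Zpos: "0 < real (card Z)" using finZ Z_nonempty by (simp add: card_gt_0_iff)
  have Hpos: "1 \<le> real (card H)" using finH single by (simp add: Suc_le_eq card_gt_0_iff) auto
  have tot: "(\<Sum>\<zeta>\<in>PiE {E} (\<lambda>_. Z). ?W \<zeta>) = 1" using Zpos by (simp add: card_PiE)
  have cons: "consistent {E} \<zeta>" if "\<zeta> \<in> PiE {E} (\<lambda>_. Z)" for \<zeta>
  proof -
    have "inj_on (\<zeta> E) R" "inj_on \<pi> E" using that single inj_tuple inj_pos by (auto simp: PiE_iff)
    then show ?thesis by (auto simp: consistent_def dest: inj_onD)
  qed
  have spread: "(\<Sum>\<zeta>\<in>PiE {E} (\<lambda>_. Z). if \<forall>G\<in>I. \<zeta> G = f G then ?W \<zeta> else 0) \<le> 1 / real (card Z) * (1 / D) ^ (card I - 1)"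
    if "I \<subseteq> {E}" "I \<noteq> {}" for I f
  proof -
    have I: "I = {E}" using that by auto
    let ?S = "{\<zeta> \<in> PiE {E} (\<lambda>_. Z). \<zeta> E = f E}"
    have "?S \<subseteq> {restrict f {E}}" by (auto simp: PiE_iff extensional_def fun_eq_iff)
    then have "card ?S \<le> 1" using card_mono[of "{restrict f {E}}" ?S] by simp
    then have "real (card ?S) * (1 / real (card Z)) \<le> 1 * (1 / real (card Z))" by (intro mult_right_mono) auto
    moreover have "(\<Sum>\<zeta>\<in>PiE {E} (\<lambda>_. Z). if \<forall>G\<in>I. \<zeta> G = f G then ?W \<zeta> else 0) = (\<Sum>\<zeta>\<in>?S. ?W \<zeta>)"
      using sum.inter_filter[OF finite_assignments[OF single], of ?W "\<lambda>\<zeta>. \<zeta> E = f E"] by (simp add: I)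
    ultimately show ?thesis by (simp add: I)
  qed
  show ?case
    unfolding spread_def by (rule exI[of _ ?W]) (use tot cons spread Hpos in auto)
next
  case (extend H' E F)
  then have H': "H' \<subseteq> H" and E: "E \<in> H" "E \<notin> H'" and F: "F \<in> H'" "F \<in> H" "E \<noteq> F"
    and leaf: "E \<inter> \<Union>H' = E \<inter> F" by auto
  obtain W where "spread H' W" using extend.IH[OF H'] by blast
  note W0 = spreadD(1)[OF this] and Wc = spreadD(2)[OF this] and Wt = spreadD(3)[OF this]
    and Ws = spreadD(4)[OF this]
  let ?A = "PiE H' (\<lambda>_. Z)"
  define P where "P = \<pi> ` (E \<inter> F)"
  define d where "d \<zeta> = real (card (fiber Z P (\<zeta> F)))" for \<zeta> :: "'v set \<Rightarrow> 'i \<Rightarrow> 'w"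
  define ext where "ext = extensions H' F E"
  \<comment> \<open>The divisor is the size of the whole fiber, not the number of admissible
    extensions. Mass is lost rather than redistributed, so events about old edges never gain
    probability, and the stationarity estimate below can use the full fiber.\<close>
  define W' where "W' \<zeta> = (if \<zeta> E \<in> ext (restrict \<zeta> H') then W (restrict \<zeta> H') / d (restrict \<zeta> H') else 0)" for \<zeta>
  have finA: "finite ?A" using finite_assignments[OF H'] .
  have finH': "finite H'" using finH H' finite_subset by auto
  have dD: "D \<le> d \<zeta>" "0 < d \<zeta>" if "\<zeta> \<in> ?A" for \<zeta>
  proof -
    have "\<zeta> F \<in> Z" using that F by auto
    then show "D \<le> d \<zeta>" using large_fibers[OF E(1) F(2,3)] by (simp add: d_def P_def)
    then show "0 < d \<zeta>" using D_pos by linarith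
  qed
  have extZ: "ext \<zeta> \<subseteq> fiber Z P (\<zeta> F)" for \<zeta> by (auto simp: ext_def extensions_def P_def)
  have extZ': "ext \<zeta> \<subseteq> Z" for \<zeta> using extZ by (auto simp: fiber_def)
  have restr: "restrict (\<zeta>(E := z)) H' = \<zeta>" if "\<zeta> \<in> ?A" for \<zeta> z
    using that E by (auto simp: PiE_iff extensional_def fun_eq_iff restrict_def)
  have W'upd: "W' (\<zeta>(E := z)) = (if z \<in> ext \<zeta> then W \<zeta> / d \<zeta> else 0)" if "\<zeta> \<in> ?A" for \<zeta> z
    by (simp add: W'_def restr[OF that])
  have row: "(\<Sum>z\<in>Z. if z \<in> ext \<zeta> then W \<zeta> / d \<zeta> else 0) = W \<zeta> * (real (card (ext \<zeta>)) / d \<zeta>)" for \<zeta>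
  proof -
    have "{z \<in> Z. z \<in> ext \<zeta>} = ext \<zeta>" using extZ' by auto
    then show ?thesis using finZ by (simp flip: sum.inter_filter)
  qed
  have ext_le: "real (card (ext \<zeta>)) / d \<zeta> \<le> 1" if "\<zeta> \<in> ?A" for \<zeta>
    using card_mono[OF finite_fiber[OF finZ] extZ, of \<zeta>] dD[OF that] by (simp add: d_def)
  have ext_ge: "1 - 1 / (2 * real (card H)) \<le> real (card (ext \<zeta>)) / d \<zeta>" if "\<zeta> \<in> ?A" for \<zeta>
    using many_extensions[OF H' F(1) E(1) that] dD[OF that] by (simp add: pos_le_divide_eq ext_def d_def P_def)
  have W'0: "0 \<le> W' \<zeta>" for \<zeta>
    using W0 by (auto simp: W'_def d_def)
  have Hpos: "1 \<le> real (card H)" using finH E by (simp add: Suc_le_eq card_gt_0_iff) auto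
  have cons: "consistent (insert E H') \<zeta>" if z: "\<zeta> \<in> PiE (insert E H') (\<lambda>_. Z)" "W' \<zeta> \<noteq> 0" for \<zeta>
  proof -
    let ?z = "restrict \<zeta> H'"
    have r: "?z \<in> ?A" using z by (auto simp: PiE_iff)
    have "\<zeta> E \<in> ext ?z" "W ?z \<noteq> 0" using z(2) by (auto simp: W'_def split: if_splits)
    then have "consistent (insert E H') (?z(E := \<zeta> E))"
      using consistent_extend[OF H' E F(1) leaf r Wc[OF r]] by (simp add: ext_def)
    moreover have "?z(E := \<zeta> E) = \<zeta>" using z by (auto simp: PiE_iff extensional_def fun_eq_iff restrict_def)
    ultimately show ?thesis by simp
  qed
  have tot: "(1 - 1 / (2 * real (card H))) ^ card (insert E H') \<le> (\<Sum>\<zeta>\<in>PiE (insert E H') (\<lambda>_. Z). W' \<zeta>)"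
  proof -
    have "(\<Sum>\<zeta>\<in>PiE (insert E H') (\<lambda>_. Z). W' \<zeta>) = (\<Sum>\<zeta>\<in>?A. \<Sum>z\<in>Z. W' (\<zeta>(E := z)))"
      by (rule sum_insert_PiE[OF E(2)])
    also have "\<dots> = (\<Sum>\<zeta>\<in>?A. W \<zeta> * (real (card (ext \<zeta>)) / d \<zeta>))"
      by (intro sum.cong refl) (simp only: W'upd row)
    also have "\<dots> \<ge> (\<Sum>\<zeta>\<in>?A. W \<zeta> * (1 - 1 / (2 * real (card H))))"
      by (intro sum_mono mult_left_mono ext_ge W0)
    finally have "(\<Sum>\<zeta>\<in>?A. W \<zeta>) * (1 - 1 / (2 * real (card H))) \<le> (\<Sum>\<zeta>\<in>PiE (insert E H') (\<lambda>_. Z). W' \<zeta>)"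
      by (simp add: sum_distrib_right)
    moreover have "(1 - 1 / (2 * real (card H))) ^ card H' * (1 - 1 / (2 * real (card H)))
        \<le> (\<Sum>\<zeta>\<in>?A. W \<zeta>) * (1 - 1 / (2 * real (card H)))"
      using Wt Hpos by (intro mult_right_mono) auto
    ultimately show ?thesis using E finH' by (simp add: mult.commute)
  qed
  have spread: "(\<Sum>\<zeta>\<in>PiE (insert E H') (\<lambda>_. Z). if \<forall>G\<in>I. \<zeta> G = f G then W' \<zeta> else 0)
      \<le> 1 / real (card Z) * (1 / D) ^ (card I - 1)" (is "?L \<le> _")
    if I: "I \<subseteq> insert E H'" "I \<noteq> {}" for I f
  proof -
    define J where "J = I - {E}"
    have J: "J \<subseteq> H'" "finite J" using I finH' finite_subset by (auto simp: J_def)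
    have L: "?L = (\<Sum>\<zeta>\<in>?A. \<Sum>z\<in>Z. if \<forall>G\<in>I. (\<zeta>(E := z)) G = f G then W' (\<zeta>(E := z)) else 0)"
      by (rule sum_insert_PiE[OF E(2)])
    show ?thesis
    proof (cases "E \<in> I")
      case False
      then have IH': "I \<subseteq> H'" using I by auto
      have "?L = (\<Sum>\<zeta>\<in>?A. if \<forall>G\<in>I. \<zeta> G = f G then W \<zeta> * (real (card (ext \<zeta>)) / d \<zeta>) else 0)"
        unfolding L
      proof (intro sum.cong refl)
        fix \<zeta> assume z: "\<zeta> \<in> ?A"
        have same: "(\<forall>G\<in>I. (\<zeta>(E := z)) G = f G) \<longleftrightarrow> (\<forall>G\<in>I. \<zeta> G = f G)" for z using False by auto
        show "(\<Sum>z\<in>Z. if \<forall>G\<in>I. (\<zeta>(E := z)) G = f G then W' (\<zeta>(E := z)) else 0)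
            = (if \<forall>G\<in>I. \<zeta> G = f G then W \<zeta> * (real (card (ext \<zeta>)) / d \<zeta>) else 0)"
          unfolding same W'upd[OF z]
          by (simp only: sum_if_const row)
      qed
      also have "\<dots> \<le> (\<Sum>\<zeta>\<in>?A. if \<forall>G\<in>I. \<zeta> G = f G then W \<zeta> else 0)"
      proof (intro sum_mono)
        fix \<zeta> assume "\<zeta> \<in> ?A"
        then have "W \<zeta> * (real (card (ext \<zeta>)) / d \<zeta>) \<le> W \<zeta> * 1" by (intro mult_left_mono ext_le W0)
        then show "(if \<forall>G\<in>I. \<zeta> G = f G then W \<zeta> * (real (card (ext \<zeta>)) / d \<zeta>) else 0) \<le> (if \<forall>G\<in>I. \<zeta> G = f G then W \<zeta> else 0)"
          by simp
      qed
      also have "\<dots> \<le> 1 / real (card Z) * (1 / D) ^ (card I - 1)" by (rule Ws[OF IH' I(2)])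
      finally show ?thesis .
    next
      case True
      have IJ: "I = insert E J" "E \<notin> J" using True by (auto simp: J_def)
      have inner: "(\<Sum>z\<in>Z. if \<forall>G\<in>I. (\<zeta>(E := z)) G = f G then W' (\<zeta>(E := z)) else 0)
          = (if (\<forall>G\<in>J. \<zeta> G = f G) \<and> f E \<in> ext \<zeta> then W \<zeta> / d \<zeta> else 0)" (is "?l = ?r") if z: "\<zeta> \<in> ?A" for \<zeta>
      proof -
        have "(\<forall>G\<in>I. (\<zeta>(E := z)) G = f G) \<longleftrightarrow> z = f E \<and> (\<forall>G\<in>J. \<zeta> G = f G)" for z using IJ by auto
        then have "?l = (\<Sum>z\<in>Z. if z = f E then (if (\<forall>G\<in>J. \<zeta> G = f G) \<and> f E \<in> ext \<zeta> then W \<zeta> / d \<zeta> else 0) else 0)"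
          by (intro sum.cong refl) (simp add: W'upd[OF z])
        also have "\<dots> = ?r" using finZ extZ'[of \<zeta>] by (auto simp: sum.delta)
        finally show ?thesis .
      qed
      have L': "?L = (\<Sum>\<zeta>\<in>?A. if (\<forall>G\<in>J. \<zeta> G = f G) \<and> f E \<in> ext \<zeta> then W \<zeta> / d \<zeta> else 0)"
        unfolding L by (intro sum.cong refl inner)
      show ?thesis
      proof (cases "J = {}")
        \<comment> \<open>Once the tuples on \<open>J\<close> are prescribed, each tuple of the new
          edge is taken with probability at most \<open>1 / D\<close>.\<close>
        case False
        have "?L \<le> (\<Sum>\<zeta>\<in>?A. 1 / D * (if \<forall>G\<in>J. \<zeta> G = f G then W \<zeta> else 0))"
          unfolding L'
        proof (intro sum_mono)
          fix \<zeta> assume z: "\<zeta> \<in> ?A"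
          have "W \<zeta> / d \<zeta> \<le> 1 / D * W \<zeta>"
            using dD[OF z] D_pos W0[of \<zeta>] by (simp add: frac_le)
          moreover have "0 \<le> 1 / D * W \<zeta>" using D_pos W0[of \<zeta>] by simp
          ultimately show "(if (\<forall>G\<in>J. \<zeta> G = f G) \<and> f E \<in> ext \<zeta> then W \<zeta> / d \<zeta> else 0) \<le> 1 / D * (if \<forall>G\<in>J. \<zeta> G = f G then W \<zeta> else 0)"
            by (simp split: if_splits)
        qed
        also have "\<dots> = 1 / D * (\<Sum>\<zeta>\<in>?A. if \<forall>G\<in>J. \<zeta> G = f G then W \<zeta> else 0)" by (rule sum_distrib_left[symmetric])
        also have "\<dots> \<le> 1 / D * (1 / real (card Z) * (1 / D) ^ (card J - 1))"
          using D_pos by (intro mult_left_mono Ws J False) auto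
        also have "\<dots> = 1 / real (card Z) * (1 / D) ^ Suc (card J - 1)" by simp
        also have "Suc (card J - 1) = card I - 1" using IJ J False by (simp add: card_gt_0_iff)
        finally show ?thesis .
      next
        case True
        \<comment> \<open>Stationarity: \<open>f E\<close> can be reached only from parent tuples in
          its own fiber \<open>Y\<close>. Each of these has weight at most \<open>1 / card Z\<close>
          and passes on a share \<open>1 / card Y\<close>, and there are \<open>card Y\<close> of
          them.\<close>
        define Y where "Y = fiber Z P (f E)"
        have finY: "finite Y" using finite_fiber[OF finZ] by (simp add: Y_def)
        have "?L \<le> (\<Sum>\<zeta>\<in>?A. \<Sum>y\<in>Y. 1 / real (card Y) * (if \<forall>G\<in>{F}. \<zeta> G = y then W \<zeta> else 0))"
          unfolding L'
        proof (intro sum_mono)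
          fix \<zeta> assume z: "\<zeta> \<in> ?A"
          have rhs0: "0 \<le> (\<Sum>y\<in>Y. 1 / real (card Y) * (if \<forall>G\<in>{F}. \<zeta> G = y then W \<zeta> else 0))"
            using W0 by (intro sum_nonneg) auto
          show "(if (\<forall>G\<in>J. \<zeta> G = f G) \<and> f E \<in> ext \<zeta> then W \<zeta> / d \<zeta> else 0)
              \<le> (\<Sum>y\<in>Y. 1 / real (card Y) * (if \<forall>G\<in>{F}. \<zeta> G = y then W \<zeta> else 0))"
          proof (cases "f E \<in> ext \<zeta>")
            case fE: True
            have fib: "f E \<in> fiber Z P (\<zeta> F)" using fE extZ by auto
            have "\<zeta> F \<in> Z" using z F by auto
            then have "\<zeta> F \<in> Y" using fib by (auto simp: Y_def fiber_def)
            moreover have "real (card Y) = d \<zeta>" using fiber_eq[OF fib] by (simp add: Y_def d_def)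
            ultimately have "(\<Sum>y\<in>Y. 1 / real (card Y) * (if \<forall>G\<in>{F}. \<zeta> G = y then W \<zeta> else 0)) = W \<zeta> / d \<zeta>"
              using finY by (simp add: if_distrib sum.delta cong: if_cong)
            then show ?thesis using rhs0 by simp
          qed (use rhs0 in simp)
        qed
        also have "\<dots> = (\<Sum>y\<in>Y. 1 / real (card Y) * (\<Sum>\<zeta>\<in>?A. if \<forall>G\<in>{F}. \<zeta> G = y then W \<zeta> else 0))"
          unfolding sum_distrib_left by (rule sum.swap)
        also have "\<dots> \<le> (\<Sum>y\<in>Y. 1 / real (card Y) * (1 / real (card Z) * (1 / D) ^ (card {F} - 1)))"
          using F by (intro sum_mono mult_left_mono Ws) auto
        also have "\<dots> \<le> 1 / real (card Z)" by simp
        finally show ?thesis using IJ True by simp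
      qed
    qed
  qed
  show ?case
    unfolding spread_def using W'0 cons tot spread by (intro exI[of _ W'] conjI allI ballI impI)
qed

section \<open>From assignments of tuples to copies\<close>

definition edge_image :: "('v set \<Rightarrow> 'i \<Rightarrow> 'w) \<Rightarrow> 'w set set" where
  "edge_image \<zeta> = (\<lambda>E. \<zeta> E ` \<pi> ` E) ` H"

lemma consistent_imp_copy:
  assumes cons: "consistent H \<zeta>" and edge: "\<And>E. E \<in> H \<Longrightarrow> \<zeta> E ` \<pi> ` E \<in> \<F>"
  shows "edge_image \<zeta> \<in> copies H \<F>"
proof -
  have c1: "\<And>A B v. A \<in> H \<Longrightarrow> B \<in> H \<Longrightarrow> v \<in> A \<Longrightarrow> v \<in> B \<Longrightarrow> \<zeta> A (\<pi> v) = \<zeta> B (\<pi> v)"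
    and c2: "\<And>A B p q. A \<in> H \<Longrightarrow> B \<in> H \<Longrightarrow> p \<in> R \<Longrightarrow> q \<in> R \<Longrightarrow> p \<noteq> q \<Longrightarrow> \<zeta> A p \<noteq> \<zeta> B q"
    and c3: "\<And>A B u v. A \<in> H \<Longrightarrow> B \<in> H \<Longrightarrow> u \<in> A \<Longrightarrow> v \<in> B \<Longrightarrow> u \<noteq> v \<Longrightarrow> \<pi> u = \<pi> v \<Longrightarrow> \<zeta> A (\<pi> u) \<noteq> \<zeta> B (\<pi> v)"
    using cons unfolding consistent_def by blast+
  define \<phi> where "\<phi> v = \<zeta> (SOME E. E \<in> H \<and> v \<in> E) (\<pi> v)" for v
  have \<phi>: "\<phi> v = \<zeta> E (\<pi> v)" if "E \<in> H" "v \<in> E" for v E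
  proof -
    have "(SOME E. E \<in> H \<and> v \<in> E) \<in> H \<and> v \<in> (SOME E. E \<in> H \<and> v \<in> E)"
      using that by (intro someI[of "\<lambda>E. E \<in> H \<and> v \<in> E" E]) simp
    then show ?thesis unfolding \<phi>_def using c1[OF _ that(1) _ that(2)] by blast
  qed
  have img: "\<phi> ` E = \<zeta> E ` \<pi> ` E" if "E \<in> H" for E
    using \<phi>[OF that] by (auto simp: image_image intro!: image_cong)
  have "inj_on \<phi> (\<Union>H)"
  proof (rule inj_onI, rule ccontr)
    fix u v assume "u \<in> \<Union>H" "v \<in> \<Union>H" and eq: "\<phi> u = \<phi> v" and ne: "u \<noteq> v"
    then obtain E F where EF: "E \<in> H" "u \<in> E" "F \<in> H" "v \<in> F" by auto
    have R: "\<pi> u \<in> R" "\<pi> v \<in> R" using pos_in EF by auto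
    have "\<zeta> E (\<pi> u) = \<zeta> F (\<pi> v)" using eq \<phi> EF by simp
    then show False
      using c2[OF EF(1,3) R] c3[OF EF(1,3,2,4) ne] by (cases "\<pi> u = \<pi> v") auto
  qed
  moreover have eq: "(\<lambda>E. \<phi> ` E) ` H = edge_image \<zeta>"
    unfolding edge_image_def by (intro image_cong refl img)
  moreover have "\<phi> ` \<Union>H = \<Union>(edge_image \<zeta>)" by (simp add: image_Union flip: eq)
  ultimately have "hypergraph_isomorphic H (edge_image \<zeta>)"
    unfolding hypergraph_isomorphic_def bij_betw_def by blast
  moreover have "edge_image \<zeta> \<subseteq> \<F>" using edge by (auto simp: edge_image_def)
  ultimately show ?thesis by (simp add: copies_def)
qed

text \<open>The weights are pushed forward along \<open>edge_image\<close>. If a copy contains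
  \<open>S\<close>, each \<open>s \<in> S\<close> is the image of some edge of \<open>H\<close>
  under one of at most \<open>L\<close> tuples. This leaves at most
  \<open>(card H * L) ^ card S\<close> events, each prescribing the tuples of \<open>card S\<close>
  edges.\<close>

lemma copies_spread:
  assumes fin\<F>: "finite \<F>" and edge: "\<And>z E. z \<in> Z \<Longrightarrow> E \<in> H \<Longrightarrow> z ` \<pi> ` E \<in> \<F>"
    and mult: "\<And>E f. E \<in> H \<Longrightarrow> card {z \<in> Z. z ` \<pi> ` E = f} \<le> L"
  shows "\<exists>w. (\<forall>C. 0 \<le> w C) \<and> 1 / 2 \<le> (\<Sum>C\<in>copies H \<F>. w C) \<and>
    (\<forall>S. finite S \<longrightarrow> S \<noteq> {} \<longrightarrow> (\<Sum>C\<in>{C \<in> copies H \<F>. S \<subseteq> C}. w C)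
      \<le> real (card H * L) ^ card S * (1 / real (card Z) * (1 / D) ^ (card S - 1)))"
proof -
  let ?A = "PiE H (\<lambda>_. Z)"
  obtain W where W: "spread H W" using spread_weights[OF tree] by auto
  define w where "w C = (\<Sum>\<zeta>\<in>{\<zeta> \<in> ?A. edge_image \<zeta> = C}. W \<zeta>)" for C
  have finA: "finite ?A" by (rule finite_assignments) simp
  have fin_copies: "finite (copies H \<F>)"
    by (rule finite_subset[of _ "Pow \<F>"]) (auto simp: copies_def fin\<F>)
  have w0: "0 \<le> w C" for C unfolding w_def by (intro sum_nonneg spreadD(1)[OF W])
  have group: "(\<Sum>C\<in>X. w C) = (\<Sum>\<zeta>\<in>{\<zeta> \<in> ?A. edge_image \<zeta> \<in> X}. W \<zeta>)" if "finite X" for X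
  proof -
    have "(\<Sum>C\<in>X. \<Sum>\<zeta>\<in>{\<zeta> \<in> {\<zeta> \<in> ?A. edge_image \<zeta> \<in> X}. edge_image \<zeta> = C}. W \<zeta>)
        = (\<Sum>\<zeta>\<in>{\<zeta> \<in> ?A. edge_image \<zeta> \<in> X}. W \<zeta>)"
      using finA that by (intro sum.group) auto
    moreover have "(\<Sum>\<zeta>\<in>{\<zeta> \<in> {\<zeta> \<in> ?A. edge_image \<zeta> \<in> X}. edge_image \<zeta> = C}. W \<zeta>) = w C" if "C \<in> X" for C
      unfolding w_def using that by (intro sum.cong) auto
    ultimately show ?thesis by simp
  qed
  \<comment> \<open>Bernoulli's inequality turns the failure probability
    \<open>1 / (2 * card H)\<close> per edge into an overall success probability of at least one
    half.\<close>
  have "1 / 2 \<le> (1 - 1 / (2 * real (card H))) ^ card H"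
  proof -
    have pos: "1 \<le> real (card H)" using finH hypertree_nonempty[OF tree] by (simp add: Suc_le_eq card_gt_0_iff)
    then have "1 / (2 * real (card H)) \<le> 1" by simp
    then have "-1 \<le> - (1 / (2 * real (card H)))" by linarith
    from Bernoulli_inequality[OF this, of "card H"] show ?thesis using pos by simp
  qed
  also have "\<dots> \<le> (\<Sum>\<zeta>\<in>?A. W \<zeta>)" by (rule spreadD(3)[OF W])
  also have "\<dots> = (\<Sum>\<zeta>\<in>{\<zeta> \<in> ?A. edge_image \<zeta> \<in> copies H \<F>}. W \<zeta>)"
  proof (intro sum.mono_neutral_right finA ballI)
    fix \<zeta> assume z: "\<zeta> \<in> ?A - {\<zeta> \<in> ?A. edge_image \<zeta> \<in> copies H \<F>}"
    then have "\<zeta> E ` \<pi> ` E \<in> \<F>" if "E \<in> H" for E using edge that by (auto simp: PiE_iff)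
    then show "W \<zeta> = 0" using z consistent_imp_copy spreadD(2)[OF W, of \<zeta>] by blast
  qed auto
  also have "\<dots> = (\<Sum>C\<in>copies H \<F>. w C)" by (rule group[OF fin_copies, symmetric])
  finally have total: "1 / 2 \<le> (\<Sum>C\<in>copies H \<F>. w C)" .
  have spr: "(\<Sum>C\<in>{C \<in> copies H \<F>. S \<subseteq> C}. w C)
      \<le> real (card H * L) ^ card S * (1 / real (card Z) * (1 / D) ^ (card S - 1))"
    if S: "finite S" "S \<noteq> {}" for S
  proof -
    define B where "B = 1 / real (card Z) * (1 / D) ^ (card S - 1)"
    have B0: "0 \<le> B" using D_pos by (simp add: B_def)
    define J where "J = Sigma (PiE S (\<lambda>_. H)) (\<lambda>g. PiE S (\<lambda>s. {z \<in> Z. z ` \<pi> ` g s = s}))"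
    \<comment> \<open>Different members of \<open>S\<close> come from different edges of
      \<open>H\<close>, because the tuple of an edge fixes its image. Injectivity of
      \<open>g\<close> is what yields the exponent \<open>card S - 1\<close>.\<close>
    define J' where "J' = {(g, f) \<in> J. inj_on g S}"
    define X where "X = (\<lambda>(g, f). {\<zeta> \<in> ?A. \<forall>s\<in>S. \<zeta> (g s) = f s})"
    have finJ: "finite J" unfolding J_def using S finH finZ by (intro finite_SigmaI finite_PiE) auto
    have finJ': "finite J'" "J' \<subseteq> J" using finJ by (auto simp: J'_def intro: finite_subset[of _ J])
    have cJ: "card J \<le> (card H * L) ^ card S"
    proof -
      have "card J = (\<Sum>g\<in>PiE S (\<lambda>_. H). card (PiE S (\<lambda>s. {z \<in> Z. z ` \<pi> ` g s = s})))"
        unfolding J_def using S finH finZ by (intro card_SigmaI finite_PiE ballI) auto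
      also have "\<dots> \<le> (\<Sum>g\<in>PiE S (\<lambda>_. H). L ^ card S)"
      proof (intro sum_mono)
        fix g assume g: "g \<in> PiE S (\<lambda>_. H)"
        have "card (PiE S (\<lambda>s. {z \<in> Z. z ` \<pi> ` g s = s})) = (\<Prod>s\<in>S. card {z \<in> Z. z ` \<pi> ` g s = s})"
          using S by (simp add: card_PiE)
        also have "\<dots> \<le> (\<Prod>s\<in>S. L)" using g mult by (intro prod_mono) auto
        finally show "card (PiE S (\<lambda>s. {z \<in> Z. z ` \<pi> ` g s = s})) \<le> L ^ card S" by simp
      qed
      also have "\<dots> = (card H * L) ^ card S" using S by (simp add: card_PiE power_mult_distrib)
      finally show ?thesis .
    qed
    have each: "sum W (X j) \<le> B" if j: "j \<in> J'" for j
    proof -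
      obtain g f where [simp]: "j = (g, f)" by (cases j)
      have g: "g \<in> PiE S (\<lambda>_. H)" "inj_on g S" using j by (auto simp: J'_def J_def)
      define h where "h E = f (the_inv_into S g E)" for E
      have "(\<forall>G\<in>g ` S. \<zeta> G = h G) \<longleftrightarrow> (\<forall>s\<in>S. \<zeta> (g s) = f s)" for \<zeta>
        using g by (simp add: h_def the_inv_into_f_f)
      then have "sum W (X j) = (\<Sum>\<zeta>\<in>{\<zeta> \<in> ?A. \<forall>G\<in>g ` S. \<zeta> G = h G}. W \<zeta>)" by (simp add: X_def)
      also have "\<dots> = (\<Sum>\<zeta>\<in>?A. if \<forall>G\<in>g ` S. \<zeta> G = h G then W \<zeta> else 0)" by (rule sum.inter_filter[OF finA])
      also have "\<dots> \<le> 1 / real (card Z) * (1 / D) ^ (card (g ` S) - 1)"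
        using g S by (intro spreadD(4)[OF W]) auto
      finally show ?thesis using g by (simp add: card_image B_def)
    qed
    have cover: "{\<zeta> \<in> ?A. edge_image \<zeta> \<in> {C \<in> copies H \<F>. S \<subseteq> C}} \<subseteq> (\<Union>j\<in>J'. X j)"
    proof
      fix \<zeta> assume z: "\<zeta> \<in> {\<zeta> \<in> ?A. edge_image \<zeta> \<in> {C \<in> copies H \<F>. S \<subseteq> C}}"
      then have "\<forall>s\<in>S. \<exists>E. E \<in> H \<and> \<zeta> E ` \<pi> ` E = s" by (auto simp: edge_image_def)
      from bchoice[OF this] obtain g where "\<forall>s\<in>S. g s \<in> H \<and> \<zeta> (g s) ` \<pi> ` g s = s" by (rule exE)
      then have g: "g s \<in> H" "\<zeta> (g s) ` \<pi> ` g s = s" if "s \<in> S" for s using that by auto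
      define g' where "g' = restrict g S"
      define f where "f = restrict (\<lambda>s. \<zeta> (g s)) S"
      have "inj_on g' S"
      proof (rule inj_onI)
        fix s s' assume s: "s \<in> S" "s' \<in> S" "g' s = g' s'"
        then have "g s = g s'" by (simp add: g'_def)
        then have "\<zeta> (g s) ` \<pi> ` g s = \<zeta> (g s') ` \<pi> ` g s'" by (simp only:)
        then show "s = s'" unfolding g(2)[OF s(1)] g(2)[OF s(2)] .
      qed
      moreover have "g' \<in> PiE S (\<lambda>_. H)" using g by (auto simp: g'_def)
      moreover have "f \<in> PiE S (\<lambda>s. {z \<in> Z. z ` \<pi> ` g' s = s})"
        using g z unfolding f_def g'_def by (simp add: PiE_iff)
      ultimately have "(g', f) \<in> J'" by (auto simp: J'_def J_def)
      moreover have "\<zeta> \<in> X (g', f)" using z by (auto simp: X_def g'_def f_def)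
      ultimately show "\<zeta> \<in> (\<Union>j\<in>J'. X j)" by blast
    qed
    have finX: "finite (X j)" for j using finA by (auto simp: X_def split: prod.splits)
    have "(\<Sum>C\<in>{C \<in> copies H \<F>. S \<subseteq> C}. w C) = (\<Sum>\<zeta>\<in>{\<zeta> \<in> ?A. edge_image \<zeta> \<in> {C \<in> copies H \<F>. S \<subseteq> C}}. W \<zeta>)"
      using fin_copies by (intro group) simp
    also have "\<dots> \<le> sum W (\<Union>j\<in>J'. X j)"
      using finJ' finX by (intro sum_mono2 cover spreadD(1)[OF W]) auto
    also have "\<dots> \<le> (\<Sum>j\<in>J'. sum W (X j))" by (intro sum_UN_le finJ' finX spreadD(1)[OF W])
    also have "\<dots> \<le> (\<Sum>j\<in>J'. B)" by (intro sum_mono each)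
    also have "\<dots> = real (card J') * B" by simp
    also have "\<dots> \<le> real ((card H * L) ^ card S) * B"
      using cJ card_mono[OF finJ finJ'(2)] B0 by (intro mult_right_mono of_nat_mono) auto
    finally show ?thesis by (simp add: B_def)
  qed
  show ?thesis using w0 total spr by (intro exI[of _ w]) auto
qed

end

text \<open>A maximal collection respecting the codegree caps is large: otherwise the saturated sets
  would carry too little weight to meet every member of the family.\<close>

lemma balanced_subcollection:
  fixes m c :: real and w :: "'e set \<Rightarrow> real"
  assumes finF: "finite \<F>" "\<F> \<noteq> {}" and mem: "\<And>C. C \<in> \<C> \<Longrightarrow> C \<subseteq> \<F> \<and> card C = t"
    and t: "1 \<le> t" and m: "1 \<le> m" and c: "0 < c" and w: "\<And>C. 0 \<le> w C"
    and total: "1 / 2 \<le> (\<Sum>C\<in>\<C>. w C)"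
    and spread: "\<And>S. S \<subseteq> \<F> \<Longrightarrow> S \<noteq> {} \<Longrightarrow> card S \<le> t \<Longrightarrow>
      (\<Sum>C\<in>{C \<in> \<C>. S \<subseteq> C}. w C) \<le> c / real (card \<F>) * (1 / m) ^ (card S - 1)"
  shows "\<exists>K\<subseteq>\<C>. real (card \<F>) * m ^ (t - 1) \<le> 4 * c * 2 ^ t * real (card K) \<and>
    (\<forall>S\<subseteq>\<F>. S \<noteq> {} \<longrightarrow> card S \<le> t \<longrightarrow> real (card {C \<in> K. S \<subseteq> C}) \<le> m ^ (t - card S))"
proof -
  have finC: "finite \<C>" by (rule finite_subset[of _ "Pow \<F>"]) (use mem finF in auto)
  define d where "d K S = card {C \<in> K. S \<subseteq> C}" for K and S :: "'e set"
  \<comment> \<open>The cap is the codegree that the goal asks for: \<open>m ^ (t - card S)\<close>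
    equals \<open>(1 / m) ^ (card S - 1) * card K / card \<F>\<close> for a collection of size
    \<open>card \<F> * m ^ (t - 1)\<close>.\<close>
  define ok where "ok K \<longleftrightarrow> (\<forall>S\<subseteq>\<F>. S \<noteq> {} \<longrightarrow> card S \<le> t \<longrightarrow> real (d K S) \<le> m ^ (t - card S))" for K
  have m1: "1 \<le> m ^ j" for j using m by (rule one_le_power)
  have m0: "0 < m" using m by simp
  have "{} \<in> {K \<in> Pow \<C>. ok K}" using m0 by (simp add: ok_def d_def)
  moreover have "finite {K \<in> Pow \<C>. ok K}" using finC by simp
  ultimately obtain K where K: "K \<subseteq> \<C>" "ok K"
    and Kmax: "\<And>K'. K' \<subseteq> \<C> \<Longrightarrow> ok K' \<Longrightarrow> card K' \<le> card K"
  proof -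
    have "card K' < Suc (card \<C>)" if "K' \<subseteq> \<C> \<and> ok K'" for K' using card_mono[OF finC] that by (simp add: less_Suc_eq_le)
    then have "\<exists>K. (K \<subseteq> \<C> \<and> ok K) \<and> (\<forall>K'. K' \<subseteq> \<C> \<and> ok K' \<longrightarrow> card K' \<le> card K)"
      using \<open>{} \<in> {K \<in> Pow \<C>. ok K}\<close> by (intro ex_has_greatest_nat[of _ "{}" _ "Suc (card \<C>)"]) auto
    then show ?thesis using that by blast
  qed
  have finK: "finite K" using K finC finite_subset by auto
  \<comment> \<open>Reaching half the cap already counts as saturated: codegrees are integers and
    caps are at least 1, so a set whose cap would be exceeded by one more copy is at least half
    full. A member of \<open>K\<close> saturates itself, its cap being \<open>m ^ 0\<close>.\<close>
  define sat where "sat = {S. S \<subseteq> \<F> \<and> S \<noteq> {} \<and> card S \<le> t \<and> m ^ (t - card S) \<le> 2 * real (d K S)}"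
  have finsat: "finite sat" using finF by (simp add: sat_def)
  have hit: "\<exists>S\<in>sat. S \<subseteq> C" if C: "C \<in> \<C>" for C
  proof (cases "C \<in> K")
    case True
    have "C \<noteq> {}" using mem[OF C] t by auto
    moreover have "1 \<le> d K C"
      unfolding d_def using True finK by (simp add: Suc_le_eq card_gt_0_iff) auto
    ultimately show ?thesis using mem[OF C] by (intro bexI[of _ C]) (auto simp: sat_def)
  next
    case False
    have "\<not> ok (insert C K)" using Kmax[of "insert C K"] C K finK False by auto
    then obtain S where S: "S \<subseteq> \<F>" "S \<noteq> {}" "card S \<le> t" "m ^ (t - card S) < real (d (insert C K) S)"
      unfolding ok_def by (meson not_le)
    have old: "real (d K S) \<le> m ^ (t - card S)" using K(2) S unfolding ok_def by blast
    have SC: "S \<subseteq> C"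
    proof (rule ccontr)
      assume "\<not> S \<subseteq> C"
      then have "{D \<in> insert C K. S \<subseteq> D} = {D \<in> K. S \<subseteq> D}" by auto
      then show False using S(4) old by (simp add: d_def)
    qed
    have "{D \<in> insert C K. S \<subseteq> D} = insert C {D \<in> K. S \<subseteq> D}" using SC by auto
    then have "d (insert C K) S = Suc (d K S)" using False finK by (simp add: d_def)
    then have "m ^ (t - card S) < real (d K S) + 1" using S(4) by simp
    then have "m ^ (t - card S) \<le> 2 * real (d K S)" using m1[of "t - card S"] by (cases "d K S") auto
    then show ?thesis using S SC by (intro bexI[of _ S]) (auto simp: sat_def)
  qed
  have F0: "0 < real (card \<F>)" using finF by (simp add: card_gt_0_iff)
  have "1 / 2 \<le> sum w \<C>" by (rule total)
  also have "\<dots> \<le> sum w (\<Union>S\<in>sat. {C \<in> \<C>. S \<subseteq> C})"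
    using finsat finC w hit by (intro sum_mono2) auto
  also have "\<dots> \<le> (\<Sum>S\<in>sat. \<Sum>C\<in>{C \<in> \<C>. S \<subseteq> C}. w C)"
    by (intro sum_UN_le finsat w) (use finC in auto)
  \<comment> \<open>The weight through a saturated set is charged to its codegree, since
    \<open>m ^ (t - card S)\<close> is at most twice \<open>d K S\<close>.\<close>
  also have "\<dots> \<le> (\<Sum>S\<in>sat. 2 * c / (real (card \<F>) * m ^ (t - 1)) * real (d K S))"
  proof (intro sum_mono)
    fix S assume S: "S \<in> sat"
    then have "finite S" using finF by (auto simp: sat_def intro: finite_subset)
    then have "card S \<noteq> 0" using S by (simp add: sat_def)
    then have e: "t - 1 = (t - card S) + (card S - 1)" using S by (auto simp: sat_def)
    have "(\<Sum>C\<in>{C \<in> \<C>. S \<subseteq> C}. w C) \<le> c / real (card \<F>) * (1 / m) ^ (card S - 1)"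
      using S by (intro spread) (auto simp: sat_def)
    also have "(1 / m) ^ (card S - 1) = m ^ (t - card S) / m ^ (t - 1)"
      unfolding e power_add using m0 by (simp add: power_one_over)
    also have "c / real (card \<F>) * (m ^ (t - card S) / m ^ (t - 1)) \<le> c / real (card \<F>) * (2 * real (d K S) / m ^ (t - 1))"
      using S c m0 by (intro mult_left_mono divide_right_mono) (auto simp: sat_def)
    finally show "(\<Sum>C\<in>{C \<in> \<C>. S \<subseteq> C}. w C) \<le> 2 * c / (real (card \<F>) * m ^ (t - 1)) * real (d K S)"
      by (simp add: mult_ac)
  qed
  also have "\<dots> = 2 * c / (real (card \<F>) * m ^ (t - 1)) * real (\<Sum>S\<in>sat. d K S)"
    by (simp add: sum_distrib_left)
  also have "\<dots> \<le> 2 * c / (real (card \<F>) * m ^ (t - 1)) * real (2 ^ t * card K)"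
  proof (intro mult_left_mono of_nat_mono)
    \<comment> \<open>Double counting: summed over all \<open>S\<close>, the codegrees count each
      member of \<open>K\<close> once for each of its \<open>2 ^ t\<close> subsets.\<close>
    have "(\<Sum>S\<in>sat. d K S) \<le> (\<Sum>S\<in>Pow \<F>. d K S)"
      using finF by (intro sum_mono2) (auto simp: sat_def)
    also have "\<dots> = (\<Sum>S\<in>Pow \<F>. \<Sum>C\<in>K. if S \<subseteq> C then 1 else 0)"
      using finK by (simp add: d_def sum.inter_filter[symmetric])
    also have "\<dots> = (\<Sum>C\<in>K. \<Sum>S\<in>Pow \<F>. if S \<subseteq> C then 1 else 0)" by (rule sum.swap)
    also have "\<dots> = (\<Sum>C\<in>K. 2 ^ t)"
    proof (intro sum.cong refl)
      fix C assume "C \<in> K"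
      then have C: "C \<subseteq> \<F>" "card C = t" using K mem by auto
      have "(\<Sum>S\<in>Pow \<F>. if S \<subseteq> C then 1 else 0) = card {S \<in> Pow \<F>. S \<subseteq> C}"
        using finF by (simp add: sum.inter_filter[symmetric])
      also have "{S \<in> Pow \<F>. S \<subseteq> C} = Pow C" using C by auto
      finally show "(\<Sum>S\<in>Pow \<F>. if S \<subseteq> C then 1 else 0) = (2::nat) ^ t"
        using C by (simp add: card_Pow finite_subset[OF C(1) finF(1)])
    qed
    finally show "(\<Sum>S\<in>sat. d K S) \<le> 2 ^ t * card K" by (simp add: mult.commute)
  qed (use c m0 in auto)
  finally have "1 / 2 \<le> 2 * c / (real (card \<F>) * m ^ (t - 1)) * real (2 ^ t * card K)" .
  then have "real (card \<F>) * m ^ (t - 1) \<le> 4 * c * 2 ^ t * real (card K)"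
    using F0 m0 by (simp add: pos_le_divide_eq mult_ac)
  then show ?thesis using K unfolding ok_def d_def by blast
qed

section \<open>Positions for the vertices of the hypertree\<close>

text \<open>\<open>U\<close> stands for vertices that are placed separately: two private vertices
  per edge, or a cross-cut. The already coloured vertices of a new edge all lie in its neighbour
  \<open>F\<close>, where colours are distinct, so its new vertices can take exactly the colours
  left over.\<close>

lemma hypertree_colouring:
  assumes "hypertree H" "\<And>E. E \<in> H \<Longrightarrow> finite E \<and> card (E - U) = c"
  shows "\<exists>\<rho>. \<forall>E\<in>H. bij_betw \<rho> (E - U) {..<c}"
  using assms
proof (induction rule: hypertree.induct)
  case (single E)
  then show ?case using ex_bij_betw_finite_nat[of "E - U"] by (auto simp: atLeast0LessThan)
next
  case (extend H' E F)
  obtain \<rho> where \<rho>: "\<And>G. G \<in> H' \<Longrightarrow> bij_betw \<rho> (G - U) {..<c}"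
  proof -
    have "\<exists>\<rho>. \<forall>G\<in>H'. bij_betw \<rho> (G - U) {..<c}" by (rule extend.IH) (use extend.prems in auto)
    then show ?thesis using that by blast
  qed
  define A where "A = E \<inter> F - U"
  define N where "N = E - U - \<Union>H'"
  have AN: "E - U = A \<union> N" "A \<inter> N = {}" using extend by (auto simp: A_def N_def)
  have fin: "finite (E - U)" "card (E - U) = c" using extend by auto
  have finAN: "finite A" "finite N" using fin AN by auto
  have injA: "inj_on \<rho> A" and imA: "\<rho> ` A \<subseteq> {..<c}"
    using \<rho>[OF extend(3)] by (auto simp: A_def bij_betw_def inj_on_def)
  have "card N = card ({..<c} - \<rho> ` A)"
    using fin AN finAN injA imA by (simp add: card_Diff_subset card_image card_Un_disjoint)
  then obtain h where h: "bij_betw h N ({..<c} - \<rho> ` A)"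
    using finite_same_card_bij[of N "{..<c} - \<rho> ` A"] finAN by auto
  define \<rho>' where "\<rho>' v = (if v \<in> \<Union>H' then \<rho> v else h v)" for v
  have "bij_betw \<rho>' A (\<rho> ` A)"
    using injA extend(3) by (auto simp: bij_betw_def \<rho>'_def A_def inj_on_def)
  moreover have "bij_betw \<rho>' N ({..<c} - \<rho> ` A)"
    using h by (rule bij_betw_cong[THEN iffD1, rotated]) (auto simp: \<rho>'_def N_def)
  ultimately have "bij_betw \<rho>' (A \<union> N) (\<rho> ` A \<union> ({..<c} - \<rho> ` A))"
    by (rule bij_betw_combine) auto
  then have "bij_betw \<rho>' (E - U) {..<c}" using imA AN by (simp add: Un_absorb1)
  moreover have "bij_betw \<rho>' (G - U) {..<c}" if "G \<in> H'" for G
    using \<rho>[OF that] by (rule bij_betw_cong[THEN iffD1, rotated]) (use that in \<open>auto simp: \<rho>'_def\<close>)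
  ultimately show ?case by (intro exI[of _ \<rho>']) auto
qed

lemma degree_one_unique:
  assumes "degree H v = 1" "E \<in> H" "F \<in> H" "v \<in> E" "v \<in> F"
  shows "E = F"
proof -
  obtain G where G: "{E \<in> H. v \<in> E} = {G}"
    using assms(1) unfolding degree_def by (rule card_1_singletonE)
  have "E \<in> {E \<in> H. v \<in> E}" "F \<in> {E \<in> H. v \<in> E}" using assms by simp_all
  then show ?thesis unfolding G by simp
qed

lemma two_contractible_private_vertices:
  assumes "two_contractible H"
  obtains u1 u2 where "\<And>E. E \<in> H \<Longrightarrow> u1 E \<in> E \<and> u2 E \<in> E \<and> u1 E \<noteq> u2 E"
    and "\<And>E F. E \<in> H \<Longrightarrow> F \<in> H \<Longrightarrow> u1 E \<in> F \<or> u2 E \<in> F \<Longrightarrow> E = F"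
proof -
  have "\<forall>E\<in>H. \<exists>p. fst p \<in> E \<and> snd p \<in> E \<and> fst p \<noteq> snd p \<and> degree H (fst p) = 1 \<and> degree H (snd p) = 1"
  proof
    fix E assume "E \<in> H"
    then have "2 \<le> card {v \<in> E. degree H v = 1}" using assms by (simp add: two_contractible_def)
    then obtain u v where "u \<in> {v \<in> E. degree H v = 1}" "v \<in> {v \<in> E. degree H v = 1}" "u \<noteq> v"
      by (auto simp: card_le_Suc_iff numeral_2_eq_2)
    then show "\<exists>p. fst p \<in> E \<and> snd p \<in> E \<and> fst p \<noteq> snd p \<and> degree H (fst p) = 1 \<and> degree H (snd p) = 1"
      by (intro exI[of _ "(u, v)"]) simp
  qed
  from bchoice[OF this] obtain u where u: "\<And>E. E \<in> H \<Longrightarrow> fst (u E) \<in> E \<and> snd (u E) \<in> E \<and> fst (u E) \<noteq> snd (u E)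
      \<and> degree H (fst (u E)) = 1 \<and> degree H (snd (u E)) = 1" by auto
  show ?thesis
  proof (rule that[of "fst \<circ> u" "snd \<circ> u"])
    fix E F assume "E \<in> H" "F \<in> H" "(fst \<circ> u) E \<in> F \<or> (snd \<circ> u) E \<in> F"
    then show "E = F"
      using u[of E] degree_one_unique[of H "fst (u E)" E F] degree_one_unique[of H "snd (u E)" E F] by auto
  qed (use u in auto)
qed

section \<open>Closed sets of positions and the placement of the vertices\<close>

lemma determines_trans:
  assumes "\<And>x. x \<in> Q' \<Longrightarrow> determines Z Q x" "determines Z Q' y"
  shows "determines Z Q y"
  unfolding determines_def
proof (intro ballI)
  fix z z' assume z: "z \<in> Z" "z' \<in> fiber Z Q z"
  then have "z' \<in> fiber Z Q' z" using assms(1) by (auto simp: determines_def fiber_def)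
  then show "z' y = z y" using assms(2) z by (auto simp: determines_def)
qed

text \<open>If \<open>P\<close> determined \<open>q\<close>, then \<open>q\<close> and one of
  \<open>p1\<close>, \<open>p2\<close> could both be recovered from the remaining
  \<open>card B - 2\<close> positions of \<open>B\<close>, so these would determine all of
  \<open>B\<close>, against \<open>rank\<close>. The partner is \<open>p2\<close> if
  \<open>q = p1\<close>, and \<open>p1\<close> otherwise.\<close>

lemma closed_off_two_determined:
  assumes B: "finite B" and rank: "\<And>P. P \<subseteq> B \<Longrightarrow> card P \<le> card B - 2 \<Longrightarrow> \<exists>q\<in>B. \<not> determines Z P q"
    and p: "p1 \<in> B" "p2 \<in> B" "p1 \<noteq> p2" "determines Z (B - {p1}) p1" "determines Z (B - {p2}) p2"
    and P: "P \<subseteq> B - {p1, p2}" and q: "q \<in> B" "q \<notin> P"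
  shows "\<not> determines Z P q"
proof
  assume det: "determines Z P q"
  have pair: False if y: "y \<in> B" "y' \<in> B" "y \<noteq> y'" "determines Z (B - {y'}) y'" "determines Z (B - {y, y'}) y" for y y'
  proof -
    have d: "determines Z (B - {y, y'}) x" if "x \<in> B - {y'}" for x
      using that y by (cases "x = y") (auto intro: determines_mem)
    have "determines Z (B - {y, y'}) y'" using determines_trans[OF d y(4)] .
    then have "determines Z (B - {y, y'}) x" if "x \<in> B" for x
      using d that by (cases "x = y'") auto
    moreover have "card (B - {y, y'}) \<le> card B - 2" using B y by (simp add: card_Diff_subset)
    ultimately show False using rank[of "B - {y, y'}"] by blast
  qed
  show False
  proof (cases "q = p1")
    case True
    then show False using pair[of p1 p2] p determines_mono[OF det P] by auto
  next
    case False
    have "P \<subseteq> B - {q, p1}" using P q by auto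
    then show False using pair[of q p1] p False q determines_mono[OF det] by auto
  qed
qed

text \<open>All edges use the same positions \<open>B\<close>, with two degree-1 vertices of each
  edge at \<open>p1\<close> and \<open>p2\<close>. Such vertices lie in no other edge, so the
  positions of \<open>E \<inter> F\<close> avoid \<open>p1\<close> and \<open>p2\<close>, and
  \<open>nd\<close> gives the first alternative of \<open>fresh\<close>.\<close>

lemma embedding_private_positions:
  fixes Z :: "('i \<Rightarrow> 'w) set"
  assumes tree: "k_tree k H" and contr: "two_contractible H" and over: "overlapping l H"
    and R: "finite R" "B \<subseteq> R" "card B = k" and Z: "finite Z" "Z \<noteq> {}"
    and inj: "\<And>z. z \<in> Z \<Longrightarrow> inj_on z R"
    and homog: "\<And>P p. P \<subseteq> R \<Longrightarrow> p \<in> R \<Longrightarrow> determines Z P p \<or> light \<eta> Z P p"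
    and p: "p1 \<in> B" "p2 \<in> B" "p1 \<noteq> p2"
    and nd: "\<And>P q. P \<subseteq> B - {p1, p2} \<Longrightarrow> q \<in> B \<Longrightarrow> q \<notin> P \<Longrightarrow> \<not> determines Z P q"
    and big: "\<And>z P. z \<in> Z \<Longrightarrow> P \<subseteq> R \<Longrightarrow> card P \<le> l \<Longrightarrow> D \<le> real (card (fiber Z P z))"
    and D: "0 < D" and eta: "0 \<le> \<eta>" "\<eta> * real (card R) ^ 2 * real (card H) \<le> 1 / (2 * real (card H))"
  shows "\<exists>\<pi>. tuple_embedding H \<pi> R Z \<eta> D \<and> (\<forall>E\<in>H. \<pi> ` E = B)"
proof -
  obtain u1 u2 where u: "\<And>E. E \<in> H \<Longrightarrow> u1 E \<in> E \<and> u2 E \<in> E \<and> u1 E \<noteq> u2 E"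
    and uniq: "\<And>E F. E \<in> H \<Longrightarrow> F \<in> H \<Longrightarrow> u1 E \<in> F \<or> u2 E \<in> F \<Longrightarrow> E = F"
    using two_contractible_private_vertices[OF contr] by metis
  have HT: "hypertree H" and unif: "\<And>E. E \<in> H \<Longrightarrow> finite E \<and> card E = k"
    using tree by (auto simp: k_tree_def uniform_hypergraph_def)
  define U where "U = u1 ` H \<union> u2 ` H"
  have EU: "E \<inter> U = {u1 E, u2 E}" if "E \<in> H" for E
    using u[OF that] uniq that by (auto simp: U_def)
  have "finite E \<and> card (E - U) = k - 2" if "E \<in> H" for E
  proof -
    have "E - U = E - {u1 E, u2 E}" using EU[OF that] by auto
    then show ?thesis using unif[OF that] u[OF that] by (simp add: card_Diff_subset)
  qed
  from hypertree_colouring[OF HT this] obtain \<rho> where \<rho>: "\<And>E. E \<in> H \<Longrightarrow> bij_betw \<rho> (E - U) {..<k - 2}" by blast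
  have "card (B - {p1, p2}) = k - 2" using p R by (simp add: card_Diff_subset)
  moreover have finB: "finite B" using R finite_subset by auto
  ultimately obtain g where g: "bij_betw g {..<k - 2} (B - {p1, p2})"
    using ex_bij_betw_nat_finite[of "B - {p1, p2}"] by (auto simp: atLeast0LessThan)
  define \<pi> where "\<pi> v = (if v \<in> u1 ` H then p1 else if v \<in> u2 ` H then p2 else g (\<rho> v))" for v
  have \<pi>u: "\<pi> (u1 E) = p1" "\<pi> (u2 E) = p2" if E: "E \<in> H" for E
  proof -
    show "\<pi> (u1 E) = p1" using E by (simp add: \<pi>_def)
    have "u2 E \<notin> u1 ` H"
    proof
      assume "u2 E \<in> u1 ` H"
      then obtain E' where E': "E' \<in> H" "u2 E = u1 E'" by blast
      then have "u1 E' \<in> E" using u[OF E] by simp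
      then have "E' = E" using uniq[OF E'(1) E] by simp
      then show False using E' u[OF E] by simp
    qed
    then show "\<pi> (u2 E) = p2" using E by (simp add: \<pi>_def)
  qed
  have img: "\<pi> ` E = B" if E: "E \<in> H" for E
  proof -
    have "\<pi> ` (E - U) = g ` \<rho> ` (E - U)" unfolding image_image by (intro image_cong) (auto simp: \<pi>_def U_def)
    also have "\<dots> = B - {p1, p2}" using \<rho>[OF E] g by (simp add: bij_betw_def)
    finally have "\<pi> ` (E - U) = B - {p1, p2}" .
    moreover have "\<pi> ` (E \<inter> U) = {p1, p2}" unfolding EU[OF E] using \<pi>u[OF E] by simp
    moreover have "E = (E - U) \<union> (E \<inter> U)" by auto
    ultimately have "\<pi> ` E = (B - {p1, p2}) \<union> {p1, p2}" by (metis image_Un)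
    then show ?thesis using p by auto
  qed
  have inj\<pi>: "inj_on \<pi> E" if "E \<in> H" for E
    using unif[OF that] img[OF that] R(3) by (intro eq_card_imp_inj_on) auto
  have P: "\<pi> ` (E \<inter> F) \<subseteq> B - {p1, p2}" if "E \<in> H" "F \<in> H" "E \<noteq> F" for E F
  proof -
    have "u1 E \<notin> F" "u2 E \<notin> F" using uniq that by auto
    then have "\<pi> (u1 E) \<notin> \<pi> ` (E \<inter> F)" "\<pi> (u2 E) \<notin> \<pi> ` (E \<inter> F)"
      using inj_on_image_mem_iff[OF inj\<pi>[OF that(1)], of _ "E \<inter> F"] u[OF that(1)] by auto
    then have "p1 \<notin> \<pi> ` (E \<inter> F)" "p2 \<notin> \<pi> ` (E \<inter> F)" using \<pi>u[OF that(1)] by simp_all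
    then show ?thesis using img[OF that(1)] by auto
  qed
  have "tuple_embedding H \<pi> R Z \<eta> D"
  proof
    fix E F v assume a: "E \<in> H" "F \<in> H" "E \<noteq> F" "v \<in> E" "v \<notin> F"
    have "\<pi> v \<notin> \<pi> ` (E \<inter> F)" using inj_on_image_mem_iff[OF inj\<pi>[OF a(1)], of v "E \<inter> F"] a(4,5) by simp
    then show "\<not> determines Z (\<pi> ` (E \<inter> F)) (\<pi> v) \<or> (\<forall>u\<in>\<Union>H. \<pi> u = \<pi> v \<longrightarrow> u = v)"
      using nd[OF P[OF a(1-3)]] img[OF a(1)] a(4) by auto
  next
    fix E F z assume a: "E \<in> H" "F \<in> H" "E \<noteq> F" "z \<in> Z"
    have "card (\<pi> ` (E \<inter> F)) \<le> card (E \<inter> F)" using unif[OF a(1)] by (intro card_image_le) auto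
    also have "\<dots> \<le> l" using over a by (simp add: overlapping_def)
    finally show "D \<le> real (card (fiber Z (\<pi> ` (E \<inter> F)) z))" using P[OF a(1-3)] R a by (intro big) auto
  qed (use HT R Z img inj\<pi> inj homog D eta in auto)
  then show ?thesis using img by (intro exI[of _ \<pi>] conjI ballI)
qed

text \<open>Cross-cut vertices have their positions to themselves, the second alternative of
  \<open>fresh\<close>. The other vertices are coloured with the core positions below
  \<open>k - 1\<close>. For these \<open>nd\<close> suffices, because an edge meets the cross-cut
  once and so uses just one extra position \<open>k - 1 + j\<close>.\<close>

lemma embedding_cross_cut:
  fixes Z :: "(nat \<Rightarrow> 'w) set"
  assumes tree: "k_tree k H" and k: "1 \<le> k" and cut: "cross_cut H S" "card S = s" and over: "overlapping l H"
    and R: "R = {..<k - 1 + s}" and Z: "finite Z" "Z \<noteq> {}"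
    and inj: "\<And>z. z \<in> Z \<Longrightarrow> inj_on z R"
    and homog: "\<And>P p. P \<subseteq> R \<Longrightarrow> p \<in> R \<Longrightarrow> determines Z P p \<or> light \<eta> Z P p"
    and nd: "\<And>j q. j < s \<Longrightarrow> q < k - 1 \<Longrightarrow> \<not> determines Z (insert (k - 1 + j) ({..<k - 1} - {q})) q"
    and big: "\<And>z P. z \<in> Z \<Longrightarrow> P \<subseteq> R \<Longrightarrow> card P \<le> l \<Longrightarrow> D \<le> real (card (fiber Z P z))"
    and D: "0 < D" and eta: "0 \<le> \<eta>" "\<eta> * real (card R) ^ 2 * real (card H) \<le> 1 / (2 * real (card H))"
  shows "\<exists>\<pi>. tuple_embedding H \<pi> R Z \<eta> D \<and> (\<forall>E\<in>H. \<exists>j<s. \<pi> ` E = insert (k - 1 + j) {..<k - 1})"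
proof -
  have HT: "hypertree H" and unif: "\<And>E. E \<in> H \<Longrightarrow> finite E \<and> card E = k"
    using tree by (auto simp: k_tree_def uniform_hypergraph_def)
  have finS: "finite S"
    using cut(1) unif finite_hypertree[OF HT] by (auto simp: cross_cut_def intro: finite_subset[of S "\<Union>H"])
  have "finite E \<and> card (E - S) = k - 1" if "E \<in> H" for E
  proof -
    have "card (E - S) = card E - card (E \<inter> S)" using unif[OF that] by (intro card_Diff_subset_Int) auto
    then show ?thesis using unif[OF that] cut(1) that by (simp add: cross_cut_def Int_commute)
  qed
  from hypertree_colouring[OF HT this] obtain \<rho> where \<rho>: "\<And>E. E \<in> H \<Longrightarrow> bij_betw \<rho> (E - S) {..<k - 1}" by blast
  obtain e where e: "bij_betw e S {..<s}"
    using ex_bij_betw_finite_nat[OF finS] cut(2) by (auto simp: atLeast0LessThan)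
  define \<pi> where "\<pi> v = (if v \<in> S then k - 1 + e v else \<rho> v)" for v
  have out: "\<rho> v < k - 1" if "v \<in> \<Union>H" "v \<notin> S" for v
    using \<rho> that by (auto simp: bij_betw_def)
  have img: "\<exists>j<s. \<pi> ` E = insert (k - 1 + j) {..<k - 1} \<and> (\<forall>v\<in>E \<inter> S. \<pi> v = k - 1 + j)" if E: "E \<in> H" for E
  proof -
    have "card (E \<inter> S) = 1" using cut(1) E by (simp add: cross_cut_def Int_commute)
    then obtain x where x: "E \<inter> S = {x}" by (rule card_1_singletonE)
    have "\<pi> ` (E - S) = \<rho> ` (E - S)" by (intro image_cong) (auto simp: \<pi>_def)
    then have "\<pi> ` (E - S) = {..<k - 1}" using \<rho>[OF E] by (simp add: bij_betw_def)
    moreover have "\<pi> ` (E \<inter> S) = {k - 1 + e x}" unfolding x using x by (auto simp: \<pi>_def)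
    moreover have "E = (E - S) \<union> (E \<inter> S)" by auto
    ultimately have "\<pi> ` E = {..<k - 1} \<union> {k - 1 + e x}" by (metis image_Un)
    moreover have "e x < s" using e x by (auto simp: bij_betw_def)
    moreover have "\<forall>v\<in>E \<inter> S. \<pi> v = k - 1 + e x" unfolding x using x by (auto simp: \<pi>_def)
    ultimately show ?thesis by auto
  qed
  have inj\<pi>: "inj_on \<pi> E" if E: "E \<in> H" for E
  proof -
    obtain j where "\<pi> ` E = insert (k - 1 + j) {..<k - 1}" using img[OF E] by auto
    then have "card (\<pi> ` E) = k" using k by simp
    then show ?thesis using unif[OF E] by (intro eq_card_imp_inj_on) auto
  qed
  have imgR: "\<pi> ` E \<subseteq> R" if E: "E \<in> H" for E
  proof -
    obtain j where "j < s" "\<pi> ` E = insert (k - 1 + j) {..<k - 1}" using img[OF E] by auto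
    then show ?thesis by (auto simp: R subset_iff)
  qed
  have "tuple_embedding H \<pi> R Z \<eta> D"
  proof
    fix E F v assume a: "E \<in> H" "F \<in> H" "E \<noteq> F" "v \<in> E" "v \<notin> F"
    show "\<not> determines Z (\<pi> ` (E \<inter> F)) (\<pi> v) \<or> (\<forall>u\<in>\<Union>H. \<pi> u = \<pi> v \<longrightarrow> u = v)"
    proof (cases "v \<in> S")
      case True
      have "u = v" if u: "u \<in> \<Union>H" "\<pi> u = \<pi> v" for u
      proof -
        have "u \<in> S" using u(2) out[OF u(1)] True by (cases "u \<in> S") (auto simp: \<pi>_def)
        then have "e u = e v" using u(2) True by (simp add: \<pi>_def)
        then show ?thesis using e True \<open>u \<in> S\<close> by (auto simp: bij_betw_def dest: inj_onD)
      qed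
      then show ?thesis by auto
    next
      case False
      obtain j where j: "j < s" "\<pi> ` E = insert (k - 1 + j) {..<k - 1}" using img[OF a(1)] by auto
      have q: "\<pi> v < k - 1" using out[of v] a False by (auto simp: \<pi>_def)
      have "\<pi> v \<notin> \<pi> ` (E \<inter> F)" using inj_on_image_mem_iff[OF inj\<pi>[OF a(1)], of v "E \<inter> F"] a(4,5) by simp
      then have sub: "\<pi> ` (E \<inter> F) \<subseteq> insert (k - 1 + j) ({..<k - 1} - {\<pi> v})" using j(2) by blast
      show ?thesis using nd[OF j(1) q] determines_mono[OF _ sub] by auto
    qed
  next
    fix E F z assume a: "E \<in> H" "F \<in> H" "E \<noteq> F" "z \<in> Z"
    have "card (\<pi> ` (E \<inter> F)) \<le> card (E \<inter> F)" using unif[OF a(1)] by (intro card_image_le) auto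
    also have "\<dots> \<le> l" using over a by (simp add: overlapping_def)
    finally show "D \<le> real (card (fiber Z (\<pi> ` (E \<inter> F)) z))" using imgR[OF a(1)] a by (intro big) auto
  qed (use HT R Z imgR inj\<pi> inj homog D eta in auto)
  moreover have "\<exists>j<s. \<pi> ` E = insert (k - 1 + j) {..<k - 1}" if "E \<in> H" for E using img[OF that] by auto
  ultimately show ?thesis by (intro exI[of _ \<pi>] conjI ballI)
qed

section \<open>Spread measures on copies in dense hypergraphs\<close>

definition spread_copies :: "'v set set \<Rightarrow> 'w set set \<Rightarrow> real \<Rightarrow> real \<Rightarrow> bool" where
  "spread_copies H F c m \<longleftrightarrow> (\<exists>w. (\<forall>C. 0 \<le> w C) \<and> 1 / 2 \<le> (\<Sum>C\<in>copies H F. w C) \<and>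
    (\<forall>S\<subseteq>F. S \<noteq> {} \<longrightarrow> card S \<le> card H \<longrightarrow>
      (\<Sum>C\<in>{C \<in> copies H F. S \<subseteq> C}. w C) \<le> c / real (card F) * (1 / m) ^ (card S - 1)))"

text \<open>In the constant, one factor \<open>1 / \<delta>\<close> pays for comparing
  \<open>card Z\<close> with \<open>card F\<close>, and at most \<open>card H\<close> further ones
  pay for the fiber bound \<open>\<delta> * m\<close>. Raising all exponents to
  \<open>card H\<close> makes it independent of \<open>S\<close>.\<close>

lemma spread_copies_from_embedding:
  assumes emb: "tuple_embedding H \<pi> R Z \<eta> (\<delta> * m)" and F: "finite F" "F \<noteq> {}"
    and edge: "\<And>z E. z \<in> Z \<Longrightarrow> E \<in> H \<Longrightarrow> z ` \<pi> ` E \<in> F"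
    and mult: "\<And>E f. E \<in> H \<Longrightarrow> card {z \<in> Z. z ` \<pi> ` E = f} \<le> L"
    and L: "1 \<le> L" and \<delta>: "0 < \<delta>" "\<delta> \<le> 1" and m: "0 < m" and Z: "\<delta> * real (card F) \<le> real (card Z)"
  shows "spread_copies H F (real (card H * L) ^ card H / \<delta> ^ (card H + 1)) m"
proof -
  interpret tuple_embedding H \<pi> R Z \<eta> "\<delta> * m" by (rule emb)
  obtain w where w: "\<forall>C. 0 \<le> w C" "1 / 2 \<le> (\<Sum>C\<in>copies H F. w C)"
    and spr: "\<forall>S. finite S \<longrightarrow> S \<noteq> {} \<longrightarrow> (\<Sum>C\<in>{C \<in> copies H F. S \<subseteq> C}. w C)
      \<le> real (card H * L) ^ card S * (1 / real (card Z) * (1 / (\<delta> * m)) ^ (card S - 1))"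
  proof -
    have "\<exists>w. (\<forall>C. 0 \<le> w C) \<and> 1 / 2 \<le> (\<Sum>C\<in>copies H F. w C) \<and>
      (\<forall>S. finite S \<longrightarrow> S \<noteq> {} \<longrightarrow> (\<Sum>C\<in>{C \<in> copies H F. S \<subseteq> C}. w C)
      \<le> real (card H * L) ^ card S * (1 / real (card Z) * (1 / (\<delta> * m)) ^ (card S - 1)))"
      by (rule copies_spread[OF F(1) edge mult])
    then show ?thesis by (elim exE conjE) (rule that)
  qed
  let ?t = "card H"
  have t: "1 \<le> ?t" using finH hypertree_nonempty[OF tree] by (simp add: Suc_le_eq card_gt_0_iff)
  have Fpos: "0 < real (card F)" using F by (simp add: card_gt_0_iff)
  have "(\<Sum>C\<in>{C \<in> copies H F. S \<subseteq> C}. w C) \<le> real (?t * L) ^ ?t / \<delta> ^ (?t + 1) / real (card F) * (1 / m) ^ (card S - 1)"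
    if S: "S \<subseteq> F" "S \<noteq> {}" "card S \<le> ?t" for S
  proof -
    have "finite S" using S F finite_subset by blast
    then have "(\<Sum>C\<in>{C \<in> copies H F. S \<subseteq> C}. w C)
        \<le> real (?t * L) ^ card S * (1 / real (card Z) * (1 / (\<delta> * m)) ^ (card S - 1))" using S by (intro spr[rule_format])
    also have "\<dots> \<le> real (?t * L) ^ ?t * (1 / (\<delta> * real (card F)) * ((1 / \<delta>) ^ ?t * (1 / m) ^ (card S - 1)))"
    proof (intro mult_mono)
      have "1 * 1 \<le> ?t * L" using t L by (rule mult_le_mono)
      then have "real (1 * 1) \<le> real (?t * L)" by (rule of_nat_mono)
      then have "1 \<le> real (?t * L)" by simp
      then show "real (?t * L) ^ card S \<le> real (?t * L) ^ ?t" using S(3) by (intro power_increasing)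
      show "1 / real (card Z) \<le> 1 / (\<delta> * real (card F))" using Z \<delta> Fpos by (intro frac_le) auto
      have "(1 / (\<delta> * m)) ^ (card S - 1) = (1 / \<delta>) ^ (card S - 1) * (1 / m) ^ (card S - 1)"
        by (simp flip: power_mult_distrib)
      moreover have "(1 / \<delta>) ^ (card S - 1) \<le> (1 / \<delta>) ^ ?t" using \<delta> S(3) by (intro power_increasing) auto
      ultimately show "(1 / (\<delta> * m)) ^ (card S - 1) \<le> (1 / \<delta>) ^ ?t * (1 / m) ^ (card S - 1)"
        using m by (simp add: mult_right_mono)
    qed (use \<delta> m in auto)
    also have "\<dots> = real (?t * L) ^ ?t / \<delta> ^ (?t + 1) / real (card F) * (1 / m) ^ (card S - 1)"
      by (simp add: power_one_over field_simps)
    finally show ?thesis .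
  qed
  then show ?thesis unfolding spread_copies_def using w by (intro exI[of _ w]) auto
qed

text \<open>No \<open>k - 1\<close> positions determine the remaining one, so any two positions can
  host the private vertices; 0 and 1 are taken. Labels vanish from \<open>k\<close> on, so the first
  \<open>k\<close> entries fix a tuple, and a determined last entry would make a fiber from
  \<open>several\<close> a singleton.\<close>

lemma spread_copies_undetermined:
  fixes lab :: "nat set \<Rightarrow> nat \<Rightarrow> nat"
  assumes k: "2 \<le> k" and tree: "k_tree k H" and contr: "two_contractible H" and over: "overlapping l H"
    and F: "finite F" "F \<noteq> {}" and lab: "\<And>e. e \<in> F \<Longrightarrow> bij_betw (lab e) {..<k} e \<and> (\<forall>i\<ge>k. lab e i = 0)"
    and Z: "Z \<subseteq> lab ` F" "\<delta> * real (card F) \<le> real (card Z)"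
    and homog: "\<And>P p. P \<subseteq> {..<k} \<Longrightarrow> p \<in> {..<k} \<Longrightarrow> determines Z P p \<or> light \<eta> Z P p"
    and several: "\<And>z p. z \<in> Z \<Longrightarrow> p < k \<Longrightarrow> 1 < card (fiber Z ({..<k} - {p}) z)"
    and big: "\<And>z P. z \<in> Z \<Longrightarrow> P \<subseteq> {..<k} \<Longrightarrow> card P \<le> l \<Longrightarrow> \<delta> * m \<le> real (card (fiber Z P z))"
    and \<delta>: "0 < \<delta>" "\<delta> \<le> 1" and m: "0 < m"
    and eta: "0 \<le> \<eta>" "\<eta> * real k ^ 2 * real (card H) \<le> 1 / (2 * real (card H))"
  shows "spread_copies H F (real (card H * 2 ^ k) ^ card H / \<delta> ^ (card H + 1)) m"
proof -
  have finZ: "finite Z" using Z F finite_subset by blast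
  have Fpos: "0 < real (card F)" using F by (simp add: card_gt_0_iff)
  have "0 < \<delta> * real (card F)" using \<delta> Fpos by simp
  then have Zne: "Z \<noteq> {}" using Z(2) by auto
  have tuple: "bij_betw z {..<k} (z ` {..<k}) \<and> z ` {..<k} \<in> F \<and> z = lab (z ` {..<k}) \<and> (\<forall>i\<ge>k. z i = 0)" if z: "z \<in> Z" for z
  proof -
    obtain e where e: "e \<in> F" "z = lab e" using z Z by blast
    then show ?thesis using lab[OF e(1)] by (auto simp: bij_betw_def)
  qed
  have nd: "\<not> determines Z ({..<k} - {q}) q" if q: "q < k" for q
  proof
    assume det: "determines Z ({..<k} - {q}) q"
    obtain z where z: "z \<in> Z" using Zne by blast
    have "fiber Z ({..<k} - {q}) z \<subseteq> {z}"
    proof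
      fix z' assume z': "z' \<in> fiber Z ({..<k} - {q}) z"
      have "z' i = z i" for i
      proof (cases "i < k")
        case True
        then show ?thesis using z' det z by (cases "i = q") (auto simp: fiber_def determines_def)
      next
        case False
        then show ?thesis using tuple[OF z] tuple[of z'] z' by (auto simp: fiber_def)
      qed
      then show "z' \<in> {z}" by auto
    qed
    then have "card (fiber Z ({..<k} - {q}) z) \<le> 1" using card_mono[of "{z}"] by simp
    then show False using several[OF z q] by simp
  qed
  have "\<exists>\<pi>. tuple_embedding H \<pi> {..<k} Z \<eta> (\<delta> * m) \<and> (\<forall>E\<in>H. \<pi> ` E = {..<k})"
  proof (rule embedding_private_positions[OF tree contr over, where ?p1.0 = 0 and ?p2.0 = 1])
    fix P q assume a: "P \<subseteq> {..<k} - {0, 1}" "q \<in> {..<k}" "q \<notin> P"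
    then have "P \<subseteq> {..<k} - {q}" by auto
    from determines_mono[OF _ this, of Z q] show "\<not> determines Z P q" using nd[of q] a(2) by auto
  next
    fix z assume "z \<in> Z"
    then show "inj_on z {..<k}" using tuple by (auto simp: bij_betw_def)
  qed (use k finZ Zne homog big \<delta> m eta in auto)
  then obtain \<pi> where \<pi>: "tuple_embedding H \<pi> {..<k} Z \<eta> (\<delta> * m)" "\<And>E. E \<in> H \<Longrightarrow> \<pi> ` E = {..<k}" by blast
  show ?thesis
  proof (rule spread_copies_from_embedding[OF \<pi>(1) F _ _ _ \<delta> m Z(2)])
    fix E f assume E: "E \<in> H"
    have "{z \<in> Z. z ` \<pi> ` E = f} \<subseteq> {lab f}" using tuple \<pi>(2)[OF E] by auto
    then have "card {z \<in> Z. z ` \<pi> ` E = f} \<le> 1" using card_mono[of "{lab f}"] by simp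
    \<comment> \<open>The multiplicity is at most 1 here; the weaker bound \<open>2 ^ k\<close>
      gives the same constant as in the cross-cut case.\<close>
    then show "card {z \<in> Z. z ` \<pi> ` E = f} \<le> 2 ^ k" using one_le_power[of "2::nat" k] by linarith
  qed (use tuple \<pi>(2) in auto)
qed

text \<open>By \<open>core\<close> the core entries fix the whole tuple, so every extra position is
  determined by the core. If conversely a core position \<open>q\<close> is determined by the rest
  of the core and one extra position, that edge has two positions each determined by its other
  positions, and these host the private vertices. Otherwise the cross-cut placement works.\<close>

lemma spread_copies_cross_cut:
  fixes Z :: "(nat \<Rightarrow> 'w) set"
  assumes k: "2 \<le> k" and tree: "k_tree k H" and contr: "two_contractible H" and over: "overlapping l H"
    and cut: "cross_cut H S" "card S = s" and F: "finite F" "F \<noteq> {}" "uniform_hypergraph k F"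
    and finZ: "finite Z" and Z: "\<delta> * real (card F) \<le> real (card Z)"
    and inj: "\<And>z. z \<in> Z \<Longrightarrow> inj_on z {..<k - 1 + s}"
    and core: "\<And>z z'. z \<in> Z \<Longrightarrow> z' \<in> Z \<Longrightarrow> z ` {..<k - 1} = z' ` {..<k - 1} \<Longrightarrow> z = z'"
    and edge: "\<And>z j. z \<in> Z \<Longrightarrow> j < s \<Longrightarrow> z ` insert (k - 1 + j) {..<k - 1} \<in> F"
    and homog: "\<And>P p. P \<subseteq> {..<k - 1 + s} \<Longrightarrow> p \<in> {..<k - 1 + s} \<Longrightarrow> determines Z P p \<or> light \<eta> Z P p"
    and rank: "\<And>z P. z \<in> Z \<Longrightarrow> P \<subseteq> {..<k - 1 + s} \<Longrightarrow> card P \<le> k - 2 \<Longrightarrow> 1 < card (fiber Z P z)"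
    and big: "\<And>z P. z \<in> Z \<Longrightarrow> P \<subseteq> {..<k - 1 + s} \<Longrightarrow> card P \<le> l \<Longrightarrow> \<delta> * m \<le> real (card (fiber Z P z))"
    and \<delta>: "0 < \<delta>" "\<delta> \<le> 1" and m: "0 < m"
    and eta: "0 \<le> \<eta>" "\<eta> * real (k - 1 + s) ^ 2 * real (card H) \<le> 1 / (2 * real (card H))"
  shows "spread_copies H F (real (card H * 2 ^ k) ^ card H / \<delta> ^ (card H + 1)) m"
proof -
  let ?R = "{..<k - 1 + s}"
  let ?B = "\<lambda>j. insert (k - 1 + j) {..<k - 1}"
  have Fpos: "0 < real (card F)" using F by (simp add: card_gt_0_iff)
  have "0 < \<delta> * real (card F)" using \<delta> Fpos by simp
  then have Zne: "Z \<noteq> {}" using Z by auto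
  have agree: "z = z'" if "z \<in> Z" "z' \<in> Z" "\<And>i. i < k - 1 \<Longrightarrow> z i = z' i" for z z'
    using that by (intro core image_cong) auto
  have BR: "?B j \<subseteq> ?R" if "j < s" for j using that by auto
  have cB: "card (?B j) = k" for j using k by simp
  have exist: "\<exists>\<pi>. tuple_embedding H \<pi> ?R Z \<eta> (\<delta> * m) \<and> (\<forall>E\<in>H. \<exists>j<s. \<pi> ` E = ?B j)"
  proof (cases "\<forall>j<s. \<forall>q<k - 1. \<not> determines Z (insert (k - 1 + j) ({..<k - 1} - {q})) q")
    case True
    show ?thesis
      by (rule embedding_cross_cut[OF tree _ cut over refl finZ Zne inj homog _ big])
        (use True k \<delta> m eta in auto)
  next
    case False
    then obtain j q where j: "j < s" and q: "q < k - 1"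
      and det: "determines Z (insert (k - 1 + j) ({..<k - 1} - {q})) q" by blast
    have "insert (k - 1 + j) ({..<k - 1} - {q}) = ?B j - {q}" using q by auto
    then have detq: "determines Z (?B j - {q}) q" using det by simp
    have eqB: "?B j - {k - 1 + j} = {..<k - 1}" by auto
    have "determines Z {..<k - 1} p" for p
      unfolding determines_def
    proof (intro ballI)
      fix z z' assume z: "z \<in> Z" "z' \<in> fiber Z {..<k - 1} z"
      then have "z' = z" by (intro agree) (auto simp: fiber_def)
      then show "z' p = z p" by simp
    qed
    then have dety: "determines Z (?B j - {k - 1 + j}) (k - 1 + j)" unfolding eqB .
    \<comment> \<open>So few positions cannot determine the core: they would fix the tuple, whereas
      by \<open>rank\<close> their fibers have more than one element.\<close>
    have rankB: "\<exists>q\<in>?B j. \<not> determines Z P q" if P: "P \<subseteq> ?B j" "card P \<le> card (?B j) - 2" for P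
    proof (rule ccontr)
      assume "\<not> ?thesis"
      then have all: "determines Z P q" if "q < k - 1" for q using that by auto
      obtain z where z: "z \<in> Z" using Zne by blast
      have "fiber Z P z \<subseteq> {z}"
      proof
        fix z' assume z': "z' \<in> fiber Z P z"
        then have "z' = z" using all z by (intro agree) (auto simp: fiber_def determines_def)
        then show "z' \<in> {z}" by simp
      qed
      then have "card (fiber Z P z) \<le> 1" using card_mono[of "{z}"] by simp
      moreover have "P \<subseteq> ?R" using P(1) BR[OF j] by (rule subset_trans)
      ultimately show False using rank[OF z, of P] P(2) by (simp only: cB) simp
    qed
    have "\<exists>\<pi>. tuple_embedding H \<pi> ?R Z \<eta> (\<delta> * m) \<and> (\<forall>E\<in>H. \<pi> ` E = ?B j)"
    proof (rule embedding_private_positions[OF tree contr over _ BR[OF j] cB finZ Zne inj homog,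
          where ?p1.0 = "k - 1 + j" and ?p2.0 = q])
      fix P p assume a: "P \<subseteq> ?B j - {k - 1 + j, q}" "p \<in> ?B j" "p \<notin> P"
      show "\<not> determines Z P p"
        by (rule closed_off_two_determined[OF _ rankB _ _ _ dety detq a]) (use q in auto)
    qed (use q big \<delta> m eta in auto)
    then show ?thesis using j by blast
  qed
  then obtain \<pi> where \<pi>: "tuple_embedding H \<pi> ?R Z \<eta> (\<delta> * m)" "\<And>E. E \<in> H \<Longrightarrow> \<exists>j<s. \<pi> ` E = ?B j" by blast
  show ?thesis
  proof (rule spread_copies_from_embedding[OF \<pi>(1) F(1,2) _ _ _ \<delta> m Z])
    fix z E assume "z \<in> Z" "E \<in> H"
    then show "z ` \<pi> ` E \<in> F" using \<pi>(2)[of E] edge by auto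
  next
    fix E f assume E: "E \<in> H"
    obtain j where j: "j < s" "\<pi> ` E = ?B j" using \<pi>(2)[OF E] by blast
    show "card {z \<in> Z. z ` \<pi> ` E = f} \<le> 2 ^ k"
    proof (cases "{z \<in> Z. z ` \<pi> ` E = f} = {}")
      case True
      show ?thesis unfolding True by simp
    next
      case False
      then obtain z0 where "z0 \<in> Z" "z0 ` ?B j = f" using j by auto
      then have "f \<in> F" using edge j by blast
      then have f: "finite f" "card f = k" using F(3) by (auto simp: uniform_hypergraph_def)
      \<comment> \<open>A tuple mapped onto \<open>f\<close> is identified by its core, which is a
        subset of \<open>f\<close>.\<close>
      have "card {z \<in> Z. z ` \<pi> ` E = f} \<le> card (Pow f)"
      proof (rule card_inj_on_le[of "\<lambda>z. z ` {..<k - 1}"])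
        show "inj_on (\<lambda>z. z ` {..<k - 1}) {z \<in> Z. z ` \<pi> ` E = f}"
          by (intro inj_onI core) auto
        show "(\<lambda>z. z ` {..<k - 1}) ` {z \<in> Z. z ` \<pi> ` E = f} \<subseteq> Pow f" unfolding j(2) by auto
      qed (use f in simp)
      then show ?thesis using f by (simp add: card_Pow)
    qed
  qed simp
qed

section \<open>Cores of bounded degree with many extensions\<close>

lemma popular_cores:
  fixes lab :: "nat set \<Rightarrow> nat \<Rightarrow> nat" and M :: real
  assumes k: "1 \<le> k" and s: "1 \<le> s" and M: "0 \<le> M" and F: "\<Union>F \<subseteq> {1..n}" "finite F"
    and lab: "\<And>e. e \<in> F \<Longrightarrow> bij_betw (lab e) {..<k} e" and G: "G \<subseteq> F"
    and p: "\<And>e. e \<in> G \<Longrightarrow> p e < k \<and> real (card (fiber (lab ` F) ({..<k} - {p e}) (lab e))) \<le> M"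
  defines "M' \<equiv> real k * real k ^ k * M"
  shows "\<exists>\<D>\<subseteq>{X. X \<subseteq> {1..n} \<and> card X = k - 1}.
    real (card G) \<le> (real s - 1) * real (n choose (k - 1)) + M' * real (card \<D>) \<and>
    real (card G) \<le> M' * real (n choose (k - 1)) \<and>
    (\<forall>X\<in>\<D>. \<exists>y. inj_on y {..<s} \<and> (\<forall>j<s. y j \<notin> X \<and> insert (y j) X \<in> F))"
proof -
  \<comment> \<open>The vertex at the position with a small fiber is removed, so the remaining
    vertices have few extensions in which they keep their labels.\<close>
  define core where "core e = e - {lab e (p e)}" for e
  define N where "N X = {e \<in> G. core e = X}" for X
  define \<X> where "\<X> = {X. X \<subseteq> {1..n} \<and> card X = k - 1}"
  define \<D> where "\<D> = {X \<in> \<X>. s \<le> card (N X)}"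
  have finG: "finite G" using G F finite_subset by blast
  have fin\<X>: "finite \<X>" by (simp add: \<X>_def)
  have card\<X>: "card \<X> = n choose (k - 1)" unfolding \<X>_def by (simp add: n_subsets)
  have injlab: "inj_on lab F"
  proof (rule inj_onI)
    fix e e' assume "e \<in> F" "e' \<in> F" "lab e = lab e'"
    then show "e = e'" using lab[of e] lab[of e'] by (auto simp: bij_betw_def)
  qed
  have labG: "bij_betw (lab e) {..<k} e" "p e < k" if "e \<in> G" for e
    using that G lab p by blast+
  have top: "lab e (p e) \<in> e" "core e \<in> \<X>" if e: "e \<in> G" for e
  proof -
    show m: "lab e (p e) \<in> e" using labG[OF e] by (auto simp: bij_betw_def)
    have "card e = k" "finite e" using bij_betw_same_card[OF labG(1)[OF e]] bij_betw_finite[OF labG(1)[OF e]] by auto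
    moreover have "e \<subseteq> {1..n}" using e G F by blast
    ultimately show "core e \<in> \<X>" using m by (auto simp: core_def \<X>_def)
  qed
  \<comment> \<open>An edge over \<open>X\<close> picks the removed position and an arrangement of
    \<open>X\<close> on the others, at most \<open>k * k ^ k\<close> possibilities, each shared by
    at most \<open>M\<close> edges. This is the origin of \<open>M'\<close>.\<close>
  have mult: "real (card (N X)) \<le> M'" if X: "X \<in> \<X>" for X
  proof -
    define J where "J = (SIGMA i:{..<k}. PiE ({..<k} - {i}) (\<lambda>_. X))"
    define f where "f e = (p e, restrict (lab e) ({..<k} - {p e}))" for e
    have finX: "finite X" "card X = k - 1" using X by (auto simp: \<X>_def intro: finite_subset)
    have finJ: "finite J" unfolding J_def using finX by (intro finite_SigmaI finite_PiE) auto
    have finN: "finite (N X)" using finG by (simp add: N_def)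
    have fJ: "f ` N X \<subseteq> J"
    proof (rule image_subsetI)
      fix e assume e: "e \<in> N X"
      then have eG: "e \<in> G" "core e = X" by (auto simp: N_def)
      have "lab e i \<in> X" if "i \<in> {..<k} - {p e}" for i
      proof -
        have "lab e i \<in> e" "lab e i \<noteq> lab e (p e)"
          using labG[OF eG(1)] that by (auto simp: bij_betw_def dest: inj_onD)
        then show ?thesis unfolding eG(2)[symmetric] by (simp add: core_def)
      qed
      then show "f e \<in> J" using labG(2)[OF eG(1)] by (auto simp: f_def J_def restrict_PiE_iff)
    qed
    have each: "real (card {e \<in> N X. f e = j}) \<le> M" for j
    proof (cases "{e \<in> N X. f e = j} = {}")
      case True
      show ?thesis unfolding True using M by simp
    next
      case False
      then obtain e0 where e0: "e0 \<in> N X" "f e0 = j" by blast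
      then have e0G: "e0 \<in> G" by (simp add: N_def)
      have "card {e \<in> N X. f e = j} \<le> card (fiber (lab ` F) ({..<k} - {p e0}) (lab e0))"
      proof (rule card_inj_on_le[of lab])
        show "inj_on lab {e \<in> N X. f e = j}" by (rule inj_on_subset[OF injlab]) (use G in \<open>auto simp: N_def\<close>)
        show "lab ` {e \<in> N X. f e = j} \<subseteq> fiber (lab ` F) ({..<k} - {p e0}) (lab e0)"
        proof (rule image_subsetI)
          fix e assume "e \<in> {e \<in> N X. f e = j}"
          then have e: "e \<in> G" "f e = f e0" using e0 by (auto simp: N_def)
          then have "p e = p e0" "restrict (lab e) ({..<k} - {p e0}) = restrict (lab e0) ({..<k} - {p e0})"
            by (auto simp: f_def)
          then show "lab e \<in> fiber (lab ` F) ({..<k} - {p e0}) (lab e0)"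
            using e G unfolding fiber_conv_restrict by blast
        qed
        show "finite (fiber (lab ` F) ({..<k} - {p e0}) (lab e0))" using F by (intro finite_fiber) simp
      qed
      then show ?thesis using p[OF e0G] by linarith
    qed
    have "card J = (\<Sum>i<k. (k - 1) ^ (k - 1))"
      unfolding J_def using finX by (subst card_SigmaI) (auto intro!: finite_PiE sum.cong simp: card_PiE)
    also have "\<dots> \<le> k * k ^ k"
    proof -
      have "(k - 1) ^ (k - 1) \<le> k ^ (k - 1)" by (rule power_mono) auto
      also have "\<dots> \<le> k ^ k" using k by (intro power_increasing) auto
      finally show ?thesis by simp
    qed
    finally have cJ: "real (card J) \<le> real k * real k ^ k" by (simp flip: of_nat_power of_nat_mult)
    have "real (card (N X)) = (\<Sum>j\<in>J. real (card {e \<in> N X. f e = j}))"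
      using sum.group[OF finN finJ fJ, of "\<lambda>_. 1::real"] by simp
    also have "\<dots> \<le> (\<Sum>j\<in>J. M)" by (intro sum_mono each)
    also have "\<dots> = real (card J) * M" by simp
    also have "\<dots> \<le> M'" unfolding M'_def using cJ M by (intro mult_right_mono)
    finally show ?thesis .
  qed
  have "core ` G \<subseteq> \<X>" using top by auto
  from sum.group[OF finG fin\<X> this, of "\<lambda>_. 1::real"]
  have total: "real (card G) = (\<Sum>X\<in>\<X>. real (card (N X)))" by (simp add: N_def)
  have M'0: "0 \<le> M'" using M by (simp add: M'_def)
  \<comment> \<open>Cores outside \<open>\<D>\<close> carry at most \<open>s - 1\<close> edges each,
    so an excess over \<open>(s - 1) * (n choose (k - 1))\<close> must come from cores in
    \<open>\<D>\<close>, each contributing at most \<open>M'\<close>.\<close>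
  have "real (card G) \<le> (\<Sum>X\<in>\<X>. (real s - 1) + (if X \<in> \<D> then M' else 0))"
    unfolding total
  proof (intro sum_mono)
    fix X assume X: "X \<in> \<X>"
    show "real (card (N X)) \<le> (real s - 1) + (if X \<in> \<D> then M' else 0)"
    proof (cases "X \<in> \<D>")
      case True
      then show ?thesis using mult[OF X] s by simp
    next
      case False
      then have "card (N X) + 1 \<le> s" using X by (simp add: \<D>_def)
      then have "real (card (N X) + 1) \<le> real s" by (rule of_nat_mono)
      then show ?thesis using False by simp
    qed
  qed
  also have "\<dots> = (real s - 1) * real (card \<X>) + M' * real (card {X \<in> \<X>. X \<in> \<D>})"
    using fin\<X> by (simp add: sum.distrib sum.inter_filter[symmetric] mult.commute)
  also have "{X \<in> \<X>. X \<in> \<D>} = \<D>" by (auto simp: \<D>_def)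
  finally have c1: "real (card G) \<le> (real s - 1) * real (n choose (k - 1)) + M' * real (card \<D>)"
    unfolding card\<X> .
  have "real (card G) \<le> (\<Sum>X\<in>\<X>. M')" unfolding total by (intro sum_mono mult)
  then have c2: "real (card G) \<le> M' * real (n choose (k - 1))" by (simp add: card\<X> mult.commute)
  have c3: "\<exists>y. inj_on y {..<s} \<and> (\<forall>j<s. y j \<notin> X \<and> insert (y j) X \<in> F)" if X: "X \<in> \<D>" for X
  proof -
    have "s \<le> card (N X)" using X by (simp add: \<D>_def)
    then obtain A where A: "A \<subseteq> N X" "card A = s" "finite A" by (rule obtain_subset_with_card_n)
    obtain h where h: "bij_betw h {..<s} A"
      using ex_bij_betw_nat_finite[OF A(3)] A(2) by (auto simp: atLeast0LessThan)
    define y where "y j = lab (h j) (p (h j))" for j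
    have hj: "h j \<in> G" "core (h j) = X" if "j < s" for j
      using h A(1) that by (auto simp: bij_betw_def N_def)
    have new: "y j \<notin> X" "insert (y j) X = h j" if "j < s" for j
      using hj[OF that] top(1)[OF hj(1)[OF that]] by (auto simp: y_def core_def)
    have "inj_on y {..<s}"
    proof (rule inj_onI)
      fix i j assume ij: "i \<in> {..<s}" "j \<in> {..<s}" "y i = y j"
      then have "h i = h j" using new(2)[of i] new(2)[of j] by simp
      then show "i = j" using h ij by (auto simp: bij_betw_def dest: inj_onD)
    qed
    then show ?thesis using new hj(1) G by (intro exI[of _ y]) auto
  qed
  show ?thesis using c1 c2 c3 by (intro exI[of _ \<D>]) (auto simp: \<D>_def \<X>_def)
qed

lemma power_ratio_cancel:
  fixes n :: real
  assumes "d * (a * n ^ K) \<le> x * n ^ p" "p \<le> q" "q \<le> K" "1 \<le> n" "0 \<le> x"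
  shows "d * (a * n ^ (K - q)) \<le> x"
proof -
  have "n ^ K = n ^ (K - q) * n ^ q" using assms by (simp flip: power_add)
  moreover have "x * n ^ p \<le> x * n ^ q" using assms by (intro mult_left_mono power_increasing)
  ultimately have "d * (a * n ^ (K - q)) * n ^ q \<le> x * n ^ q" using assms(1) by (simp add: mult_ac)
  then show ?thesis using assms(4) by simp
qed

lemma cross_cut_number_attained:
  assumes tree: "k_tree k H" and contr: "two_contractible H"
  shows "\<exists>S. cross_cut H S \<and> card S = cross_cut_number H" and "1 \<le> cross_cut_number H"
proof -
  obtain u1 u2 where u: "\<And>E. E \<in> H \<Longrightarrow> u1 E \<in> E \<and> u2 E \<in> E \<and> u1 E \<noteq> u2 E"
    and uniq: "\<And>E F. E \<in> H \<Longrightarrow> F \<in> H \<Longrightarrow> u1 E \<in> F \<or> u2 E \<in> F \<Longrightarrow> E = F"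
    using two_contractible_private_vertices[OF contr] by metis
  have "u1 ` H \<inter> E = {u1 E}" if "E \<in> H" for E using u[OF that] uniq[OF _ that] that by auto
  then have "cross_cut H (u1 ` H)" using u by (auto simp: cross_cut_def)
  then have "\<exists>s S. cross_cut H S \<and> card S = s" by blast
  then show ex: "\<exists>S. cross_cut H S \<and> card S = cross_cut_number H"
    unfolding cross_cut_number_def by (rule LeastI_ex)
  then obtain S where S: "cross_cut H S" "card S = cross_cut_number H" by blast
  have HT: "hypertree H" and "\<And>E. E \<in> H \<Longrightarrow> finite E"
    using tree by (auto simp: k_tree_def uniform_hypergraph_def)
  then have "finite S"
    using S(1) finite_hypertree[OF HT] by (auto simp: cross_cut_def intro: finite_subset[of S "\<Union>H"])
  moreover obtain E where "E \<in> H" using hypertree_nonempty[OF HT] by blast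
  then have "card (S \<inter> E) = 1" using S(1) by (simp add: cross_cut_def)
  then have "S \<noteq> {}" by auto
  ultimately show "1 \<le> cross_cut_number H" using S(2) by (metis One_nat_def Suc_leI card_gt_0_iff)
qed

text \<open>The constants are chosen in a chain: \<open>\<theta>\<close> from
  \<open>\<epsilon>\<close> and \<open>s\<close>, then \<open>\<delta>1\<close>, then the degree
  bound \<open>M\<close>, and from it \<open>\<gamma>\<close>. None of them depends on
  \<open>n\<close>, \<open>a\<close> or \<open>F\<close>.\<close>

lemma dense_spread_copies:
  fixes \<epsilon> :: real
  assumes k: "2 \<le> k" and \<epsilon>: "0 < \<epsilon>" and tree: "k_tree k H" and contr: "two_contractible H"
    and over: "overlapping l H" and l: "l \<le> k - 2"
  shows "\<exists>c>0. \<forall>\<^sub>F n in sequentially. \<forall>(F :: nat set set) (a :: real).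
    uniform_hypergraph k F \<longrightarrow> \<Union>F \<subseteq> {1..n} \<longrightarrow>
    real (card F) = a * real (n choose (k - 1)) \<longrightarrow>
    a \<ge> real (cross_cut_number H) - 1 + \<epsilon> \<longrightarrow>
    spread_copies H F c (a * real n ^ (k - 1 - l))"
proof -
  define t where "t = card H"
  define s where "s = cross_cut_number H"
  obtain S where S: "cross_cut H S" "card S = s"
    using cross_cut_number_attained(1)[OF tree contr] by (auto simp: s_def)
  have s: "1 \<le> s" using cross_cut_number_attained(2)[OF tree contr] by (simp add: s_def)
  have HT: "hypertree H" using tree by (simp add: k_tree_def)
  have t: "1 \<le> t" using finite_hypertree[OF HT] hypertree_nonempty[OF HT]
    by (simp add: t_def Suc_le_eq card_gt_0_iff)
  define eta where "eta r = 1 / (2 * real t ^ 2 * real r ^ 2)" for r :: nat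
  have eta: "0 < eta r" "eta r \<le> 1" "eta r * real r ^ 2 * real t \<le> 1 / (2 * real t)" if r: "1 \<le> r" for r
  proof -
    have "1 * 1 * 1 \<le> 2 * real t ^ 2 * real r ^ 2"
      using t r by (intro mult_mono one_le_power) auto
    then show "0 < eta r" "eta r \<le> 1" using t r by (auto simp: eta_def)
    show "eta r * real r ^ 2 * real t \<le> 1 / (2 * real t)" using t r by (simp add: eta_def power2_eq_square)
  qed
  define \<theta> where "\<theta> = \<epsilon> / (2 * (real s + \<epsilon>))"
  have \<theta>: "0 < \<theta>" "\<theta> \<le> 1 / 2" using \<epsilon> s by (auto simp: \<theta>_def field_simps)
  let ?R1 = "{..<k}" and ?R2 = "{..<k - 1 + s}"
  have r1: "1 \<le> k" and r2: "1 \<le> k - 1 + s" using k s by auto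
  obtain \<delta>1 where \<delta>1: "0 < \<delta>1" "\<delta>1 \<le> 1" and hom1: "\<And>(A :: (nat \<Rightarrow> nat) set) Z0 V. finite A \<Longrightarrow> Z0 \<subseteq> A \<Longrightarrow> \<theta> * real (card A) \<le> real (card Z0) \<Longrightarrow>
    finite V \<Longrightarrow> V \<noteq> {} \<Longrightarrow> (\<forall>z\<in>A. z ` ?R1 \<subseteq> V) \<Longrightarrow>
    (\<exists>Z\<subseteq>Z0. \<delta>1 * real (card A) \<le> real (card Z) \<and>
      (\<forall>z\<in>Z. \<forall>P\<subseteq>?R1. \<delta>1 * real (card (fiber A P z)) \<le> real (card (fiber Z P z)) \<and>
        \<delta>1 * real (card A) \<le> real (card (fiber Z P z)) * real (card V) ^ card P) \<and>
      (\<forall>P\<subseteq>?R1. \<forall>p\<in>?R1. determines Z P p \<or> light (eta k) Z P p))"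
    using homogeneous_subfamily[where ?'w = nat, of ?R1 "eta k" \<theta>] eta(1,2)[OF r1] \<theta>
    by (elim impE meta_impE) auto
  obtain \<delta>2 where \<delta>2: "0 < \<delta>2" "\<delta>2 \<le> 1" and hom2: "\<And>(A :: (nat \<Rightarrow> nat) set) Z0 V. finite A \<Longrightarrow> Z0 \<subseteq> A \<Longrightarrow> 1 * real (card A) \<le> real (card Z0) \<Longrightarrow>
    finite V \<Longrightarrow> V \<noteq> {} \<Longrightarrow> (\<forall>z\<in>A. z ` ?R2 \<subseteq> V) \<Longrightarrow>
    (\<exists>Z\<subseteq>Z0. \<delta>2 * real (card A) \<le> real (card Z) \<and>
      (\<forall>z\<in>Z. \<forall>P\<subseteq>?R2. \<delta>2 * real (card (fiber A P z)) \<le> real (card (fiber Z P z)) \<and>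
        \<delta>2 * real (card A) \<le> real (card (fiber Z P z)) * real (card V) ^ card P) \<and>
      (\<forall>P\<subseteq>?R2. \<forall>p\<in>?R2. determines Z P p \<or> light (eta (k - 1 + s)) Z P p))"
    using homogeneous_subfamily[where ?'w = nat, of ?R2 "eta (k - 1 + s)" 1] eta(1,2)[OF r2]
    by (elim impE meta_impE) auto
  \<comment> \<open>A fiber with more than \<open>M\<close> elements keeps more than
    \<open>\<delta>1 * M = 1\<close> of them after homogenising.\<close>
  define M where "M = 1 / \<delta>1"
  define M' where "M' = real k * real k ^ k * M"
  have M: "0 < M" using \<delta>1 by (simp add: M_def)
  have M': "0 < M'" using M k by (simp add: M'_def)
  \<comment> \<open>With \<open>N = n choose (k - 1)\<close>, the light case gives
    \<open>card F \<le> 2 * M' * N\<close> and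
    \<open>\<epsilon> / 2 * N \<le> M' * card \<D>\<close>; eliminating \<open>N\<close> yields the
    quotient. The minimum with 1 keeps \<open>\<delta>\<close> at most 1.\<close>
  define \<gamma> where "\<gamma> = min 1 (\<epsilon> / (4 * M' ^ 2))"
  have \<gamma>: "0 < \<gamma>" "\<gamma> \<le> 1" using \<epsilon> M' by (auto simp: \<gamma>_def)
  define \<beta> where "\<beta> = 1 / real (k - 1) ^ (k - 1)"
  have \<beta>: "0 < \<beta>" "\<beta> \<le> 1" using k by (auto simp: \<beta>_def intro!: one_le_power)
  define \<delta> where "\<delta> = \<beta> * min \<delta>1 (\<delta>2 * \<gamma>)"
  have mins: "0 < min \<delta>1 (\<delta>2 * \<gamma>)" "min \<delta>1 (\<delta>2 * \<gamma>) \<le> 1" using \<delta>1 \<delta>2 \<gamma> by auto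
  have \<delta>: "0 < \<delta>" "\<delta> \<le> 1" unfolding \<delta>_def using \<beta> mins by (auto intro: mult_le_one)
  define c where "c = real (card H * 2 ^ k) ^ card H / \<delta> ^ (card H + 1)"
  have c: "0 < c" using t \<delta> by (simp add: c_def t_def)
  have main: "spread_copies H F c (a * real n ^ (k - 1 - l))"
    if n: "k \<le> n" "1 / (\<delta> * \<epsilon>) < real n" and F: "uniform_hypergraph k F" "\<Union>F \<subseteq> {1..n}"
      and cardF: "real (card F) = a * real (n choose (k - 1))" and a: "real s - 1 + \<epsilon> \<le> a"
    for n a and F :: "nat set set"
  proof -
    let ?m = "a * real n ^ (k - 1 - l)"
    have n1: "1 \<le> real n" using n k by simp
    have a\<epsilon>: "\<epsilon> \<le> a" using a s by simp
    have a0: "0 < a" using a\<epsilon> \<epsilon> by simp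
    have m: "0 < ?m" using a0 n1 by simp
    have choose0: "0 < real (n choose (k - 1))" using n by simp
    have finF: "finite F"
      by (rule finite_subset[of _ "Pow {1..n}"]) (use F in auto)
    have F0: "0 < real (card F)" using cardF a0 choose0 by simp
    then have Fne: "F \<noteq> {}" by auto
    have cF: "\<beta> * (a * real n ^ (k - 1)) \<le> real (card F)"
    proof -
      have "(real n / real (k - 1)) ^ (k - 1) \<le> real (n choose (k - 1))"
        using n by (intro binomial_ge_n_over_k_pow_k) simp
      then have "a * (real n / real (k - 1)) ^ (k - 1) \<le> a * real (n choose (k - 1))"
        using a0 by (intro mult_left_mono) auto
      then show ?thesis by (simp add: cardF \<beta>_def power_divide)
    qed
    have scaled: "\<delta> * (a * real n ^ (k - 1 - q)) \<le> x"
      if x: "d * real (card F) \<le> x * real n ^ p" "min \<delta>1 (\<delta>2 * \<gamma>) \<le> d" "p \<le> q" "q \<le> k - 1" "0 \<le> x" for d x p q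
    proof (rule power_ratio_cancel[OF _ x(3,4) n1 x(5)])
      have "\<delta> * (a * real n ^ (k - 1)) = min \<delta>1 (\<delta>2 * \<gamma>) * (\<beta> * (a * real n ^ (k - 1)))" by (simp add: \<delta>_def)
      also have "\<dots> \<le> d * real (card F)" using cF x(2) mins a0 \<beta> by (intro mult_mono) auto
      also have "\<dots> \<le> x * real n ^ p" by (rule x(1))
      finally show "\<delta> * (a * real n ^ (k - 1)) \<le> x * real n ^ p" .
    qed
    have \<delta>le: "\<delta> \<le> min \<delta>1 (\<delta>2 * \<gamma>)"
      unfolding \<delta>_def using \<beta> mins mult_right_mono[of \<beta> 1 "min \<delta>1 (\<delta>2 * \<gamma>)"] by simp
    have "\<forall>e\<in>F. \<exists>z :: nat \<Rightarrow> nat. bij_betw z ?R1 e \<and> (\<forall>i\<ge>k. z i = 0)"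
    proof
      fix e assume "e \<in> F"
      then have e: "finite e" "card e = k" using F(1) by (auto simp: uniform_hypergraph_def)
      obtain z where z: "bij_betw z ?R1 e"
        using ex_bij_betw_nat_finite[OF e(1)] e(2) by (auto simp: atLeast0LessThan)
      have "bij_betw (\<lambda>i. if i < k then z i else 0) ?R1 e"
        using z by (rule bij_betw_cong[THEN iffD1, rotated]) auto
      then show "\<exists>z :: nat \<Rightarrow> nat. bij_betw z ?R1 e \<and> (\<forall>i\<ge>k. z i = 0)"
        by (intro exI[of _ "\<lambda>i. if i < k then z i else 0"]) auto
    qed
    from bchoice[OF this] obtain lab :: "nat set \<Rightarrow> nat \<Rightarrow> nat"
      where "\<forall>e\<in>F. bij_betw (lab e) ?R1 e \<and> (\<forall>i\<ge>k. lab e i = 0)" by (rule exE)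
    then have lab: "bij_betw (lab e) ?R1 e \<and> (\<forall>i\<ge>k. lab e i = 0)" if "e \<in> F" for e using that by (rule bspec)
    have injlab: "inj_on lab F"
    proof (rule inj_onI)
      fix e e' assume "e \<in> F" "e' \<in> F" "lab e = lab e'"
      then show "e = e'" using lab[of e] lab[of e'] by (auto simp: bij_betw_def)
    qed
    define A where "A = lab ` F"
    have A: "finite A" "card A = card F" using finF injlab by (auto simp: A_def card_image)
    have AV: "\<forall>z\<in>A. z ` ?R1 \<subseteq> {1..n}" using lab F(2) by (auto simp: A_def bij_betw_def)
    \<comment> \<open>Fibers of labels stand in for degrees: only edges that put the same vertices
      at the same positions are counted. The factor \<open>k * k ^ k\<close> in \<open>M'\<close>
      makes up for the difference.\<close>
    define Fh where "Fh = {e \<in> F. \<forall>p<k. M < real (card (fiber A (?R1 - {p}) (lab e)))}"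
    have Fh: "Fh \<subseteq> F" "finite Fh" using finF by (auto simp: Fh_def)
    have V: "finite {1..n}" "{1..n} \<noteq> {}" using n k by auto
    show ?thesis
    proof (cases "\<theta> * real (card F) \<le> real (card Fh)")
      case True
      have "card (lab ` Fh) = card Fh" by (rule card_image[OF inj_on_subset[OF injlab Fh(1)]])
      then have "\<theta> * real (card A) \<le> real (card (lab ` Fh))" using True A by simp
      moreover have "lab ` Fh \<subseteq> A" using Fh by (auto simp: A_def)
      \<comment> \<open>The subfamily is chosen among labels of \<open>Fh\<close>, while its fibers
        are compared with those of \<open>A\<close>, the labels of all of \<open>F\<close>. This is
        why homogenising takes two families: \<open>M\<close> bounds fibers of
        \<open>A\<close>.\<close>
      ultimately obtain Z where Z: "Z \<subseteq> lab ` Fh" "\<delta>1 * real (card A) \<le> real (card Z)"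
        and fib: "\<forall>z\<in>Z. \<forall>P\<subseteq>?R1. \<delta>1 * real (card (fiber A P z)) \<le> real (card (fiber Z P z)) \<and>
          \<delta>1 * real (card A) \<le> real (card (fiber Z P z)) * real (card {1..n}) ^ card P"
        and hom: "\<forall>P\<subseteq>?R1. \<forall>p\<in>?R1. determines Z P p \<or> light (eta k) Z P p"
        using hom1[OF A(1) _ _ V AV, of "lab ` Fh"] by (elim exE conjE meta_impE) auto
      show ?thesis
        unfolding c_def
      proof (rule spread_copies_undetermined[OF k tree contr over finF Fne lab, where \<eta> = "eta k" and Z = Z])
        show "\<delta> * real (card F) \<le> real (card Z)"
          using Z(2) A(2) \<delta>le mult_right_mono[of \<delta> \<delta>1 "real (card F)"] by simp
        show "1 < card (fiber Z (?R1 - {p}) z)" if z: "z \<in> Z" "p < k" for z p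
        proof -
          obtain e where "e \<in> Fh" "z = lab e" using z Z by blast
          then have "M < real (card (fiber A (?R1 - {p}) z))" using z by (simp add: Fh_def)
          then have "\<delta>1 * M < \<delta>1 * real (card (fiber A (?R1 - {p}) z))" using \<delta>1 by simp
          also have "\<dots> \<le> real (card (fiber Z (?R1 - {p}) z))" using fib z by auto
          finally show ?thesis using \<delta>1 by (simp add: M_def)
        qed
        show "\<delta> * ?m \<le> real (card (fiber Z P z))" if z: "z \<in> Z" "P \<subseteq> ?R1" "card P \<le> l" for z P
        proof (rule scaled[OF _ _ z(3)])
          show "\<delta>1 * real (card F) \<le> real (card (fiber Z P z)) * real n ^ card P"
            using fib[rule_format, OF z(1,2)] A(2) by simp
        qed (use l in auto)
        show "eta k * (real k)\<^sup>2 * real (card H) \<le> 1 / (2 * real (card H))" using eta(3)[OF r1] by (simp add: t_def)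
      qed (use Z Fh hom \<delta> m eta(1)[OF r1] in auto)
    next
      case False
      define G where "G = F - Fh"
      have G: "G \<subseteq> F" by (auto simp: G_def)
      have cG: "(1 - \<theta>) * real (card F) \<le> real (card G)"
        using False Fh finF by (simp add: G_def card_Diff_subset of_nat_diff card_mono algebra_simps)
      have "\<forall>e\<in>G. \<exists>p. p < k \<and> real (card (fiber A (?R1 - {p}) (lab e))) \<le> M"
        by (auto simp: G_def Fh_def not_less)
      from bchoice[OF this] obtain p where p: "\<forall>e\<in>G. p e < k \<and> real (card (fiber A (?R1 - {p e}) (lab e))) \<le> M"
        by (rule exE)
      have p': "p e < k \<and> real (card (fiber (lab ` F) (?R1 - {p e}) (lab e))) \<le> M" if "e \<in> G" for e
        using p that by (simp add: A_def)
      have "\<exists>\<D>\<subseteq>{X. X \<subseteq> {1..n} \<and> card X = k - 1}.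
          real (card G) \<le> (real s - 1) * real (n choose (k - 1)) + M' * real (card \<D>) \<and>
          real (card G) \<le> M' * real (n choose (k - 1)) \<and>
          (\<forall>X\<in>\<D>. \<exists>y. inj_on y {..<s} \<and> (\<forall>j<s. y j \<notin> X \<and> insert (y j) X \<in> F))"
        unfolding M'_def
        by (rule popular_cores[OF r1 s less_imp_le[OF M] F(2) finF conjunct1[OF lab] G p'])
      then obtain \<D> where \<D>: "\<D> \<subseteq> {X. X \<subseteq> {1..n} \<and> card X = k - 1}"
        and G1: "real (card G) \<le> (real s - 1) * real (n choose (k - 1)) + M' * real (card \<D>)"
        and G2: "real (card G) \<le> M' * real (n choose (k - 1))"
        and ext: "\<forall>X\<in>\<D>. \<exists>y. inj_on y {..<s} \<and> (\<forall>j<s. y j \<notin> X \<and> insert (y j) X \<in> F)"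
        by (elim exE conjE) (rule that)
      have fin\<D>: "finite \<D>" by (rule finite_subset[OF \<D>]) simp
      have dense: "\<gamma> * real (card F) \<le> real (card \<D>)"
      proof -
        let ?N = "real (n choose (k - 1))"
        \<comment> \<open>Every core carries at most \<open>M'\<close> edges of \<open>G\<close>, so
          \<open>a\<close> is bounded in this case.\<close>
        have "(1 - \<theta>) * a * ?N \<le> M' * ?N" using cG G2 cardF by (simp add: mult.assoc)
        then have "(1 - \<theta>) * a \<le> M'" using choose0 by simp
        moreover have "1 / 2 * a \<le> (1 - \<theta>) * a" using \<theta> a0 by (intro mult_right_mono) auto
        ultimately have aM: "a \<le> 2 * M'" by linarith
        have "\<theta> * (real s - 1 + \<epsilon>) \<le> \<theta> * (real s + \<epsilon>)" using \<theta> by (intro mult_left_mono) auto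
        also have "\<dots> = \<epsilon> / 2"
        proof -
          have "0 < real s + \<epsilon>" using \<epsilon> by (simp add: add_nonneg_pos)
          then show ?thesis unfolding \<theta>_def by (simp add: field_simps)
        qed
        finally have "real s - 1 + \<epsilon> / 2 \<le> (1 - \<theta>) * (real s - 1 + \<epsilon>)" by (simp add: algebra_simps)
        also have "\<dots> \<le> (1 - \<theta>) * a" using \<theta> a by (intro mult_left_mono) auto
        finally have "(real s - 1 + \<epsilon> / 2) * ?N \<le> (1 - \<theta>) * a * ?N" using choose0 by (intro mult_right_mono) auto
        also have "\<dots> \<le> (real s - 1) * ?N + M' * real (card \<D>)" using cG G1 cardF by (simp add: mult.assoc)
        finally have e: "\<epsilon> / 2 * ?N \<le> M' * real (card \<D>)" by (simp add: algebra_simps)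
        have "\<epsilon> * real (card F) \<le> \<epsilon> * (2 * M' * ?N)"
          unfolding cardF using \<epsilon> aM choose0 by (intro mult_left_mono mult_right_mono) auto
        also have "\<dots> = 4 * M' * (\<epsilon> / 2 * ?N)" by simp
        also have "\<dots> \<le> 4 * M' * (M' * real (card \<D>))" using e M' by (intro mult_left_mono) auto
        also have "\<dots> = 4 * M' ^ 2 * real (card \<D>)" by (simp add: power2_eq_square)
        finally have "\<epsilon> / (4 * M' ^ 2) * real (card F) \<le> real (card \<D>)"
          using M' by (simp add: pos_divide_le_eq mult.commute)
        moreover have "\<gamma> * real (card F) \<le> \<epsilon> / (4 * M' ^ 2) * real (card F)"
          by (intro mult_right_mono) (auto simp: \<gamma>_def)
        ultimately show ?thesis by linarith
      qed
      have "\<forall>X\<in>\<D>. \<exists>z. inj_on z ?R2 \<and> z ` {..<k - 1} = X \<and> (\<forall>j<s. insert (z (k - 1 + j)) X \<in> F)"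
      proof
        fix X assume X: "X \<in> \<D>"
        then obtain y where y: "inj_on y {..<s}" "\<And>j. j < s \<Longrightarrow> y j \<notin> X \<and> insert (y j) X \<in> F" using ext by blast
        have Xn: "X \<subseteq> {1..n}" "card X = k - 1" using X \<D> by auto
        have "finite X" by (rule finite_subset[OF Xn(1)]) simp
        then obtain b where b: "bij_betw b {..<k - 1} X"
          using ex_bij_betw_nat_finite[of X] Xn(2) by (auto simp: atLeast0LessThan)
        define z where "z i = (if i < k - 1 then b i else y (i - (k - 1)))" for i
        have im: "z ` {..<k - 1} = X" using b by (auto simp: z_def bij_betw_def)
        have "inj_on z ?R2"
        proof (rule inj_onI)
          fix i j assume ij: "i \<in> ?R2" "j \<in> ?R2" "z i = z j"
          have out: "z i \<notin> X" if "\<not> i < k - 1" "i \<in> ?R2" for i using that y(2)[of "i - (k - 1)"] by (auto simp: z_def)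
          have inn: "z i \<in> X" if "i < k - 1" for i using im that by blast
          have same: "i < k - 1 \<longleftrightarrow> j < k - 1" using ij out[of i] out[of j] inn[of i] inn[of j] by metis
          show "i = j"
          proof (cases "i < k - 1")
            case True
            then have "b i = b j" using same ij by (simp add: z_def)
            then show ?thesis using b True same by (auto simp: bij_betw_def dest: inj_onD)
          next
            case False
            then have "y (i - (k - 1)) = y (j - (k - 1))" using same ij by (simp add: z_def)
            then have "i - (k - 1) = j - (k - 1)" by (rule inj_onD[OF y(1)]) (use ij False same in auto)
            then show ?thesis using False same by simp
          qed
        qed
        moreover have "\<forall>j<s. insert (z (k - 1 + j)) X \<in> F" using y(2) by (simp add: z_def)
        ultimately show "\<exists>z. inj_on z ?R2 \<and> z ` {..<k - 1} = X \<and> (\<forall>j<s. insert (z (k - 1 + j)) X \<in> F)"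
          using im by blast
      qed
      from bchoice[OF this] obtain zt where
        "\<forall>X\<in>\<D>. inj_on (zt X) ?R2 \<and> zt X ` {..<k - 1} = X \<and> (\<forall>j<s. insert (zt X (k - 1 + j)) X \<in> F)" by (rule exE)
      then have zt: "inj_on (zt X) ?R2" "zt X ` {..<k - 1} = X" "\<And>j. j < s \<Longrightarrow> insert (zt X (k - 1 + j)) X \<in> F"
        if "X \<in> \<D>" for X using that by auto
      define B where "B = zt ` \<D>"
      have "inj_on zt \<D>"
      proof (rule inj_onI)
        fix X Y assume XY: "X \<in> \<D>" "Y \<in> \<D>" "zt X = zt Y"
        then have "zt X ` {..<k - 1} = zt Y ` {..<k - 1}" by simp
        then show "X = Y" unfolding zt(2)[OF XY(1)] zt(2)[OF XY(2)] .
      qed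
      then have B: "finite B" "card B = card \<D>" using fin\<D> by (auto simp: B_def card_image)
      have BV: "\<forall>z\<in>B. z ` ?R2 \<subseteq> {1..n}"
      proof (intro ballI image_subsetI)
        fix z i assume "z \<in> B" and i: "i \<in> ?R2"
        then obtain X where X: "X \<in> \<D>" "z = zt X" by (auto simp: B_def)
        show "z i \<in> {1..n}"
        proof (cases "i < k - 1")
          case True
          then have "z i \<in> X" using zt(2)[OF X(1)] X(2) by blast
          then show ?thesis using X(1) \<D> by blast
        next
          case False
          then have "insert (zt X i) X \<in> F" using zt(3)[OF X(1), of "i - (k - 1)"] i by auto
          then show ?thesis using F(2) X(2) by blast
        qed
      qed
      obtain Z where Z: "Z \<subseteq> B" "\<delta>2 * real (card B) \<le> real (card Z)"
        and fib: "\<forall>z\<in>Z. \<forall>P\<subseteq>?R2. \<delta>2 * real (card (fiber B P z)) \<le> real (card (fiber Z P z)) \<and>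
          \<delta>2 * real (card B) \<le> real (card (fiber Z P z)) * real (card {1..n}) ^ card P"
        and hom: "\<forall>P\<subseteq>?R2. \<forall>p\<in>?R2. determines Z P p \<or> light (eta (k - 1 + s)) Z P p"
        using hom2[OF B(1) subset_refl _ V BV] by (elim exE conjE meta_impE) auto
      have tuple: "\<exists>X\<in>\<D>. z = zt X" if "z \<in> Z" for z using that Z(1) by (auto simp: B_def)
      have BF: "\<delta>2 * \<gamma> * real (card F) \<le> \<delta>2 * real (card B)"
        using dense B(2) \<delta>2 by (simp add: mult.assoc)
      have sc: "\<delta> * (a * real n ^ (k - 1 - q)) \<le> real (card (fiber Z P z))"
        if z: "z \<in> Z" "P \<subseteq> ?R2" "card P \<le> q" "q \<le> k - 1" for z P q
      proof (rule scaled[OF _ _ z(3,4)])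
        show "\<delta>2 * \<gamma> * real (card F) \<le> real (card (fiber Z P z)) * real n ^ card P"
          using fib[rule_format, OF z(1,2)] BF by simp
      qed auto
      show ?thesis
        unfolding c_def
      proof (rule spread_copies_cross_cut[OF k tree contr over S finF Fne F(1), where \<eta> = "eta (k - 1 + s)" and Z = Z])
        show "finite Z" using Z(1) B(1) by (rule finite_subset)
        have "\<delta> * real (card F) \<le> \<delta>2 * \<gamma> * real (card F)" using \<delta>le by (intro mult_right_mono) auto
        then show "\<delta> * real (card F) \<le> real (card Z)" using Z(2) BF by linarith
        show "inj_on z ?R2" if "z \<in> Z" for z using tuple[OF that] zt(1) by auto
        show "z = z'" if z: "z \<in> Z" "z' \<in> Z" "z ` {..<k - 1} = z' ` {..<k - 1}" for z z'
        proof -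
          obtain X Y where "X \<in> \<D>" "z = zt X" "Y \<in> \<D>" "z' = zt Y" using tuple z by meson
          then show ?thesis using z(3) zt(2)[of X] zt(2)[of Y] by simp
        qed
        show "z ` insert (k - 1 + j) {..<k - 1} \<in> F" if z: "z \<in> Z" "j < s" for z j
        proof -
          obtain X where X: "X \<in> \<D>" "z = zt X" using tuple[OF z(1)] by blast
          then show ?thesis using zt(3)[OF X(1) z(2)] zt(2)[OF X(1)] by simp
        qed
        show "1 < card (fiber Z P z)" if z: "z \<in> Z" "P \<subseteq> ?R2" "card P \<le> k - 2" for z P
        proof -
          \<comment> \<open>This is the purpose of the lower bound
            \<open>1 / (\<delta> * \<epsilon>)\<close> on \<open>n\<close>: with
            \<open>k - 2\<close> entries fixed, at least \<open>\<delta> * a * n > 1\<close> tuples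
            remain.\<close>
          have "\<delta> * (a * real n ^ (k - 1 - (k - 2))) \<le> real (card (fiber Z P z))" by (rule sc[OF z]) simp
          moreover have "k - 1 - (k - 2) = 1" using k by simp
          ultimately have "\<delta> * (a * real n) \<le> real (card (fiber Z P z))" by simp
          moreover have "1 < \<delta> * \<epsilon> * real n" using n(2) \<delta> \<epsilon> by (simp add: pos_divide_less_eq mult.commute)
          moreover have "\<delta> * \<epsilon> * real n \<le> \<delta> * a * real n" using \<delta> a\<epsilon> by (intro mult_right_mono mult_left_mono) auto
          ultimately show ?thesis by (simp add: mult.assoc)
        qed
        show "\<delta> * ?m \<le> real (card (fiber Z P z))" if z: "z \<in> Z" "P \<subseteq> ?R2" "card P \<le> l" for z P
          by (rule sc[OF z]) (use l in simp)
        show "eta (k - 1 + s) * (real (k - 1 + s))\<^sup>2 * real (card H) \<le> 1 / (2 * real (card H))"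
          using eta(3)[OF r2] by (simp add: t_def)
        show "0 \<le> eta (k - 1 + s)" using eta(1)[OF r2] by simp
      qed (use hom \<delta> m in auto)
    qed
  qed
  have ev: "\<forall>\<^sub>F n in sequentially. k \<le> n \<and> 1 / (\<delta> * \<epsilon>) < real n"
    using filterlim_real_sequentially
    by (intro eventually_conj eventually_ge_at_top) (simp add: filterlim_at_top_dense)
  show ?thesis
    using c main by (intro exI[of _ c] conjI eventually_mono[OF ev] allI impI) (auto simp: s_def)
qed

section \<open>From spread weights to the collection of copies\<close>

lemma card_copy:
  assumes "C \<in> copies H F"
  shows "card C = card H"
proof -
  obtain f where f: "inj_on f (\<Union>H)" "(\<lambda>E. f ` E) ` H = C"
    using assms by (auto simp: copies_def hypergraph_isomorphic_def bij_betw_def)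
  have "inj_on (\<lambda>E. f ` E) H"
    by (rule inj_on_subset[OF inj_on_image_Pow[OF f(1)]]) auto
  then show ?thesis unfolding f(2)[symmetric] by (rule card_image)
qed

text \<open>The vertices of degree 1 in an edge, at least two of them, lie in no other edge.\<close>

lemma two_contractible_overlapping:
  assumes "k_tree k H" "two_contractible H"
  shows "overlapping (k - 2) H"
  unfolding overlapping_def
proof (intro ballI impI)
  fix E F assume EF: "E \<in> H" "F \<in> H" "E \<noteq> F"
  define U where "U = {v \<in> E. degree H v = 1}"
  have E: "finite E" "card E = k" using assms(1) EF by (auto simp: k_tree_def uniform_hypergraph_def)
  have "E \<inter> F \<subseteq> E - U" using degree_one_unique[of H _ E F] EF by (auto simp: U_def)
  then have "card (E \<inter> F) \<le> card (E - U)" using E by (intro card_mono) auto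
  also have "\<dots> = k - card U" using E by (simp add: U_def card_Diff_subset)
  also have "\<dots> \<le> k - 2" using assms(2) EF by (intro diff_le_mono2) (simp add: two_contractible_def U_def)
  finally show "card (E \<inter> F) \<le> k - 2" .
qed

theorem theorem5p4:
  fixes k l t :: nat and \<epsilon> :: real and H :: "'v set set"
  assumes "k \<ge> 4"
    and "\<epsilon> > 0"
    and "k_tree k H"
    and "two_contractible H"
    and "overlapping l H"
    and "card H = t"
  shows "\<exists>c>0. \<exists>c'>0. \<forall>\<^sub>F n in sequentially. \<forall>(F :: nat set set) (a :: real).
    uniform_hypergraph k F \<longrightarrow> \<Union>F \<subseteq> {1..n} \<longrightarrow>
    real (card F) = a * real (n choose (k - 1)) \<longrightarrow>
    a \<ge> real (cross_cut_number H) - 1 + \<epsilon> \<longrightarrow>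
    (\<exists>K \<subseteq> copies H F.
      real (card K) \<ge>
        c' * a * real n ^ (k - 1) * (a * real n powi (int k - int l - 1)) ^ (t - 1) \<and>
      (\<forall>b\<in>{1..t}.
        let \<tau> = 1 / (a * real n powi (int k - int l - 1)) in
        real (max_codegree F K b) \<le> c * \<tau> ^ (b - 1) * (real (card K) / real (card F))))"
proof -
  \<comment> \<open>\<open>l\<close> may exceed \<open>k - 2\<close>, and then the exponent
    \<open>k - l - 1\<close> can be zero or negative. Working with \<open>l0\<close> gives a natural
    exponent \<open>k - 1 - l0 \<ge> 1\<close> and a scale at least as large, from which the claim
    for \<open>l\<close> follows because \<open>n \<ge> 1\<close>.\<close>
  define l0 where "l0 = min l (k - 2)"
  have over: "overlapping l0 H"
    using assms(5) two_contractible_overlapping[OF assms(3,4)] by (simp add: overlapping_def l0_def)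
  have l0: "l0 \<le> k - 2" "l0 \<le> l" by (auto simp: l0_def)
  have k2: "2 \<le> k" using assms(1) by simp
  obtain c0 where c0: "0 < c0" and ev0: "\<forall>\<^sub>F n in sequentially. \<forall>(F :: nat set set) (a :: real).
    uniform_hypergraph k F \<longrightarrow> \<Union>F \<subseteq> {1..n} \<longrightarrow>
    real (card F) = a * real (n choose (k - 1)) \<longrightarrow>
    a \<ge> real (cross_cut_number H) - 1 + \<epsilon> \<longrightarrow>
    spread_copies H F c0 (a * real n ^ (k - 1 - l0))"
    using dense_spread_copies[OF k2 assms(2-4) over l0(1)] by (elim exE conjE) (rule that)
  have HT: "hypertree H" using assms(3) by (simp add: k_tree_def)
  have t: "1 \<le> t" using finite_hypertree[OF HT] hypertree_nonempty[OF HT] assms(6)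
    by (simp add: Suc_le_eq card_gt_0_iff flip: assms(6))
  have s: "1 \<le> cross_cut_number H" using cross_cut_number_attained(2)[OF assms(3,4)] .
  \<comment> \<open>\<open>4 * c0 * 2 ^ t\<close> is the loss in extracting a balanced collection;
    the factor \<open>(k - 1) ^ (k - 1)\<close> in \<open>c'\<close> comes from the lower bound on
    the binomial coefficient.\<close>
  define c where "c = 4 * c0 * 2 ^ t"
  define c' where "c' = 1 / (real (k - 1) ^ (k - 1) * c)"
  have c: "0 < c" using c0 by (simp add: c_def)
  have c': "0 < c'" using c k2 by (simp add: c'_def)
  have ev: "\<forall>\<^sub>F n in sequentially. k \<le> n \<and> 1 / \<epsilon> < real n"
    using filterlim_real_sequentially
    by (intro eventually_conj eventually_ge_at_top) (simp add: filterlim_at_top_dense)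
  have main: "\<exists>K \<subseteq> copies H F.
      real (card K) \<ge>
        c' * a * real n ^ (k - 1) * (a * real n powi (int k - int l - 1)) ^ (t - 1) \<and>
      (\<forall>b\<in>{1..t}.
        let \<tau> = 1 / (a * real n powi (int k - int l - 1)) in
        real (max_codegree F K b) \<le> c * \<tau> ^ (b - 1) * (real (card K) / real (card F)))"
    if n: "k \<le> n" "1 / \<epsilon> < real n" and F: "\<Union>F \<subseteq> {1..n}"
      and cardF: "real (card F) = a * real (n choose (k - 1))"
      and a: "a \<ge> real (cross_cut_number H) - 1 + \<epsilon>"
      and spr: "spread_copies H F c0 (a * real n ^ (k - 1 - l0))" for n a and F :: "nat set set"
  proof -
    define m where "m = a * real n ^ (k - 1 - l0)"
    define m' where "m' = a * real n powi (int k - int l - 1)"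
    have n1: "1 \<le> real n" using n k2 by simp
    have a\<epsilon>: "\<epsilon> \<le> a" using a s by simp
    have a0: "0 < a" using a\<epsilon> assms(2) by simp
    \<comment> \<open>The caps \<open>m ^ j\<close> have to be at least 1, which
      \<open>n > 1 / \<epsilon>\<close> and \<open>a \<ge> \<epsilon>\<close> ensure.\<close>
    have m1: "1 \<le> m"
    proof -
      have "1 \<le> \<epsilon> * real n" using n(2) assms(2) by (simp add: pos_divide_less_eq mult.commute)
      also have "\<dots> \<le> a * real n ^ (k - 1 - l0)"
      proof (intro mult_mono a\<epsilon>)
        have "real n ^ 1 \<le> real n ^ (k - 1 - l0)" using n1 l0 k2 by (intro power_increasing) auto
        then show "real n \<le> real n ^ (k - 1 - l0)" by simp
      qed (use a0 in auto)
      finally show ?thesis by (simp add: m_def)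
    qed
    have m'0: "0 < m'" using a0 n1 by (simp add: m'_def)
    have m'm: "m' \<le> m"
    proof -
      have "real n powi (int k - int l - 1) \<le> real n powi (int (k - 1 - l0))"
        using n1 l0 k2 by (intro power_int_increasing) auto
      then show ?thesis using a0 by (simp add: m_def m'_def power_int_of_nat)
    qed
    have finF: "finite F" by (rule finite_subset[of _ "Pow {1..n}"]) (use F in auto)
    have F0: "0 < real (card F)" using cardF a0 n by simp
    then have Fne: "F \<noteq> {}" by auto
    obtain w where w: "\<forall>C. 0 \<le> w C" "1 / 2 \<le> (\<Sum>C\<in>copies H F. w C)"
      and ws: "\<forall>S\<subseteq>F. S \<noteq> {} \<longrightarrow> card S \<le> card H \<longrightarrow>
        (\<Sum>C\<in>{C \<in> copies H F. S \<subseteq> C}. w C) \<le> c0 / real (card F) * (1 / m) ^ (card S - 1)"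
      using spr[folded m_def] unfolding spread_copies_def by (elim exE conjE) (rule that)
    have "\<exists>K\<subseteq>copies H F. real (card F) * m ^ (t - 1) \<le> 4 * c0 * 2 ^ t * real (card K) \<and>
      (\<forall>S\<subseteq>F. S \<noteq> {} \<longrightarrow> card S \<le> t \<longrightarrow> real (card {C \<in> K. S \<subseteq> C}) \<le> m ^ (t - card S))"
    proof (rule balanced_subcollection[OF finF Fne _ t m1 c0 _ w(2)])
      fix C assume "C \<in> copies H F"
      then show "C \<subseteq> F \<and> card C = t" using card_copy assms(6) by (auto simp: copies_def)
    qed (use w ws assms(6) in auto)
    then obtain K where K: "K \<subseteq> copies H F" and Kbig: "real (card F) * m ^ (t - 1) \<le> c * real (card K)"
      and cap: "\<forall>S\<subseteq>F. S \<noteq> {} \<longrightarrow> card S \<le> t \<longrightarrow> real (card {C \<in> K. S \<subseteq> C}) \<le> m ^ (t - card S)"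
      unfolding c_def[symmetric] by (elim exE conjE) (rule that)
    have lower: "c' * a * real n ^ (k - 1) * m' ^ (t - 1) \<le> real (card K)"
    proof -
      have "(real n / real (k - 1)) ^ (k - 1) \<le> real (n choose (k - 1))"
        using n by (intro binomial_ge_n_over_k_pow_k) simp
      then have "a * (real n / real (k - 1)) ^ (k - 1) * m' ^ (t - 1) \<le> real (card F) * m ^ (t - 1)"
        unfolding cardF using a0 m'0 m'm by (intro mult_mono power_mono) auto
      also have "\<dots> \<le> c * real (card K)" by (rule Kbig)
      finally have "a * (real n / real (k - 1)) ^ (k - 1) * m' ^ (t - 1) / c \<le> real (card K)"
        using c by (simp add: pos_divide_le_eq mult.commute)
      then show ?thesis by (simp add: c'_def power_divide mult_ac)
    qed
    have K0: "0 < real (card K)"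
    proof -
      have "0 < c * real (card K)" using Kbig F0 m1 by (smt (verit) mult_pos_pos zero_less_power)
      then show ?thesis using c by (simp add: zero_less_mult_iff)
    qed
    \<comment> \<open>A member of \<open>K\<close> shows that \<open>F\<close> has at least
      \<open>t\<close> edges, so the maximum in \<open>max_codegree\<close> is over a nonempty set
      for every \<open>b \<le> t\<close>.\<close>
    then obtain C where "C \<in> K" by (metis card.empty equals0I less_irrefl of_nat_0)
    then have CK: "C \<in> copies H F" using K by blast
    have C: "C \<subseteq> F" "card C = t" using CK card_copy[OF CK] assms(6) by (auto simp: copies_def)
    have upper: "real (max_codegree F K b) \<le> c * (1 / m') ^ (b - 1) * (real (card K) / real (card F))"
      if b: "b \<in> {1..t}" for b
    proof -
      let ?X = "(\<lambda>S. card {C \<in> K. S \<subseteq> C}) ` {S. S \<subseteq> F \<and> card S = b}"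
      obtain T where "T \<subseteq> C" "card T = b" using obtain_subset_with_card_n[of b C] C b by auto
      then have "?X \<noteq> {}" using C by auto
      moreover have "finite ?X" using finF by simp
      ultimately have "max_codegree F K b \<in> ?X" unfolding max_codegree_def by (intro Max_in)
      then obtain S where S: "S \<subseteq> F" "card S = b" "max_codegree F K b = card {C \<in> K. S \<subseteq> C}" by auto
      have "S \<noteq> {}" using S(2) b by auto
      then have "real (max_codegree F K b) \<le> m ^ (t - b)" using cap S b by auto
      \<comment> \<open>The cap is rewritten to expose \<open>m ^ (t - 1)\<close>, which is at most
        \<open>c * card K / card F\<close>; replacing \<open>1 / m\<close> by the larger
        \<open>1 / m'\<close> then gives the bound in terms of \<open>l\<close>.\<close>
      also have "\<dots> = (1 / m) ^ (b - 1) * m ^ (t - 1)"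
      proof -
        have e: "t - 1 = (b - 1) + (t - b)" using b by auto
        show ?thesis unfolding e power_add using m1 by (simp add: power_one_over)
      qed
      also have "\<dots> \<le> (1 / m') ^ (b - 1) * (c * (real (card K) / real (card F)))"
      proof (intro mult_mono power_mono)
        show "1 / m \<le> 1 / m'" using m'0 m'm by (intro frac_le) auto
        show "m ^ (t - 1) \<le> c * (real (card K) / real (card F))"
          using Kbig F0 by (simp add: pos_le_divide_eq mult.commute)
      qed (use m1 m'0 in auto)
      finally show ?thesis by (simp add: mult_ac)
    qed
    show ?thesis
      using K lower upper unfolding m'_def Let_def by (intro exI[of _ K] conjI ballI)
  qed
  show ?thesis
  proof (rule exI[of _ c], rule conjI[OF c], rule exI[of _ c'], rule conjI[OF c'],
      rule eventually_mono[OF eventually_conj[OF ev ev0]])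
    fix n assume n: "(k \<le> n \<and> 1 / \<epsilon> < real n) \<and> (\<forall>(F :: nat set set) (a :: real).
      uniform_hypergraph k F \<longrightarrow> \<Union>F \<subseteq> {1..n} \<longrightarrow>
      real (card F) = a * real (n choose (k - 1)) \<longrightarrow>
      a \<ge> real (cross_cut_number H) - 1 + \<epsilon> \<longrightarrow>
      spread_copies H F c0 (a * real n ^ (k - 1 - l0)))"
    show "\<forall>(F :: nat set set) (a :: real).
      uniform_hypergraph k F \<longrightarrow> \<Union>F \<subseteq> {1..n} \<longrightarrow>
      real (card F) = a * real (n choose (k - 1)) \<longrightarrow>
      a \<ge> real (cross_cut_number H) - 1 + \<epsilon> \<longrightarrow>
      (\<exists>K \<subseteq> copies H F.
        real (card K) \<ge>
          c' * a * real n ^ (k - 1) * (a * real n powi (int k - int l - 1)) ^ (t - 1) \<and>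
        (\<forall>b\<in>{1..t}.
          let \<tau> = 1 / (a * real n powi (int k - int l - 1)) in
          real (max_codegree F K b) \<le> c * \<tau> ^ (b - 1) * (real (card K) / real (card F))))"
      using n by (intro allI impI main) blast+
  qed
qed

end
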